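(* Let $r\ge1$ be an integer, let $\mathbf z=(z_1,\dots,z_r)\in\mathbb C^r$ with every $z_i$ a root of unity, and let $\mathbf a=(a_1,\dots,a_r)\in\mathbb Z^r$. Then the formal power series $$\sum_{k_1,\dots,k_r\ge0}\frac{(-1)^{k_1+\cdots+k_r}}{k_1!\cdots k_r!}\,\ell^{(a_1,\dots,a_r)}_{[k_1,\dots,k_r]}(\mathbf z)\,(s_1-a_1)^{k_1}\cdots(s_r-a_r)^{k_r}$$ converges in a neighbourhood of $\mathbf a$ and extends to a meromorphic function on $\mathbb C^r$. Denoting it by $\mathrm{Li}^{\mathrm{Reg}}_{(\mathbf z;\mathbf a)}(s_1,\dots,s_r)$, we have the equality of meromorphic functions $$\mathrm{Li}^{\mathrm{Reg}}_{(\mathbf z;\mathbf a)}(s_1,\dots,s_r)=\sum_{i=0}^r(-1)^i\,\mathrm{Li}_{(z_{i+1},\dots,z_r)}(s_{i+1},\dots,s_r)\,C_i(s_1,\dots,s_i),$$ where $C_0:=1$ and for $1\le i\le r$ $$C_i(s_1,\dots,s_i):=q_{[1,i]}\sum_{\substack{k_1,\dots,k_i\ge0\\ \sum_{t=1}^i(k_t+a_t)=Q_{[1,i]}}}\frac{1}{k_1!\cdots k_i!}\prod_{j\in J'_i}\frac{\overline{z_{[j,i]}}\,A^\star_{k_j}(\overline{z_{[j,i]}})}{(\overline{z_{[j,i]}}-1)^{k_j+1}}\prod_{j\in J_i}B^\star_{k_j}\prod_{j=1}^{i}\big(s_i+s_{i-1}+\cdots+s_j+k_i+\cdots+k_{j+1}-Q_{[j+1,i]}\big)_{k_j-q_{[j,i]}},$$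 with the convention $Q_{[i+1,i]}=0$ (so the factor for $j=i$ is $(s_i)_{k_i-q_{[i,i]}}$).
   Context: Notation: $\mathbb N$ = non-negative integers; $z_{[j,i]}:=\prod_{k=j}^iz_k$; $\overline{w}$ is complex conjugation. For roots of unity $w_1,\dots,w_d$, $\mathrm{Li}_{(w_1,\dots,w_d)}(s_1,\dots,s_d):=\sum_{n_1>\cdots>n_d>0}\frac{w_1^{n_1}\cdots w_d^{n_d}}{n_1^{s_1}\cdots n_d^{s_d}}$ on $\{\Re(s_1+\cdots+s_i)>i\ \forall i\}$, extended (as is known) meromorphically to $\mathbb C^d$; the depth-$0$ function is $1$. Regularised values: let $\mathcal C_{\mathbf z}$ be the $\mathbb C$-algebra of sequences generated by $(1)_{n\ge1}$ and $(z_i^n)_{n\ge1}$, with basis $\mathcal B_{\mathbf z}$ consisting of the sequences $(\xi^n)_{n\ge1}$, $\xi$ running over the distinct values of monomials $z_1^{k_1}\cdots z_r^{k_r}$. For $\mathbf a\in\mathbb Z^r,\mathbf k\in\mathbb N^r$, the partial sums $S_N=\sum_{N>n_1>\cdots>n_r>0}\frac{z_1^{n_1}(\log n_1)^{k_1}\cdots z_r^{n_r}(\log n_r)^{k_r}}{n_1^{a_1}\cdots n_r^{a_r}}$ admit as $N\to\infty$ a (unique) expansion $S_N=\sum_{(l,m)\in F}u_{l,m}(N)(\log N)^lN^m+o(1)$, $F\subset\mathbb N\times\mathbb N$ finite, $u_{l,m}\in\mathcal C_{\mathbf z}$; $\ell^{(a_1,\dots,a_r)}_{[k_1,\dots,k_r]}(\mathbf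 z)$ is the coefficient of the constant sequence in the expansion of $u_{0,0}$ in the basis $\mathcal B_{\mathbf z}$. Combinatorial notation: for $1\le j\le i\le r$, $q_{[j,i]}:=1$ if $z_{[j,i]}=1$ and $0$ otherwise; $Q_{[j,i]}:=q_{[j,i]}+q_{[j+1,i]}+\cdots+q_{[i,i]}$; $J_i:=\{j:1\le j\le i,\ z_{[j,i]}=1\}$, $J'_i:=\{j:1\le j\le i,\ z_{[j,i]}\ne1\}$. Special numbers: the Eulerian polynomials $A_n(t)$ are defined for $t\ne1$ by $\frac{1-t}{e^{(t-1)y}-t}=\sum_{n\ge0}A_n(t)\frac{y^n}{n!}$, and $A^\star_n(c):=(-1)^nA_n(c)$ (so $A^\star_0=1$). The star Bernoulli numbers are defined by $\frac{x}{e^x-1}=\sum_{k\ge0}\frac{(-1)^kB^\star_k}{k!}x^k$. Pochhammer symbol: $(x)_k=x(x+1)\cdots(x+k-1)$ for $k\ge0$ ($(x)_0=1$), and $(x)_{-1}:=\frac{1}{x-1}$. *)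

theory Defs
  imports "HOL-Analysis.Analysis" "HOL-Computational_Algebra.Formal_Power_Series"
begin

definition cspace :: "nat \<Rightarrow> (nat \<Rightarrow> complex) set" where
  "cspace n = {s. \<forall>i\<ge>n. s i = 0}"

definition polydisc :: "nat \<Rightarrow> (nat \<Rightarrow> complex) \<Rightarrow> real \<Rightarrow> (nat \<Rightarrow> complex) set" where
  "polydisc n p e = {s. (\<forall>i<n. cmod (s i - p i) < e) \<and> (\<forall>i\<ge>n. s i = 0)}"

definition multi_idx :: "nat \<Rightarrow> (nat \<Rightarrow> nat) set" where
  "multi_idx n = {k. \<forall>i\<ge>n. k i = 0}"

definition c_analytic_at :: "nat \<Rightarrow> ((nat \<Rightarrow> complex) \<Rightarrow> complex) \<Rightarrow> (nat \<Rightarrow> complex) \<Rightarrow> bool" where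
  "c_analytic_at n f p \<longleftrightarrow> (\<exists>e>0. \<exists>c :: (nat \<Rightarrow> nat) \<Rightarrow> complex.
      \<forall>s\<in>polydisc n p e. ((\<lambda>k. c k * (\<Prod>i<n. (s i - p i) ^ k i)) has_sum f s) (multi_idx n))"

definition c_meromorphic :: "nat \<Rightarrow> ((nat \<Rightarrow> complex) \<Rightarrow> complex) \<Rightarrow> bool" where
  "c_meromorphic n f \<longleftrightarrow> (\<forall>p\<in>cspace n. \<exists>e>0. \<exists>g h.
      (\<forall>q\<in>polydisc n p e. c_analytic_at n g q \<and> c_analytic_at n h q) \<and>
      (\<exists>q\<in>polydisc n p e. h q \<noteq> 0) \<and>
      (\<forall>q\<in>polydisc n p e. h q \<noteq> 0 \<longrightarrow> f q = g q / h q))"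

definition mero_eq :: "nat \<Rightarrow> ((nat \<Rightarrow> complex) \<Rightarrow> complex) \<Rightarrow> ((nat \<Rightarrow> complex) \<Rightarrow> complex) \<Rightarrow> bool" where
  "mero_eq n f g \<longleftrightarrow> (\<exists>U. U \<subseteq> cspace n \<and>
      (\<forall>p\<in>U. \<exists>e>0. polydisc n p e \<subseteq> U) \<and>
      (\<forall>p\<in>cspace n. \<forall>e>0. polydisc n p e \<inter> U \<noteq> {}) \<and>
      (\<forall>s\<in>U. f s = g s))"

definition decr_tuples :: "nat \<Rightarrow> (nat \<Rightarrow> nat) set" where
  "decr_tuples d = {n. (\<forall>i<d. 0 < n i) \<and> (\<forall>i. Suc i < d \<longrightarrow> n (Suc i) < n i) \<and> (\<forall>i\<ge>d. n i = 0)}"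

definition Li_series :: "nat \<Rightarrow> (nat \<Rightarrow> complex) \<Rightarrow> (nat \<Rightarrow> complex) \<Rightarrow> complex" where
  "Li_series d w s = (\<Sum>\<^sub>\<infinity>n\<in>decr_tuples d. \<Prod>i<d. w i ^ n i / (of_nat (n i)) powr (s i))"

definition Li_domain :: "nat \<Rightarrow> (nat \<Rightarrow> complex) set" where
  "Li_domain d = {s\<in>cspace d. \<forall>j. 1 \<le> j \<and> j \<le> d \<longrightarrow> Re (\<Sum>t<j. s t) > real j}"

text \<open>The meromorphic continuation of Li to C^d (well defined up to mero_eq).\<close>
definition Li_mero :: "nat \<Rightarrow> (nat \<Rightarrow> complex) \<Rightarrow> (nat \<Rightarrow> complex) \<Rightarrow> complex" where
  "Li_mero d w = (SOME F. c_meromorphic d F \<and> (\<forall>s\<in>Li_domain d. F s = Li_series d w s))"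

definition monomial_vals :: "nat \<Rightarrow> (nat \<Rightarrow> complex) \<Rightarrow> complex set" where
  "monomial_vals r z = {\<Prod>i<r. z i ^ m i | m. True}"

definition trunc_tuples :: "nat \<Rightarrow> nat \<Rightarrow> (nat \<Rightarrow> nat) set" where
  "trunc_tuples r N = {n \<in> decr_tuples r. r = 0 \<or> n 0 < N}"

definition partial_sum :: "nat \<Rightarrow> (nat \<Rightarrow> complex) \<Rightarrow> (nat \<Rightarrow> int) \<Rightarrow> (nat \<Rightarrow> nat) \<Rightarrow> nat \<Rightarrow> complex" where
  "partial_sum r z a k N = (\<Sum>n\<in>trunc_tuples r N.
      \<Prod>i<r. z i ^ n i * (of_real (ln (real (n i)))) ^ k i * (of_nat (n i)) powi (- a i))"

definition reg_expansion :: "nat \<Rightarrow> (nat \<Rightarrow> complex) \<Rightarrow> (nat \<Rightarrow> int) \<Rightarrow> (nat \<Rightarrow> nat) \<Rightarrow> complex \<Rightarrow> bool" where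
  "reg_expansion r z a k c \<longleftrightarrow> (\<exists>(L::nat) (M::nat) (u :: nat \<Rightarrow> nat \<Rightarrow> complex \<Rightarrow> complex).
      ((\<lambda>N. partial_sum r z a k N -
          (\<Sum>l\<le>L. \<Sum>m\<le>M. \<Sum>\<xi>\<in>monomial_vals r z.
              u l m \<xi> * \<xi> ^ N * (of_real (ln (real N))) ^ l * (of_nat N) ^ m)) \<longlonglongrightarrow> 0)
      \<and> c = u 0 0 1)"

definition reg_value :: "nat \<Rightarrow> (nat \<Rightarrow> complex) \<Rightarrow> (nat \<Rightarrow> int) \<Rightarrow> (nat \<Rightarrow> nat) \<Rightarrow> complex" where
  "reg_value r z a k = (SOME c. reg_expansion r z a k c)"

definition eulerian_poly :: "nat \<Rightarrow> complex \<Rightarrow> complex" where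
  "eulerian_poly n t = fact n *
     fps_nth (fps_const (1 - t) * inverse (fps_exp (t - 1) - fps_const t)) n"

definition eulerian_star :: "nat \<Rightarrow> complex \<Rightarrow> complex" where
  "eulerian_star n c = (-1) ^ n * eulerian_poly n c"

text \<open>x/(e^x - 1) = 1 / ((e^x - 1)/x) = sum_k (-1)^k B*_k x^k / k!\<close>
definition bernoulli_star :: "nat \<Rightarrow> complex" where
  "bernoulli_star k = (-1) ^ k * fact k *
     fps_nth (inverse (Abs_fps (\<lambda>n. 1 / fact (Suc n)) :: complex fps)) k"

text \<open>Pochhammer symbol extended by (x)_{-1} = 1/(x-1) (only m >= -1 is used).\<close>
definition gpoch :: "complex \<Rightarrow> int \<Rightarrow> complex" where
  "gpoch x m = (if m \<ge> 0 then pochhammer x (nat m) else if m = -1 then 1 / (x - 1) else 0)"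

section \<open>Combinatorial data (paper's 1-based indices: z_t = z (t-1), a_t = a (t-1), s_t = s (t-1))\<close>

definition zprod :: "(nat \<Rightarrow> complex) \<Rightarrow> nat \<Rightarrow> nat \<Rightarrow> complex" where
  "zprod z j i = (\<Prod>t\<in>{j..i}. z (t - 1))"

definition qq :: "(nat \<Rightarrow> complex) \<Rightarrow> nat \<Rightarrow> nat \<Rightarrow> nat" where
  "qq z j i = (if zprod z j i = 1 then 1 else 0)"

definition QQ :: "(nat \<Rightarrow> complex) \<Rightarrow> nat \<Rightarrow> nat \<Rightarrow> nat" where
  "QQ z j i = (\<Sum>t\<in>{j..i}. qq z t i)"

definition JJ :: "(nat \<Rightarrow> complex) \<Rightarrow> nat \<Rightarrow> nat set" where
  "JJ z i = {j\<in>{1..i}. zprod z j i = 1}"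

definition JJ' :: "(nat \<Rightarrow> complex) \<Rightarrow> nat \<Rightarrow> nat set" where
  "JJ' z i = {j\<in>{1..i}. zprod z j i \<noteq> 1}"

definition C_index :: "(nat \<Rightarrow> complex) \<Rightarrow> (nat \<Rightarrow> int) \<Rightarrow> nat \<Rightarrow> (nat \<Rightarrow> nat) set" where
  "C_index z a i = {k. (\<forall>j. (j < 1 \<or> i < j) \<longrightarrow> k j = 0) \<and>
      (\<Sum>t\<in>{1..i}. int (k t) + a (t - 1)) = int (QQ z 1 i)}"

definition C_coef :: "(nat \<Rightarrow> complex) \<Rightarrow> (nat \<Rightarrow> int) \<Rightarrow> nat \<Rightarrow> (nat \<Rightarrow> complex) \<Rightarrow> complex" where
  "C_coef z a i s =
    (if i = 0 then 1 else
     of_nat (qq z 1 i) * (\<Sum>k\<in>C_index z a i.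
        (1 / (\<Prod>t\<in>{1..i}. fact (k t))) *
        (\<Prod>j\<in>JJ' z i. cnj (zprod z j i) * eulerian_star (k j) (cnj (zprod z j i))
                          / (cnj (zprod z j i) - 1) ^ (k j + 1)) *
        (\<Prod>j\<in>JJ z i. bernoulli_star (k j)) *
        (\<Prod>j\<in>{1..i}. gpoch ((\<Sum>t\<in>{j..i}. s (t - 1)) + of_nat (\<Sum>t\<in>{j+1..i}. k t)
                                 - of_nat (QQ z (j+1) i))
                             (int (k j) - int (qq z j i)))))"

definition shift_vec :: "nat \<Rightarrow> nat \<Rightarrow> (nat \<Rightarrow> complex) \<Rightarrow> nat \<Rightarrow> complex" where
  "shift_vec r i s = (\<lambda>j. if j < r - i then s (i + j) else 0)"

definition Li_reg_rhs :: "nat \<Rightarrow> (nat \<Rightarrow> complex) \<Rightarrow> (nat \<Rightarrow> int) \<Rightarrow> (nat \<Rightarrow> complex) \<Rightarrow> complex" where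
  "Li_reg_rhs r z a s = (\<Sum>i\<le>r. (-1) ^ i *
      Li_mero (r - i) (\<lambda>j. z (i + j)) (shift_vec r i s) * C_coef z a i s)"

definition reg_series_term :: "nat \<Rightarrow> (nat \<Rightarrow> complex) \<Rightarrow> (nat \<Rightarrow> int) \<Rightarrow> (nat \<Rightarrow> complex) \<Rightarrow> (nat \<Rightarrow> nat) \<Rightarrow> complex" where
  "reg_series_term r z a s k = (-1) ^ (\<Sum>i<r. k i) / (\<Prod>i<r. fact (k i)) * reg_value r z a k *
      (\<Prod>i<r. (s i - of_int (a i)) ^ k i)"

end

theory Submission
  imports Defs "HOL-Complex_Analysis.Complex_Analysis"
begin

text \<open>
  The partial sums \<open>S\<^sub>N(s)\<close> with complex exponents are entire in \<open>s\<close>, and their Taylor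
  coefficients at \<open>a\<close> are, up to sign and factorials, the sums with logarithms. Summing
  one variable at a time by Euler--Maclaurin, outermost first, gives an expansion of \<open>S\<^sub>N(s)\<close> as
  the sum over \<open>i\<close> of \<open>Li(s\<^sub>i\<^sub>+\<^sub>1, ..., s\<^sub>r)\<close> times an explicit combination of terms
  \<open>(z\<^sub>1 ... z\<^sub>i)\<^sup>N N\<^sup>e\<close> with \<open>e\<close> affine in \<open>s\<close>; its constant term provides the meromorphic
  continuation of \<open>Li\<close>. The poles lie on hyperplanes \<open>s\<^sub>j + ... + s\<^sub>i = m\<close> with \<open>m\<close> an integer and
  are cleared by a product of sines. On a generic line through \<open>a\<close> the expansion can be
  compared coefficientwise in the line parameter: since the coefficients of \<open>S\<^sub>N\<close> of negative degree
  vanish, uniqueness of asymptotic expansions shows that the terms with \<open>e = 0\<close> at \<open>a\<close> and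
  \<open>z\<^sub>1 ... z\<^sub>i = 1\<close> add up to a function without pole on the line, whose Taylor coefficients are the
  regularised values. Averaging over directions on a torus recovers the individual
  coefficients together with Cauchy bounds.
\<close>

section \<open>Euler--Maclaurin tails\<close>

text \<open>The obstacle is that at an integer point \<open>a\<close> the separate terms of the
  expansion may be singular along several hyperplanes meeting in that same point, so they have no
  power series there; only suitable sums of them do. A line through \<open>a\<close> transversal to
  all these hyperplanes turns each term into a one-variable Laurent series with a common bound on
  the pole order, and coefficients can be compared. The price is that the results concern one
  direction at a time, hence the return to several variables by averaging.

  Values of a meromorphic function at zeros of a denominator are arbitrary here, and both
  \<open>Li_mero\<close> and \<open>reg_value\<close> are choices. Identities are therefore proved
  where no sum of consecutive exponents is an integer, and existence and uniqueness are established
  for each of the two choices.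

  Holomorphy in several variables is handled as boundedness plus differentiability along complex
  lines, which reduces the function theory to one variable.\<close>

definition dq :: "complex \<Rightarrow> nat" where
  "dq w = (if w = 1 then 1 else 0)"

text \<open>For |w| = 1 these are the Taylor coefficients of the single series x^q / (1 - w e^(-x))
  with q = \<open>dq w\<close>; the two branches are its closed forms through Bernoulli and Eulerian
  numbers.\<close>

definition em_coeff :: "complex \<Rightarrow> nat \<Rightarrow> complex" where
  "em_coeff w k = (if w = 1 then bernoulli_star k / fact k
     else cnj w * eulerian_star k (cnj w) / ((cnj w - 1) ^ (k + 1) * fact k))"

text \<open>Coefficientwise form of (e^(-x) - 1) G(x) = -x for G(x) = x / (1 - e^(-x)). The signs in
  \<open>bernoulli_star\<close> replace x by -x in x / (e^x - 1), which yields G.\<close>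

lemma em_coeff_1_recurrence:
  "(\<Sum>m\<le>n. (-1) ^ m / fact m * em_coeff 1 (n - m)) - em_coeff 1 n = - (if n = 1 then 1 else 0)"
proof -
  define A where "A = (Abs_fps (\<lambda>n. 1 / fact (Suc n)) :: complex fps)"
  define I where "I = fps_nth (inverse A)"
  have b: "em_coeff 1 k = (-1) ^ k * I k" for k
    by (simp add: em_coeff_def bernoulli_star_def I_def A_def)
  have IA: "inverse A * A = 1"
    by (rule inverse_mult_eq_1) (simp add: A_def)
  have eq: "(-1) ^ m / fact m * em_coeff 1 (n - m) = (-1) ^ n * (I (n - m) / fact m)" if "m \<le> n" for m
  proof -
    have "(-1) ^ m / fact m * em_coeff 1 (n - m) = ((-1) ^ m * (-1) ^ (n - m)) * I (n - m) / fact m"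
      by (simp add: b)
    also have "(-1) ^ m * (-1) ^ (n - m) = ((-1) ^ n :: complex)"
      using that by (simp add: power_add[symmetric])
    finally show ?thesis by simp
  qed
  have "(\<Sum>m\<le>n. (-1) ^ m / fact m * em_coeff 1 (n - m)) - em_coeff 1 n
      = (-1) ^ n * ((\<Sum>m\<le>n. I (n - m) / fact m) - I n)"
  proof -
    have "(\<Sum>m\<le>n. (-1) ^ m / fact m * em_coeff 1 (n - m)) = (\<Sum>m\<le>n. (-1) ^ n * (I (n - m) / fact m))"
      by (intro sum.cong refl eq) simp
    then show ?thesis by (simp add: sum_distrib_left right_diff_distrib b)
  qed
  also have "(\<Sum>m\<le>n. I (n - m) / fact m) - I n = (if n = 1 then 1 else 0)"
  proof (cases n)
    case 0
    then show ?thesis by simp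
  next
    case (Suc p)
    \<comment> \<open>Dropping the term m = 0 and shifting divides e^x - 1 by x, so the series
      \<open>A\<close> appears next to its inverse.\<close>
    have "(\<Sum>m\<le>n. I (n - m) / fact m) - I n = (\<Sum>m\<le>p. I (p - m) / fact (Suc m))"
      unfolding Suc by (subst sum.atMost_Suc_shift) simp
    also have "\<dots> = (\<Sum>m\<le>p. I m / fact (Suc (p - m)))"
      by (rule sum.reindex_bij_witness[of _ "\<lambda>i. p - i" "\<lambda>i. p - i"]) auto
    also have "\<dots> = fps_nth (inverse A * A) p"
      by (simp add: fps_mult_nth I_def A_def atLeast0AtMost)
    also have "\<dots> = (if n = 1 then 1 else 0)"
      by (simp add: IA Suc)
    finally show ?thesis .
  qed
  finally show ?thesis by simp
qed

text \<open>With c = \<open>cnj w\<close> = 1/w, the substitution (c - 1) y = -x in the Eulerian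
  generating function produces 1 / (1 - w e^(-x)); multiplying by w e^(-x) - 1 and comparing
  coefficients gives the recurrence.\<close>

lemma em_coeff_neq_1_recurrence:
  assumes "w * cnj w = 1" "w \<noteq> 1"
  shows "(\<Sum>m\<le>n. w * (-1) ^ m / fact m * em_coeff w (n - m)) - em_coeff w n = - (if n = 0 then 1 else 0)"
proof -
  define c where "c = cnj w"
  have wc: "w * c = 1" using assms(1) by (simp add: c_def)
  have c1: "c \<noteq> 1" using wc assms(2) by auto
  define F where "F = fps_nth (fps_const (1 - c) * inverse (fps_exp (c - 1) - fps_const c))"
  have b: "em_coeff w k = c * (-1) ^ k * F k / (c - 1) ^ (k + 1)" for k
    using assms(2) by (simp add: em_coeff_def eulerian_star_def eulerian_poly_def F_def c_def)
  have inv: "(fps_const (1 - c) * inverse (fps_exp (c - 1) - fps_const c)) * (fps_exp (c - 1) - fps_const c) = fps_const (1 - c)"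
    by (subst mult.assoc, subst inverse_mult_eq_1) (use c1 in auto)
  have "(\<Sum>m\<le>n. F (n - m) * ((c - 1) ^ m / fact m)) - c * F n = (if n = 0 then 1 - c else 0)"
  proof -
    have "(if n = 0 then 1 - c else 0) = fps_nth ((fps_const (1 - c) * inverse (fps_exp (c - 1) - fps_const c)) * (fps_exp (c - 1) - fps_const c)) n"
      unfolding inv by simp
    also have "\<dots> = (\<Sum>m=0..n. F m * ((c - 1) ^ (n - m) / fact (n - m))) - F n * c"
      by (subst right_diff_distrib) (simp add: fps_mult_nth[of _ "fps_exp _"] F_def)
    also have "(\<Sum>m=0..n. F m * ((c - 1) ^ (n - m) / fact (n - m))) = (\<Sum>m\<le>n. F (n - m) * ((c - 1) ^ m / fact m))"
      by (rule sum.reindex_bij_witness[of _ "\<lambda>i. n - i" "\<lambda>i. n - i"]) auto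
    finally show ?thesis by (simp add: mult.commute)
  qed
  moreover have "w * (-1) ^ m / fact m * em_coeff w (n - m) = (-1) ^ n / (c - 1) ^ (n + 1) * (F (n - m) * ((c - 1) ^ m / fact m))"
    if "m \<le> n" for m
  proof -
    have "w * (-1) ^ m / fact m * em_coeff w (n - m) = (w * c) * ((-1) ^ m * (-1) ^ (n - m)) / fact m * F (n - m) / (c - 1) ^ (n - m + 1)"
      by (simp add: b)
    also have "(-1) ^ m * (-1) ^ (n - m) = ((-1) ^ n :: complex)"
      using that by (simp add: power_add[symmetric])
    also have "(c - 1) ^ (n - m + 1) = (c - 1) ^ (n + 1) / (c - 1) ^ m"
      using that c1 by (simp add: power_diff)
    finally show ?thesis unfolding wc by (simp add: mult_ac)
  qed
  ultimately have "(\<Sum>m\<le>n. w * (-1) ^ m / fact m * em_coeff w (n - m)) - em_coeff w n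
     = (-1) ^ n / (c - 1) ^ (n + 1) * (if n = 0 then 1 - c else 0)"
  proof -
    assume a1: "(\<Sum>m\<le>n. F (n - m) * ((c - 1) ^ m / fact m)) - c * F n = (if n = 0 then 1 - c else 0)"
    assume a2: "\<And>m. m \<le> n \<Longrightarrow> w * (-1) ^ m / fact m * em_coeff w (n - m) = (-1) ^ n / (c - 1) ^ (n + 1) * (F (n - m) * ((c - 1) ^ m / fact m))"
    have "(\<Sum>m\<le>n. w * (-1) ^ m / fact m * em_coeff w (n - m)) - em_coeff w n
       = (-1) ^ n / (c - 1) ^ (n + 1) * ((\<Sum>m\<le>n. F (n - m) * ((c - 1) ^ m / fact m)) - c * F n)"
      using a2 by (simp add: right_diff_distrib sum_distrib_left b)
    then show ?thesis by (simp only: a1)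
  qed
  also have "\<dots> = - (if n = 0 then 1 else 0)"
    using c1 by (simp add: field_simps)
  finally show ?thesis .
qed

lemma em_coeff_recurrence:
  assumes "cmod w = 1"
  shows "(\<Sum>m\<le>n. w * (-1) ^ m / fact m * em_coeff w (n - m)) - em_coeff w n = - (if n = dq w then 1 else 0)"
proof (cases "w = 1")
  case True
  then show ?thesis using em_coeff_1_recurrence[of n] by (simp add: dq_def)
next
  case False
  have "w * cnj w = 1" using assms by (simp add: complex_norm_square[symmetric])
  then show ?thesis using em_coeff_neq_1_recurrence[OF _ False] False by (simp add: dq_def)
qed

text \<open>A truncated formal solution f of w f(N+1) - f(N) = N^(-s). With x = -d/dN it is -(1 - w
  e^(-x))^(-1) N^(-s), and x^k sends N^(-s) to (s)_k N^(-s-k). For w = 1 the series starts with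
  x^(-1), an antiderivative, which is what \<open>gpoch\<close> at -1 encodes.\<close>

definition em_sum :: "nat \<Rightarrow> complex \<Rightarrow> nat \<Rightarrow> complex \<Rightarrow> complex" where
  "em_sum K w N s = - (\<Sum>k\<le>K. em_coeff w k * gpoch s (int k - int (dq w)) *
      of_nat N powr (- (s + of_nat k - of_nat (dq w))))"

text \<open>Composition rule for powers of -d/dN. For k = 0 and q = 1 the value 1/(s - 1) has to
  cancel the first Pochhammer factor s - 1, hence the exclusion of s = 1.\<close>

lemma gpoch_mult_pochhammer:
  assumes "q \<le> 1" "q = 1 \<Longrightarrow> s \<noteq> 1"
  shows "gpoch s (int k - int q) * pochhammer (s + of_nat k - of_nat q) m = gpoch s (int (k + m) - int q)"
proof (cases "q \<le> k")
  case True
  then have "int k - int q = int (k - q)" "int (k + m) - int q = int ((k - q) + m)" by auto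
  then show ?thesis
    using True pochhammer_product'[of s "k - q" m] by (simp add: gpoch_def of_nat_diff add_diff_eq nat_diff_distrib' nat_add_distrib)
next
  case False
  with assms have q: "q = 1" "k = 0" by auto
  with assms have "s \<noteq> 1" by auto
  show ?thesis
  proof (cases m)
    case 0
    then show ?thesis by simp
  next
    case (Suc p)
    then show ?thesis using \<open>s \<noteq> 1\<close> by (simp add: gpoch_def q pochhammer_rec)
  qed
qed

lemma has_field_derivative_powr_pochhammer:
  fixes x s :: complex
  assumes "x \<notin> \<real>\<^sub>\<le>\<^sub>0"
  shows "((\<lambda>x. (-1) ^ i * pochhammer s i * x powr (- s - of_nat i)) has_field_derivative
     (-1) ^ Suc i * pochhammer s (Suc i) * x powr (- s - of_nat (Suc i))) (at x within S)"
proof -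
  have "x \<notin> \<real>\<^sub>\<le>\<^sub>0" by fact
  then have "((\<lambda>x. x powr (- s - of_nat i)) has_field_derivative (- s - of_nat i) * x powr (- s - of_nat i - 1)) (at x within S)"
    by (intro DERIV_subset[OF has_field_derivative_powr]) auto
  from DERIV_cmult[OF this, of "(-1) ^ i * pochhammer s i"] show ?thesis
    by (simp add: pochhammer_Suc algebra_simps)
qed

text \<open>Taylor's formula on the segment from N to N + 1. The factor
  \<open>2 powr (\<bar>Re s\<bar>)\<close> handles the case of a growing power, which is compared
  with its value at 2N, an upper bound for N + 1.\<close>

lemma powr_shift_Taylor:
  fixes s :: complex
  assumes "N \<ge> 1"
  shows "cmod (of_nat (N + 1) powr (- s) - (\<Sum>m\<le>M. (-1) ^ m / fact m * pochhammer s m * of_nat N powr (- s - of_nat m)))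
    \<le> cmod (pochhammer s (Suc M)) * 2 powr (\<bar>Re s\<bar>) * real N powr (- Re s - real (Suc M))"
proof -
  define f where "f = (\<lambda>i x. (-1) ^ i * pochhammer s i * x powr (- s - of_nat i) :: complex)"
  define S where "S = closed_segment (of_nat N :: complex) (of_nat (N + 1))"
  have S: "\<exists>y. x = of_real y \<and> real N \<le> y \<and> y \<le> real N + 1" if "x \<in> S" for x
  proof -
    note that
    moreover have "S = closed_segment (of_real (real N)) (of_real (real (N + 1)))"
      by (simp add: S_def)
    ultimately have "x \<in> of_real ` closed_segment (real N) (real (N + 1))"
      by (simp only: closed_segment_of_real)
    then show ?thesis by (auto simp: closed_segment_eq_real_ivl)
  qed
  define B where "B = cmod (pochhammer s (Suc M)) * 2 powr (\<bar>Re s\<bar>) * real N powr (- Re s - real (Suc M))"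
  have bound: "cmod (f (Suc M) x) \<le> B" if xS: "x \<in> S" for x
  proof -
    obtain y where y: "x = of_real y" "real N \<le> y" "y \<le> real N + 1" using S xS by blast
    have yp: "y > 0" using y assms by auto
    have "y powr (- Re s - real (Suc M)) \<le> 2 powr (\<bar>Re s\<bar>) * real N powr (- Re s - real (Suc M))"
    proof (cases "- Re s - real (Suc M) \<ge> 0")
      case True
      have "y powr (- Re s - real (Suc M)) \<le> (2 * real N) powr (- Re s - real (Suc M))"
        by (rule powr_mono2) (use y assms True in auto)
      also have "\<dots> = 2 powr (- Re s - real (Suc M)) * real N powr (- Re s - real (Suc M))"
        by (simp add: powr_mult)
      also have "\<dots> \<le> 2 powr (\<bar>Re s\<bar>) * real N powr (- Re s - real (Suc M))"
        by (intro mult_right_mono powr_mono) auto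
      finally show ?thesis .
    next
      case False
      have "y powr (- Re s - real (Suc M)) \<le> 1 * real N powr (- Re s - real (Suc M))"
        unfolding mult_1 by (rule powr_mono2') (use False y assms in auto)
      also have "\<dots> \<le> 2 powr (\<bar>Re s\<bar>) * real N powr (- Re s - real (Suc M))"
        by (intro mult_right_mono) (auto simp: ge_one_powr_ge_zero)
      finally show ?thesis .
    qed
    moreover have "cmod (f (Suc M) x) = cmod (pochhammer s (Suc M)) * y powr (- Re s - real (Suc M))"
      using yp by (simp add: f_def norm_mult norm_power y norm_powr_real_powr del: pochhammer_Suc)
    ultimately show ?thesis unfolding B_def
      by (metis mult.assoc mult_left_mono norm_ge_zero)
  qed
  have "cmod (f 0 (of_nat (N + 1)) - (\<Sum>i\<le>M. f i (of_nat N) * (of_nat (N + 1) - of_nat N) ^ i / (fact i)))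
      \<le> B * cmod (of_nat (N + 1) - of_nat N :: complex) ^ Suc M / fact M"
  proof (rule complex_Taylor[where S = S])
    show "convex S" by (simp add: S_def)
    show "(f i has_field_derivative f (Suc i) x) (at x within S)" if xS: "x \<in> S" and "i \<le> M" for i x
    proof -
      obtain y where y: "x = of_real y" "real N \<le> y" using S xS by blast
      then have "x \<notin> \<real>\<^sub>\<le>\<^sub>0" using assms by auto
      then show ?thesis unfolding f_def by (rule has_field_derivative_powr_pochhammer)
    qed
  qed (use bound in \<open>auto simp: S_def\<close>)
  also have "\<dots> \<le> B"
  proof -
    have "B \<ge> 0" by (simp add: B_def)
    moreover have "(1::real) \<le> fact M" by (simp add: fact_ge_1)
    ultimately have "B * 1 \<le> B * fact M" by (intro mult_left_mono)
    then show ?thesis by (simp add: divide_simps)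
  qed
  finally show ?thesis unfolding B_def f_def by (simp add: mult_ac del: pochhammer_Suc)
qed

text \<open>By the recurrence for the coefficients all terms of order up to K cancel except the one
  of index \<open>dq w\<close>, which is N^(-s) itself. The Taylor remainders, taken at different k,
  all have the order of the first omitted term.\<close>

lemma em_sum_step:
  assumes w: "cmod w = 1" and K: "dq w \<le> K" and N: "N \<ge> 1" and s: "w = 1 \<Longrightarrow> s \<noteq> 1"
  shows "cmod (w * em_sum K w (N + 1) s - em_sum K w N s - (of_nat N powr (- s)))
    \<le> cmod (gpoch s (int (K + 1) - int (dq w))) * (\<Sum>k\<le>K. cmod (em_coeff w k)) *
        2 powr (\<bar>Re s\<bar> + real K + 1) * real N powr (real (dq w) - Re s - real (K + 1))"
proof -
  define q where "q = dq w"
  have q1: "q \<le> 1" by (simp add: q_def dq_def)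
  have qs: "q = 1 \<Longrightarrow> s \<noteq> 1" using s by (auto simp: q_def dq_def split: if_splits)
  define g where "g = (\<lambda>k. gpoch s (int k - int q))"
  define sg where "sg = (\<lambda>k. s + of_nat k - of_nat q)"
  \<comment> \<open>The term of index k is expanded only to order K - k, so that exactly the terms
    of total order at most K are kept.\<close>
  define T where "T = (\<lambda>k. (\<Sum>m\<le>K - k. (-1) ^ m / fact m * pochhammer (sg k) m * of_nat N powr (- sg k - of_nat m)))"
  define rem where "rem = (\<lambda>k. of_nat (N + 1) powr (- sg k) - T k)"
  define p where "p = (\<lambda>n. of_nat N powr (- sg n))"
  have gm: "g k * pochhammer (sg k) m = g (k + m)" for k m
    unfolding g_def sg_def by (rule gpoch_mult_pochhammer[OF q1 qs])
  have psg: "of_nat N powr (- sg k - of_nat m) = p (k + m)" for k m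
    by (simp add: p_def sg_def algebra_simps)
  have gT: "g k * T k = (\<Sum>m\<le>K - k. (-1) ^ m / fact m * (g (k + m) * p (k + m)))" for k
    unfolding T_def sum_distrib_left psg gm[symmetric] by (simp add: mult_ac)
  have main: "(\<Sum>k\<le>K. w * em_coeff w k * (g k * T k)) - (\<Sum>k\<le>K. em_coeff w k * g k * p k) = - (of_nat N powr (- s))"
  proof -
    have "(\<Sum>k\<le>K. w * em_coeff w k * (g k * T k))
       = (\<Sum>k\<le>K. \<Sum>m\<le>K - k. w * (-1) ^ m / fact m * em_coeff w k * (g (k + m) * p (k + m)))"
      unfolding gT sum_distrib_left by (simp add: mult_ac)
    also have "\<dots> = (\<Sum>(k, m)\<in>{(i, j). i + j \<le> K}. w * (-1) ^ m / fact m * em_coeff w k * (g (k + m) * p (k + m)))"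
      by (subst sum.Sigma) (auto intro!: sum.cong)
    also have "\<dots> = (\<Sum>n\<le>K. \<Sum>m\<le>n. w * (-1) ^ (n - m) / fact (n - m) * em_coeff w m * (g (m + (n - m)) * p (m + (n - m))))"
      by (rule sum.triangle_reindex_eq)
    also have "\<dots> = (\<Sum>n\<le>K. (\<Sum>m\<le>n. w * (-1) ^ m / fact m * em_coeff w (n - m)) * (g n * p n))"
    proof (rule sum.cong[OF refl])
      fix n assume "n \<in> {..K}"
      have "(\<Sum>m\<le>n. w * (-1) ^ (n - m) / fact (n - m) * em_coeff w m * (g (m + (n - m)) * p (m + (n - m))))
          = (\<Sum>m\<le>n. w * (-1) ^ m / fact m * em_coeff w (n - m) * (g n * p n))"
        by (rule sum.reindex_bij_witness[of _ "\<lambda>i. n - i" "\<lambda>i. n - i"]) auto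
      then show "(\<Sum>m\<le>n. w * (-1) ^ (n - m) / fact (n - m) * em_coeff w m * (g (m + (n - m)) * p (m + (n - m))))
          = (\<Sum>m\<le>n. w * (-1) ^ m / fact m * em_coeff w (n - m)) * (g n * p n)"
        by (simp add: sum_distrib_right)
    qed
    finally have "(\<Sum>k\<le>K. w * em_coeff w k * (g k * T k)) - (\<Sum>k\<le>K. em_coeff w k * g k * p k)
       = (\<Sum>n\<le>K. ((\<Sum>m\<le>n. w * (-1) ^ m / fact m * em_coeff w (n - m)) - em_coeff w n) * (g n * p n))"
      by (simp add: sum_subtractf left_diff_distrib mult.assoc)
    also have "\<dots> = (\<Sum>n\<le>K. if n = q then - (g n * p n) else 0)"
      unfolding em_coeff_recurrence[OF w] q_def by (intro sum.cong) auto
    also have "\<dots> = - (g q * p q)" using K by (simp add: q_def)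
    also have "\<dots> = - (of_nat N powr (- s))" by (simp add: g_def p_def sg_def gpoch_def)
    finally show ?thesis .
  qed
  have "w * em_sum K w (N + 1) s - em_sum K w N s - (of_nat N powr (- s))
     = - (\<Sum>k\<le>K. w * em_coeff w k * (g k * (of_nat (N + 1) powr (- sg k)))) + (\<Sum>k\<le>K. em_coeff w k * g k * p k) - (of_nat N powr (- s))"
    unfolding em_sum_def g_def p_def sg_def q_def by (simp add: sum_distrib_left mult_ac)
  also have "(\<Sum>k\<le>K. w * em_coeff w k * (g k * (of_nat (N + 1) powr (- sg k))))
     = (\<Sum>k\<le>K. w * em_coeff w k * (g k * T k)) + (\<Sum>k\<le>K. w * em_coeff w k * (g k * rem k))"
    unfolding rem_def by (simp add: algebra_simps sum_subtractf)
  finally have h1: "w * em_sum K w (N + 1) s - em_sum K w N s - of_nat N powr (- s)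
     = - ((\<Sum>k\<le>K. w * em_coeff w k * (g k * T k)) + (\<Sum>k\<le>K. w * em_coeff w k * (g k * rem k))) + (\<Sum>k\<le>K. em_coeff w k * g k * p k) - of_nat N powr (- s)" .
  have "- (a + b) + c - e = - b" if "a - c = - e" for a b c e :: complex
    using that by algebra
  note linarr = this[OF main]
  have "w * em_sum K w (N + 1) s - em_sum K w N s - (of_nat N powr (- s)) = - (\<Sum>k\<le>K. w * em_coeff w k * (g k * rem k))"
    unfolding h1 by (rule linarr)
  then have "cmod (w * em_sum K w (N + 1) s - em_sum K w N s - (of_nat N powr (- s))) \<le> (\<Sum>k\<le>K. cmod (em_coeff w k) * cmod (g k * rem k))"
    by (simp add: norm_mult w order_trans[OF norm_sum])
  also have "\<dots> \<le> (\<Sum>k\<le>K. cmod (em_coeff w k) * (cmod (g (K + 1)) * 2 powr (\<bar>Re s\<bar> + real K + 1) * real N powr (real q - Re s - real (K + 1))))"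
  proof (intro sum_mono mult_left_mono)
    fix k assume "k \<in> {..K}"
    then have k: "k \<le> K" by simp
    have "cmod (rem k) \<le> cmod (pochhammer (sg k) (Suc (K - k))) * 2 powr (\<bar>Re (sg k)\<bar>) * real N powr (- Re (sg k) - real (Suc (K - k)))"
      unfolding rem_def T_def by (rule powr_shift_Taylor[OF N])
    then have "cmod (g k * rem k) \<le> cmod (g k) * (cmod (pochhammer (sg k) (Suc (K - k))) * 2 powr (\<bar>Re (sg k)\<bar>) * real N powr (- Re (sg k) - real (Suc (K - k))))"
      by (simp add: norm_mult mult_left_mono)
    also have "\<dots> = cmod (g k * pochhammer (sg k) (Suc (K - k))) * 2 powr (\<bar>Re (sg k)\<bar>) * real N powr (- Re (sg k) - real (Suc (K - k)))"
      by (simp only: norm_mult mult.assoc)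
    also have "g k * pochhammer (sg k) (Suc (K - k)) = g (K + 1)"
      using k by (simp only: gm) simp
    also have "- Re (sg k) - real (Suc (K - k)) = real q - Re s - real (K + 1)"
      using k by (simp add: sg_def of_nat_diff)
    \<comment> \<open>\<open>sg k\<close> differs from s by k - q, whose modulus is at most K + 1;
      this explains the enlarged exponent of 2.\<close>
    also have "cmod (g (K + 1)) * 2 powr (\<bar>Re (sg k)\<bar>) * real N powr (real q - Re s - real (K + 1))
        \<le> cmod (g (K + 1)) * 2 powr (\<bar>Re s\<bar> + real K + 1) * real N powr (real q - Re s - real (K + 1))"
      using k q1 by (intro mult_right_mono mult_left_mono powr_mono) (auto simp: sg_def)
    finally show "cmod (g k * rem k) \<le> cmod (g (K + 1)) * 2 powr (\<bar>Re s\<bar> + real K + 1) * real N powr (real q - Re s - real (K + 1))" .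
  qed auto
  finally show ?thesis unfolding q_def g_def sum_distrib_right[symmetric] by (simp add: mult_ac)
qed

section \<open>Power series of bounded Gateaux-holomorphic functions\<close>

lemma multi_idx_0: "multi_idx 0 = {\<lambda>_. 0}"
  by (auto simp: multi_idx_def)

lemma has_sum_multi_idx_Suc:
  "((\<lambda>(m, k). f (k(d := m))) has_sum S) (UNIV \<times> multi_idx d) \<longleftrightarrow> (f has_sum S) (multi_idx (Suc d))"
proof (rule has_sum_reindex_bij_witness[where j = "\<lambda>(m, k). k(d := m)" and i = "\<lambda>k. (k d, k(d := 0))"])
  show "(\<lambda>(m, k). k(d := m)) b \<in> multi_idx (Suc d)" if "b \<in> UNIV \<times> multi_idx d" for b
    using that by (auto simp: multi_idx_def split: prod.splits)
  show "(\<lambda>k. (k d, k(d := 0))) b \<in> UNIV \<times> multi_idx d" if "b \<in> multi_idx (Suc d)" for b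
    using that unfolding multi_idx_def by (auto dest: le_neq_implies_less)
qed (auto simp: multi_idx_def fun_eq_iff)

text \<open>Majorant for the multivariable series below: coefficients with Cauchy bounds are
  dominated by such a product of geometric series.\<close>

lemma has_sum_geometric_multi:
  fixes x :: "nat \<Rightarrow> real"
  assumes "\<And>i. i < d \<Longrightarrow> 0 \<le> x i" "\<And>i. i < d \<Longrightarrow> x i < 1"
  shows "((\<lambda>k. \<Prod>i<d. x i ^ k i) has_sum (\<Prod>i<d. 1 / (1 - x i))) (multi_idx d)"
  using assms
proof (induction d)
  case 0
  then show ?case by (simp add: multi_idx_0 has_sum_finite_iff)
next
  case (Suc d)
  define P where "P = (\<Prod>i<d. 1 / (1 - x i))"
  have IH: "((\<lambda>k. \<Prod>i<d. x i ^ k i) has_sum P) (multi_idx d)" unfolding P_def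
    using Suc by auto
  have in1: "((\<lambda>k. (\<lambda>(m, k). x d ^ m * (\<Prod>i<d. x i ^ k i)) (m, k)) has_sum x d ^ m * P) (multi_idx d)" for m
    unfolding split by (rule has_sum_cmult_right[OF IH])
  have out: "((\<lambda>m. x d ^ m * P) has_sum (1 / (1 - x d) * P)) UNIV"
    using Suc.prems(1)[of d] Suc.prems(2)[of d]
    by (intro has_sum_cmult_left norm_summable_imp_has_sum) (auto simp: geometric_sums)
  have "((\<lambda>(m, k). x d ^ m * (\<Prod>i<d. x i ^ k i)) has_sum (1 / (1 - x d) * P)) (UNIV \<times> multi_idx d)"
  proof (rule has_sum_SigmaI[OF in1 out])
    show "(\<lambda>(m, k). x d ^ m * (\<Prod>i<d. x i ^ k i)) summable_on UNIV \<times> multi_idx d"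
      by (rule summable_on_SigmaI[OF in1]) (use out Suc.prems in \<open>auto simp: summable_on_def intro!: mult_nonneg_nonneg prod_nonneg\<close>)
  qed
  also have "?this \<longleftrightarrow> ((\<lambda>(m, k). (\<lambda>k. \<Prod>i<Suc d. x i ^ k i) (k(d := m))) has_sum (1 / (1 - x d) * P)) (UNIV \<times> multi_idx d)"
    by (intro has_sum_cong) (auto simp: mult.commute)
  also have "\<dots> \<longleftrightarrow> ((\<lambda>k. \<Prod>i<Suc d. x i ^ k i) has_sum (1 / (1 - x d) * P)) (multi_idx (Suc d))"
    by (rule has_sum_multi_idx_Suc)
  finally show ?case by (simp add: P_def mult.commute)
qed

section \<open>Functions restricted to complex lines\<close>

definition cline :: "(nat \<Rightarrow> complex) \<Rightarrow> (nat \<Rightarrow> complex) \<Rightarrow> complex \<Rightarrow> nat \<Rightarrow> complex" where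
  "cline s v t = (\<lambda>i. s i + t * v i)"

lemma cline_0 [simp]: "cline s v 0 = s"
  by (simp add: cline_def)

lemma cline_cline: "cline (cline s v t) v u = cline s v (t + u)"
  by (simp add: cline_def algebra_simps)

lemma cline_in_cspace [intro]: "s \<in> cspace d \<Longrightarrow> v \<in> cspace d \<Longrightarrow> cline s v t \<in> cspace d"
  by (simp add: cspace_def cline_def)

lemma polydisc_subset_cspace: "polydisc d p e \<subseteq> cspace d"
  by (auto simp: polydisc_def cspace_def)

lemma polydisc_iff: "s \<in> polydisc d p e \<longleftrightarrow> s \<in> cspace d \<and> (\<forall>i<d. cmod (s i - p i) < e)"
  by (auto simp: polydisc_def cspace_def)

lemma polydisc_line_set:
  assumes "s \<in> cspace d" "v \<in> cspace d"
  shows "{t. cline s v t \<in> polydisc d p e} = (\<Inter>i<d. {t. cmod (s i + t * v i - p i) < e})"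
  using assms by (auto simp: polydisc_def cspace_def cline_def)

lemma open_polydisc_line:
  assumes "s \<in> cspace d" "v \<in> cspace d"
  shows "open {t. cline s v t \<in> polydisc d p e}"
  unfolding polydisc_line_set[OF assms]
  by (intro open_INT finite_lessThan ballI open_Collect_less continuous_intros)

lemma convex_polydisc_line:
  assumes "s \<in> cspace d" "v \<in> cspace d"
  shows "convex {t. cline s v t \<in> polydisc d p e}"
  unfolding polydisc_line_set[OF assms]
proof (intro convex_INT)
  fix i assume "i \<in> {..<d}"
  have "{t. cmod (s i + t * v i - p i) < e} = (\<lambda>t. t * v i) -` ball (p i - s i) e"
    by (auto simp: dist_norm norm_minus_commute algebra_simps)
  also have "convex \<dots>"
    by (intro convex_linear_vimage linearI) (auto simp: algebra_simps)
  finally show "convex {t. cmod (s i + t * v i - p i) < e}" .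
qed

text \<open>Holomorphy through derivatives along lines only. The bound stands in for joint
  continuity: it makes one-variable Cauchy estimates uniform in the remaining variables, which
  suffices for a convergent power series.\<close>

definition bdd_gateaux :: "nat \<Rightarrow> (nat \<Rightarrow> complex) set \<Rightarrow> ((nat \<Rightarrow> complex) \<Rightarrow> complex) \<Rightarrow> bool" where
  "bdd_gateaux d S f \<longleftrightarrow>
     (\<forall>s\<in>S. \<forall>v\<in>cspace d. (\<lambda>t. f (cline s v t)) field_differentiable at 0) \<and>
     (\<exists>C. \<forall>s\<in>S. cmod (f s) \<le> C)"

lemma bdd_gateaux_subset: "bdd_gateaux d S f \<Longrightarrow> T \<subseteq> S \<Longrightarrow> bdd_gateaux d T f"
  unfolding bdd_gateaux_def by blast

lemma bdd_gateauxE: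
  assumes "bdd_gateaux d S f"
  obtains C where "C \<ge> 0" "\<And>s. s \<in> S \<Longrightarrow> cmod (f s) \<le> C"
proof -
  from assms obtain C where C: "\<forall>s\<in>S. cmod (f s) \<le> C" by (auto simp: bdd_gateaux_def)
  show ?thesis by (rule that[of "\<bar>C\<bar>"]) (use C in force)+
qed

lemma bdd_gateaux_const [intro]: "bdd_gateaux d S (\<lambda>_. c)"
  unfolding bdd_gateaux_def by auto

lemma bdd_gateaux_add:
  assumes "bdd_gateaux d S f" "bdd_gateaux d S g"
  shows "bdd_gateaux d S (\<lambda>s. f s + g s)"
proof -
  from bdd_gateauxE[OF assms(1)] obtain A where A: "\<And>s. s \<in> S \<Longrightarrow> cmod (f s) \<le> A" by metis
  from bdd_gateauxE[OF assms(2)] obtain B where B: "\<And>s. s \<in> S \<Longrightarrow> cmod (g s) \<le> B" by metis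
  have "\<forall>s\<in>S. cmod (f s + g s) \<le> A + B"
    using A B by (meson add_mono norm_triangle_le)
  then show ?thesis using assms unfolding bdd_gateaux_def
    by (auto intro!: field_differentiable_add)
qed

lemma bdd_gateaux_mult:
  assumes "bdd_gateaux d S f" "bdd_gateaux d S g"
  shows "bdd_gateaux d S (\<lambda>s. f s * g s)"
proof -
  from bdd_gateauxE[OF assms(1)] obtain A where A: "A \<ge> 0" "\<And>s. s \<in> S \<Longrightarrow> cmod (f s) \<le> A" by metis
  from bdd_gateauxE[OF assms(2)] obtain B where B: "B \<ge> 0" "\<And>s. s \<in> S \<Longrightarrow> cmod (g s) \<le> B" by metis
  have "\<forall>s\<in>S. cmod (f s * g s) \<le> A * B"
    using A B by (simp add: norm_mult mult_mono)
  then show ?thesis using assms unfolding bdd_gateaux_def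
    by (auto intro!: field_differentiable_mult)
qed

lemma bdd_gateaux_sum: "(\<And>x. x \<in> A \<Longrightarrow> bdd_gateaux d S (f x)) \<Longrightarrow> bdd_gateaux d S (\<lambda>s. \<Sum>x\<in>A. f x s)"
  by (induction A rule: infinite_finite_induct) (auto intro!: bdd_gateaux_add)

lemma bdd_gateaux_prod: "(\<And>x. x \<in> A \<Longrightarrow> bdd_gateaux d S (f x)) \<Longrightarrow> bdd_gateaux d S (\<lambda>s. \<Prod>x\<in>A. f x s)"
  by (induction A rule: infinite_finite_induct) (auto intro!: bdd_gateaux_mult)

text \<open>Differentiability at parameter 0 of every line is enough, since a line can be re-based
  at each of its points.\<close>

lemma bdd_gateaux_line_holomorphic:
  assumes f: "bdd_gateaux d (polydisc d p e) f" and s: "s \<in> cspace d" and v: "v \<in> cspace d"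
  shows "(\<lambda>t. f (cline s v t)) holomorphic_on {t. cline s v t \<in> polydisc d p e}"
proof (unfold holomorphic_on_def, intro ballI)
  fix t assume t: "t \<in> {t. cline s v t \<in> polydisc d p e}"
  then obtain D where "((\<lambda>u. f (cline (cline s v t) v u)) has_field_derivative D) (at 0)"
    using f v unfolding bdd_gateaux_def field_differentiable_def by blast
  then have "((\<lambda>u. f (cline s v u)) has_field_derivative D) (at t)"
    using DERIV_at_within_shift[of "\<lambda>u. f (cline s v u)" D t 0 UNIV] by (simp add: cline_cline)
  then show "(\<lambda>t. f (cline s v t)) field_differentiable at t within {t. cline s v t \<in> polydisc d p e}"
    by (auto simp: field_differentiable_def intro: has_field_derivative_at_within)
qed

lemma bdd_gateaux_compose_linear:
  assumes \<phi>: "\<phi> holomorphic_on UNIV"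
    and lin: "\<And>s v t. l (cline s v t) = l s + t * l' v"
    and bd: "\<And>s. s \<in> S \<Longrightarrow> cmod (l s) \<le> C"
  shows "bdd_gateaux d S (\<lambda>s. \<phi> (l s))"
  unfolding bdd_gateaux_def
proof (intro conjI ballI)
  fix s v
  have "(\<lambda>t. \<phi> (l s + t * l' v)) holomorphic_on UNIV"
    by (rule holomorphic_on_compose_gen[OF _ \<phi>, unfolded o_def]) (auto intro!: holomorphic_intros)
  then show "(\<lambda>t. \<phi> (l (cline s v t))) field_differentiable at 0"
    unfolding lin by (simp add: holomorphic_on_def)
next
  have "compact (\<phi> ` cball 0 C)"
    by (intro compact_continuous_image holomorphic_on_imp_continuous_on holomorphic_on_subset[OF \<phi>]) auto
  from compact_imp_bounded[OF this] obtain B where "\<forall>y\<in>\<phi> ` cball 0 C. cmod y \<le> B"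
    unfolding bounded_iff ..
  then have "cmod (\<phi> (l s)) \<le> B" if "s \<in> S" for s
  proof -
    have "l s \<in> cball 0 C" using bd[OF that] by simp
    with \<open>\<forall>y\<in>\<phi> ` cball 0 C. cmod y \<le> B\<close> show ?thesis by blast
  qed
  then show "\<exists>B. \<forall>s\<in>S. cmod (\<phi> (l s)) \<le> B" by blast
qed

text \<open>Weierstrass' theorem on locally uniform limits, applied on each line separately.\<close>

lemma bdd_gateaux_uniform_limit:
  assumes f: "\<And>n. bdd_gateaux d (polydisc d p e) (f n)"
    and lim: "uniform_limit (polydisc d p e) f g sequentially"
  shows "bdd_gateaux d (polydisc d p e) g"
  unfolding bdd_gateaux_def
proof (intro conjI ballI)
  let ?S = "polydisc d p e"
  from lim obtain n where n: "\<forall>s\<in>?S. dist (f n s) (g s) < 1"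
    unfolding uniform_limit_iff eventually_sequentially by (meson order_refl zero_less_one)
  from bdd_gateauxE[OF f[of n]] obtain A where A: "\<And>s. s \<in> ?S \<Longrightarrow> cmod (f n s) \<le> A" by metis
  have "cmod (g s) \<le> A + 1" if "s \<in> ?S" for s
  proof -
    have "cmod (g s) \<le> cmod (f n s) + cmod (f n s - g s)"
      by (metis norm_minus_commute norm_triangle_sub)
    then show ?thesis using A[OF that] n that by (force simp: dist_norm)
  qed
  then show "\<exists>C. \<forall>s\<in>?S. cmod (g s) \<le> C" by blast
next
  let ?S = "polydisc d p e"
  fix s v assume s: "s \<in> ?S" and v: "v \<in> cspace d"
  have sc: "s \<in> cspace d" using s polydisc_subset_cspace by blast
  define T where "T = {t. cline s v t \<in> ?S}"
  have T: "open T" unfolding T_def by (rule open_polydisc_line[OF sc v])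
  have "(\<lambda>t. g (cline s v t)) holomorphic_on T"
  proof (rule holomorphic_uniform_sequence[OF T])
    show "(\<lambda>t. f n (cline s v t)) holomorphic_on T" for n
      unfolding T_def by (rule bdd_gateaux_line_holomorphic[OF f sc v])
    fix x assume "x \<in> T"
    then obtain r where r: "r > 0" "cball x r \<subseteq> T" using T open_contains_cball by blast
    have "uniform_limit (cball x r) (\<lambda>n t. f n (cline s v t)) (\<lambda>t. g (cline s v t)) sequentially"
      by (rule uniform_limit_compose'[OF lim]) (use r in \<open>auto simp: T_def\<close>)
    then show "\<exists>r>0. cball x r \<subseteq> T \<and> uniform_limit (cball x r) (\<lambda>n t. f n (cline s v t)) (\<lambda>t. g (cline s v t)) sequentially"
      using r by blast
  qed
  moreover have "0 \<in> T" using s by (simp add: T_def)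
  ultimately show "(\<lambda>t. g (cline s v t)) field_differentiable at 0"
    using T holomorphic_on_imp_differentiable_at by blast
qed

section \<open>Taylor coefficients from averages over roots of unity\<close>

lemma sum_roots_unity_orthogonal:
  assumes N: "N > 0" and i: "i < N" and m: "m < N"
  defines "w \<equiv> cis (2 * pi / real N)"
  shows "(\<Sum>j<N. (w ^ j) ^ i * cnj (w ^ j) ^ m) = (if i = m then of_nat N else 0)"
proof -
  define x where "x = w ^ i * cnj w ^ m"
  have wN: "w ^ N = 1" using N by (simp add: w_def Complex.DeMoivre)
  have wc: "w * cnj w = 1" by (simp add: w_def cis_cnj cis_mult)
  have xN: "x ^ N = 1"
    by (simp add: x_def power_mult_distrib power_mult[symmetric] mult.commute[of _ N])
       (simp add: power_mult wN flip: complex_cnj_power)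
  have "(\<Sum>j<N. (w ^ j) ^ i * cnj (w ^ j) ^ m) = (\<Sum>j<N. x ^ j)"
    by (simp add: x_def power_mult_distrib power_mult[symmetric] mult.commute)
  also have "\<dots> = (if i = m then of_nat N else 0)"
  proof (cases "i = m")
    case True
    then have "x = (w * cnj w) ^ m" by (simp only: x_def power_mult_distrib)
    then show ?thesis using True by (simp add: wc)
  next
    case False
    have "x \<noteq> 1"
    proof
      assume "x = 1"
      have "x * w ^ m = w ^ i * (w * cnj w) ^ m" by (simp add: x_def power_mult_distrib)
      then have "w ^ i = w ^ m" using \<open>x = 1\<close> by (simp add: wc)
      then have "cis (2 * pi * real i / real N) = cis (2 * pi * real m / real N)"
        by (simp add: w_def Complex.DeMoivre mult_ac)
      moreover have "inj_on (\<lambda>k. cis (2 * pi * real k / real N)) {..<N}"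
        using Complex.bij_betw_roots_unity[OF N] by (simp add: bij_betw_def)
      ultimately show False using False i m by (auto dest: inj_onD)
    qed
    then show ?thesis using False xN geometric_sum[of x N] by simp
  qed
  finally show ?thesis .
qed

text \<open>Cauchy's inequality on circles of radius r < R, followed by r tending to R; in this way
  nothing is asked of h on the boundary.\<close>

lemma Taylor_coeff_bound:
  assumes h: "h holomorphic_on ball c R" and M: "\<And>x. x \<in> ball c R \<Longrightarrow> cmod (h x) \<le> M" and R: "R > 0"
  shows "cmod ((deriv ^^ n) h c / fact n) \<le> M / R ^ n"
proof -
  let ?x = "cmod ((deriv ^^ n) h c / fact n)"
  have b: "?x * r ^ n \<le> M" if "0 < r" "r < R" for r
  proof -
    have "cmod ((deriv ^^ n) h c) \<le> fact n * M / r ^ n"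
    proof (rule Cauchy_inequality)
      have s: "cball c r \<subseteq> ball c R" using that by auto
      show "h holomorphic_on ball c r" by (rule holomorphic_on_subset[OF h]) (use that in auto)
      show "continuous_on (cball c r) h" using holomorphic_on_imp_continuous_on[OF h] s continuous_on_subset by blast
      show "cmod (h x) \<le> M" if "cmod (c - x) = r" for x
        using M[of x] that \<open>r < R\<close> by (simp add: dist_norm)
    qed (use that in auto)
    then show ?thesis using that by (simp add: norm_divide field_simps)
  qed
  have "((\<lambda>r. ?x * r ^ n) \<longlongrightarrow> ?x * R ^ n) (at_left R)"
    by (intro tendsto_intros)
  moreover have "eventually (\<lambda>r. ?x * r ^ n \<le> M) (at_left R)"
    using eventually_at_left_real[OF R] by eventually_elim (use b in auto)
  ultimately have "?x * R ^ n \<le> M"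
    by (rule tendsto_upperbound) auto
  then show ?thesis using R by (simp add: field_simps)
qed

text \<open>Averaging over the \<open>N\<close>-th roots of unity extracts the \<open>m\<close>-th Taylor coefficient exactly
  from the Taylor polynomial of degree less than \<open>N\<close>; only the tail contributes an error.\<close>

lemma roots_unity_average_Taylor_coeff:
  assumes h: "h holomorphic_on ball c R" and M: "\<And>x. x \<in> ball c R \<Longrightarrow> cmod (h x) \<le> M"
    and r: "0 < r" "r < R" and m: "m < N"
  defines "w \<equiv> cis (2 * pi / real N)"
  shows "cmod ((\<Sum>j<N. h (c + of_real r * w ^ j) * cnj (w ^ j) ^ m) / of_nat N / of_real r ^ m - (deriv ^^ m) h c / fact m)
     \<le> M * (r / R) ^ N / (1 - r / R) / r ^ m"
proof -
  define a where "a = (\<lambda>n. (deriv ^^ n) h c / fact n)"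
  have N: "N > 0" using m by simp
  have R: "R > 0" using r by simp
  have M0: "M \<ge> 0" using M[of c] R by (meson centre_in_ball norm_ge_zero order_trans)
  have wn: "cmod (w ^ j) = 1" for j by (simp add: w_def norm_power)
  have a_bound: "cmod (a n) \<le> M / R ^ n" for n
    unfolding a_def by (rule Taylor_coeff_bound[OF h M R])
  define P where "P = (\<lambda>x. \<Sum>n<N. a n * (x - c) ^ n)"
  have rem: "cmod (h x - P x) \<le> M * (r / R) ^ N / (1 - r / R)" if x: "cmod (x - c) = r" for x
  proof -
    have "x \<in> ball c R" using x r by (simp add: dist_norm norm_minus_commute)
    then have "(\<lambda>n. a n * (x - c) ^ n) sums h x"
      unfolding a_def by (rule holomorphic_power_series[OF h])
    then have s1: "(\<lambda>n. a (n + N) * (x - c) ^ (n + N)) sums (h x - P x)"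
      unfolding P_def by (rule sums_split_initial_segment)
    have s2: "(\<lambda>n. M * (r / R) ^ N * (r / R) ^ n) sums (M * (r / R) ^ N * (1 / (1 - r / R)))"
      by (intro sums_mult geometric_sums) (use r in auto)
    have le: "cmod (a (n + N) * (x - c) ^ (n + N)) \<le> M * (r / R) ^ N * (r / R) ^ n" for n
    proof -
      have "cmod (a (n + N) * (x - c) ^ (n + N)) \<le> M / R ^ (n + N) * r ^ (n + N)"
        by (simp only: norm_mult norm_power x) (intro mult_right_mono a_bound, use r in auto)
      then show ?thesis by (simp add: power_add power_divide mult_ac)
    qed
    have "cmod (h x - P x) \<le> (\<Sum>n. M * (r / R) ^ N * (r / R) ^ n)"
      unfolding sums_unique[OF s1] by (rule norm_suminf_le[OF le sums_summable[OF s2]])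
    then show ?thesis using sums_unique[OF s2] by simp
  qed
  let ?x = "\<lambda>j. c + of_real r * w ^ j"
  have "(\<Sum>j<N. P (?x j) * cnj (w ^ j) ^ m) = (\<Sum>j<N. \<Sum>n<N. a n * of_real r ^ n * ((w ^ j) ^ n * cnj (w ^ j) ^ m))"
    by (simp only: P_def add_diff_cancel_left' power_mult_distrib sum_distrib_right mult.assoc)
  also have "\<dots> = (\<Sum>n<N. a n * of_real r ^ n * (\<Sum>j<N. (w ^ j) ^ n * cnj (w ^ j) ^ m))"
    unfolding sum_distrib_left by (rule sum.swap)
  also have "\<dots> = (\<Sum>n<N. if n = m then a n * of_real r ^ n * of_nat N else 0)"
    using m N unfolding w_def by (intro sum.cong refl) (subst sum_roots_unity_orthogonal, auto)
  also have "\<dots> = a m * of_real r ^ m * of_nat N" using m by simp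
  finally have "a m = (\<Sum>j<N. P (?x j) * cnj (w ^ j) ^ m) / of_nat N / of_real r ^ m"
    using N r by simp
  then have eq: "(\<Sum>j<N. h (?x j) * cnj (w ^ j) ^ m) / of_nat N / of_real r ^ m - a m
      = (\<Sum>j<N. (h (?x j) - P (?x j)) * cnj (w ^ j) ^ m) / of_nat N / of_real r ^ m"
    by (simp add: diff_divide_distrib left_diff_distrib sum_subtractf)
  have "cmod ((\<Sum>j<N. (h (?x j) - P (?x j)) * cnj (w ^ j) ^ m) / of_nat N / of_real r ^ m) = cmod (\<Sum>j<N. (h (?x j) - P (?x j)) * cnj (w ^ j) ^ m) / real N / r ^ m"
    using r by (simp add: norm_divide norm_power norm_mult)
  also have "\<dots> \<le> (real N * (M * (r / R) ^ N / (1 - r / R))) / real N / r ^ m"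
  proof (intro divide_right_mono)
    have "cmod (\<Sum>j<N. (h (?x j) - P (?x j)) * cnj (w ^ j) ^ m) \<le> (\<Sum>j<N. M * (r / R) ^ N / (1 - r / R))"
    proof (rule sum_norm_le)
      fix j
      have "cmod (?x j - c) = r" using r wn[of j] by (simp add: norm_mult)
      from rem[OF this] show "cmod ((h (?x j) - P (?x j)) * cnj (w ^ j) ^ m) \<le> M * (r / R) ^ N / (1 - r / R)"
        using wn[of j] by (simp add: norm_mult norm_power)
    qed
    then show "cmod (\<Sum>j<N. (h (?x j) - P (?x j)) * cnj (w ^ j) ^ m) \<le> real N * (M * (r / R) ^ N / (1 - r / R))"
      by simp
  qed (use r in auto)
  also have "\<dots> = M * (r / R) ^ N / (1 - r / R) / r ^ m" using N by simp
  finally show ?thesis unfolding eq[symmetric] by (simp add: a_def)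
qed

definition slice_coeff :: "nat \<Rightarrow> (nat \<Rightarrow> complex) \<Rightarrow> ((nat \<Rightarrow> complex) \<Rightarrow> complex) \<Rightarrow> nat \<Rightarrow> (nat \<Rightarrow> complex) \<Rightarrow> complex" where
  "slice_coeff d p f m s = (deriv ^^ m) (\<lambda>x. f (s(d := x))) (p d) / fact m"

text \<open>Inductive step for the power series theorem. A Taylor coefficient in the last variable
  is a uniform limit of finite averages of values of f, so it inherits line differentiability in the
  other variables without any interchange of derivatives.\<close>

lemma bdd_gateaux_slice_coeff:
  assumes f: "bdd_gateaux (Suc d) (polydisc (Suc d) p R) f" and R: "R > 0"
    and M: "\<And>s. s \<in> polydisc (Suc d) p R \<Longrightarrow> cmod (f s) \<le> M"
  defines "g \<equiv> slice_coeff d p f"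
  shows "bdd_gateaux d (polydisc d p R) (g m)"
    and "\<And>s. s \<in> polydisc d p R \<Longrightarrow> cmod (g m s) \<le> M / R ^ m"
    and "\<And>s. s \<in> polydisc (Suc d) p R \<Longrightarrow> (\<lambda>m. g m (s(d := 0)) * (s d - p d) ^ m) sums f s"
proof -
  have upd: "s(d := x) \<in> polydisc (Suc d) p R" if "s \<in> polydisc d p R" "x \<in> ball (p d) R" for s x
    using that by (auto simp: polydisc_def less_Suc_eq dist_norm norm_minus_commute)
  have hol: "(\<lambda>x. f (s(d := x))) holomorphic_on ball (p d) R" if s: "s \<in> polydisc d p R" for s
  proof -
    define v where "v = (\<lambda>i. if i = d then 1 else 0 :: complex)"
    have sd: "s d = 0" using s by (simp add: polydisc_def)
    have e: "s(d := x) = cline s v x" for x by (auto simp: cline_def v_def sd)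
    have "s \<in> cspace (Suc d)" "v \<in> cspace (Suc d)" using s by (auto simp: cspace_def v_def polydisc_def)
    from bdd_gateaux_line_holomorphic[OF f this] show ?thesis
      unfolding e[symmetric] by (rule holomorphic_on_subset) (use upd[OF s] in auto)
  qed
  have bd: "cmod (f (s(d := x))) \<le> M" if "s \<in> polydisc d p R" "x \<in> ball (p d) R" for s x
    by (rule M[OF upd[OF that]])
  show b: "cmod (g m s) \<le> M / R ^ m" if "s \<in> polydisc d p R" for s m
    unfolding g_def slice_coeff_def by (rule Taylor_coeff_bound[OF hol[OF that] bd[OF that] R])
  show "(\<lambda>m. g m (s(d := 0)) * (s d - p d) ^ m) sums f s" if s: "s \<in> polydisc (Suc d) p R" for s
  proof -
    have "s(d := 0) \<in> polydisc d p R" "s d \<in> ball (p d) R"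
      using s unfolding polydisc_def
      by (auto simp: dist_norm norm_minus_commute dest: le_neq_implies_less)
    from holomorphic_power_series[OF hol[OF this(1)] this(2)] show ?thesis
      by (simp add: g_def slice_coeff_def)
  qed
  \<comment> \<open>Any radius strictly between 0 and R works; r / R < 1 makes the averages converge
    uniformly in s.\<close>
  define r where "r = R / 2"
  have r: "0 < r" "r < R" using R by (auto simp: r_def)
  define A where "A = (\<lambda>n s. (\<Sum>j<n. f (s(d := p d + of_real r * cis (2 * pi / real n) ^ j)) * cnj (cis (2 * pi / real n) ^ j) ^ m) / of_nat n / of_real r ^ m)"
  show "bdd_gateaux d (polydisc d p R) (g m)"
  proof (rule bdd_gateaux_uniform_limit)
    show "bdd_gateaux d (polydisc d p R) (A n)" for n
    proof -
      have "bdd_gateaux d (polydisc d p R) (\<lambda>s. f (s(d := x)))" if x: "x \<in> ball (p d) R" for x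
        unfolding bdd_gateaux_def
      proof (intro conjI ballI)
        fix s v assume s: "s \<in> polydisc d p R" and v: "v \<in> cspace d"
        have "(\<lambda>t. f (cline (s(d := x)) v t)) field_differentiable at 0"
          using f upd[OF s x] v unfolding bdd_gateaux_def by (auto simp: cspace_def)
        moreover have "cline (s(d := x)) v t = (cline s v t)(d := x)" for t
          using v by (auto simp: cline_def cspace_def)
        ultimately show "(\<lambda>t. f ((cline s v t)(d := x))) field_differentiable at 0" by simp
      qed (use bd x in blast)
      then show ?thesis unfolding A_def divide_inverse mult.assoc using r
        by (intro bdd_gateaux_mult bdd_gateaux_sum bdd_gateaux_const)
           (auto simp: dist_norm norm_mult norm_power)
    qed
    have M0: "M \<ge> 0" if "s \<in> polydisc d p R" for s
      using bd[OF that, of "p d"] R by (meson centre_in_ball norm_ge_zero order_trans)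
    have le: "dist (A n s) (g m s) \<le> M * (r / R) ^ n / (1 - r / R) / r ^ m" if "n > m" "s \<in> polydisc d p R" for n s
      unfolding A_def g_def slice_coeff_def dist_norm
      by (rule roots_unity_average_Taylor_coeff[OF hol[OF that(2)] bd[OF that(2)] r that(1)])
    have "(\<lambda>n. M * (r / R) ^ n / (1 - r / R) / r ^ m) \<longlonglongrightarrow> M * 0 / (1 - r / R) / r ^ m"
      using r by (intro tendsto_intros LIMSEQ_realpow_zero) auto
    then have l0: "(\<lambda>n. M * (r / R) ^ n / (1 - r / R) / r ^ m) \<longlonglongrightarrow> 0" by simp
    show "uniform_limit (polydisc d p R) A (g m) sequentially"
    proof (rule uniform_limitI)
      fix e :: real assume "e > 0"
      from order_tendstoD(2)[OF l0 this] eventually_gt_at_top[of m]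
      show "\<forall>\<^sub>F n in sequentially. \<forall>s\<in>polydisc d p R. dist (A n s) (g m s) < e"
        by eventually_elim (use le in force)
    qed
  qed
qed

text \<open>Variables are split off starting from the last. The bound M / R^m of the m-th slice
  takes the place of M in the induction, so the Cauchy bounds multiply up to absolute summability;
  the sum may then be evaluated slice by slice.\<close>

theorem bdd_gateaux_power_series:
  assumes "bdd_gateaux d (polydisc d p R) f" "R > 0"
    and "\<And>s. s \<in> polydisc d p R \<Longrightarrow> cmod (f s) \<le> M"
  shows "\<exists>c. (\<forall>k\<in>multi_idx d. cmod (c k) \<le> M / R ^ (\<Sum>i<d. k i)) \<and>
     (\<forall>s\<in>polydisc d p R. ((\<lambda>k. c k * (\<Prod>i<d. (s i - p i) ^ k i)) has_sum f s) (multi_idx d))"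
  using assms(1,3)
proof (induction d arbitrary: f M)
  case 0
  have "(\<lambda>_. 0) \<in> polydisc 0 p R" by (simp add: polydisc_def)
  moreover have "s = (\<lambda>_. 0)" if "s \<in> polydisc 0 p R" for s
    using that by (auto simp: polydisc_def)
  ultimately have "polydisc 0 p R = {\<lambda>_. 0}" by blast
  then show ?case using "0.prems"(2)[of "\<lambda>_. 0"]
    by (intro exI[of _ "\<lambda>_. f (\<lambda>_. 0)"]) (simp add: multi_idx_0 has_sum_finite_iff)
next
  case (Suc d)
  define g where "g = slice_coeff d p f"
  note sl = bdd_gateaux_slice_coeff[OF Suc.prems(1) assms(2) Suc.prems(2), folded g_def]
  have "\<exists>c. (\<forall>k\<in>multi_idx d. cmod (c k) \<le> M / R ^ m / R ^ (\<Sum>i<d. k i)) \<and>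
     (\<forall>s\<in>polydisc d p R. ((\<lambda>k. c k * (\<Prod>i<d. (s i - p i) ^ k i)) has_sum g m s) (multi_idx d))" for m
    by (rule Suc.IH[OF sl(1)]) (use sl(2) in auto)
  then have "\<forall>m. \<exists>c. (\<forall>k\<in>multi_idx d. cmod (c k) \<le> M / R ^ m / R ^ (\<Sum>i<d. k i)) \<and>
     (\<forall>s\<in>polydisc d p R. ((\<lambda>k. c k * (\<Prod>i<d. (s i - p i) ^ k i)) has_sum g m s) (multi_idx d))"
    by (rule allI)
  from choice[OF this] obtain c where "\<forall>m. (\<forall>k\<in>multi_idx d. cmod (c m k) \<le> M / R ^ m / R ^ (\<Sum>i<d. k i)) \<and>
     (\<forall>s\<in>polydisc d p R. ((\<lambda>k. c m k * (\<Prod>i<d. (s i - p i) ^ k i)) has_sum g m s) (multi_idx d))" ..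
  then have c: "\<And>m k. k \<in> multi_idx d \<Longrightarrow> cmod (c m k) \<le> M / R ^ m / R ^ (\<Sum>i<d. k i)"
     "\<And>m s. s \<in> polydisc d p R \<Longrightarrow> ((\<lambda>k. c m k * (\<Prod>i<d. (s i - p i) ^ k i)) has_sum g m s) (multi_idx d)"
    by simp_all
  define C where "C = (\<lambda>k. c (k d) (k(d := 0)))"
  have C_bound: "cmod (C k) \<le> M / R ^ (\<Sum>i<Suc d. k i)" if "k \<in> multi_idx (Suc d)" for k
  proof -
    have "k(d := 0) \<in> multi_idx d" using that unfolding multi_idx_def by (auto dest: le_neq_implies_less)
    from c(1)[OF this, of "k d"] show ?thesis by (simp add: C_def power_add mult.commute)
  qed
  have "((\<lambda>k. C k * (\<Prod>i<Suc d. (s i - p i) ^ k i)) has_sum f s) (multi_idx (Suc d))" if s: "s \<in> polydisc (Suc d) p R" for s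
  proof -
    define F where "F = (\<lambda>k. C k * (\<Prod>i<Suc d. (s i - p i) ^ k i))"
    have M0: "M \<ge> 0" using Suc.prems(2)[OF s] norm_ge_zero order_trans by blast
    have "(\<lambda>k. M * (\<Prod>i<Suc d. (cmod (s i - p i) / R) ^ k i)) summable_on multi_idx (Suc d)"
      using has_sum_geometric_multi[of "Suc d" "\<lambda>i. cmod (s i - p i) / R"] s assms(2)
      by (intro summable_on_cmult_right) (auto simp: summable_on_def polydisc_def)
    then have "(\<lambda>k. norm (F k)) summable_on multi_idx (Suc d)"
    proof (rule Infinite_Sum.abs_summable_on_comparison_test')
      fix k assume k: "k \<in> multi_idx (Suc d)"
      have "cmod (F k) \<le> M / R ^ (\<Sum>i<Suc d. k i) * (\<Prod>i<Suc d. cmod (s i - p i) ^ k i)"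
        unfolding F_def norm_mult prod_norm[symmetric] norm_power
        by (intro mult_right_mono C_bound k prod_nonneg) auto
      also have "\<dots> = M * (\<Prod>i<Suc d. (cmod (s i - p i) / R) ^ k i)"
        by (simp only: power_divide prod_dividef power_sum) simp
      finally show "cmod (F k) \<le> M * (\<Prod>i<Suc d. (cmod (s i - p i) / R) ^ k i)" .
    qed
    from Infinite_Sum.abs_summable_summable[OF this] obtain S where S: "(F has_sum S) (multi_idx (Suc d))" by (auto simp: summable_on_def)
    define s' where "s' = s(d := 0)"
    have s': "s' \<in> polydisc d p R"
      using s unfolding s'_def polydisc_def by (auto dest: le_neq_implies_less)
    have S': "((\<lambda>(m, k). F (k(d := m))) has_sum S) (UNIV \<times> multi_idx d)"
      using S by (simp only: has_sum_multi_idx_Suc)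
    have inn: "((\<lambda>k. (\<lambda>(m, k). F (k(d := m))) (m, k)) has_sum (g m s' * (s d - p d) ^ m)) (multi_idx d)" for m
    proof -
      have "F (k(d := m)) = c m k * (\<Prod>i<d. (s' i - p i) ^ k i) * (s d - p d) ^ m" if "k \<in> multi_idx d" for k
      proof -
        have "k(d := 0) = k" using that by (auto simp: multi_idx_def)
        then show ?thesis by (simp add: F_def C_def s'_def)
      qed
      then have "((\<lambda>k. F (k(d := m))) has_sum (g m s' * (s d - p d) ^ m)) (multi_idx d) \<longleftrightarrow>
         ((\<lambda>k. c m k * (\<Prod>i<d. (s' i - p i) ^ k i) * (s d - p d) ^ m) has_sum (g m s' * (s d - p d) ^ m)) (multi_idx d)"
        by (rule has_sum_cong)
      then show ?thesis unfolding split
        using has_sum_cmult_left[OF c(2)[OF s', of m], of "(s d - p d) ^ m"] by blast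
    qed
    have "((\<lambda>m. g m s' * (s d - p d) ^ m) has_sum S) UNIV"
      by (rule has_sum_SigmaD[OF S' inn])
    then have "(\<lambda>m. g m s' * (s d - p d) ^ m) sums S" by (rule has_sum_imp_sums)
    moreover have "(\<lambda>m. g m s' * (s d - p d) ^ m) sums f s" unfolding s'_def by (rule sl(3)) (use s in auto)
    ultimately have "S = f s" by (rule sums_unique2)
    then show ?thesis using S by (simp add: F_def)
  qed
  then show ?case using C_bound by blast
qed

lemma polydisc_nbhd:
  assumes q: "q \<in> polydisc d p R"
  obtains e where "e > 0" "polydisc d q e \<subseteq> polydisc d p R"
proof -
  obtain e where e: "e > 0" "\<And>i. i < d \<Longrightarrow> cmod (q i - p i) + e \<le> R"
  proof (cases "d = 0")
    case True
    then show ?thesis using that[of 1] by auto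
  next
    case False
    define e where "e = Min ((\<lambda>i. R - cmod (q i - p i)) ` {..<d})"
    have "e > 0" unfolding e_def by (subst Min_gr_iff) (use False q in \<open>auto simp: polydisc_def\<close>)
    moreover have "e \<le> R - cmod (q i - p i)" if "i < d" for i
      unfolding e_def by (rule Min_le) (use that in auto)
    ultimately show ?thesis using that[of e] by force
  qed
  have "polydisc d q e \<subseteq> polydisc d p R"
  proof
    fix s assume s: "s \<in> polydisc d q e"
    have "cmod (s i - p i) < R" if "i < d" for i
    proof -
      have "cmod (s i - p i) \<le> cmod (s i - q i) + cmod (q i - p i)"
        using norm_triangle_ineq[of "s i - q i" "q i - p i"] by simp
      then show ?thesis using e(2)[OF that] s that by (force simp: polydisc_def)
    qed
    then show "s \<in> polydisc d p R" using s by (auto simp: polydisc_def)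
  qed
  then show thesis using that e(1) by blast
qed

corollary bdd_gateaux_imp_c_analytic_at:
  assumes f: "bdd_gateaux d (polydisc d p R) f" and q: "q \<in> polydisc d p R"
  shows "c_analytic_at d f q"
proof -
  obtain e where e: "e > 0" "polydisc d q e \<subseteq> polydisc d p R"
    using polydisc_nbhd[OF q] by blast
  from bdd_gateaux_subset[OF f e(2)] have f': "bdd_gateaux d (polydisc d q e) f" .
  then obtain M where "\<And>s. s \<in> polydisc d q e \<Longrightarrow> cmod (f s) \<le> M" by (metis bdd_gateauxE)
  from bdd_gateaux_power_series[OF f' e(1) this] show ?thesis
    unfolding c_analytic_at_def using e(1) by blast
qed

section \<open>Identity theorem for meromorphic functions\<close>

definition homog_idx :: "nat \<Rightarrow> nat \<Rightarrow> (nat \<Rightarrow> nat) set" where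
  "homog_idx d n = {k \<in> multi_idx d. (\<Sum>i<d. k i) = n}"

lemma finite_homog_idx [intro, simp]: "finite (homog_idx d n)"
proof (rule finite_subset)
  show "homog_idx d n \<subseteq> {f. \<forall>i. (i \<in> {..<d} \<longrightarrow> f i \<in> {..n}) \<and> (i \<notin> {..<d} \<longrightarrow> f i = 0)}"
    by (auto simp: homog_idx_def multi_idx_def intro: member_le_sum)
  show "finite {f. \<forall>i. (i \<in> {..<d} \<longrightarrow> f i \<in> {..n}) \<and> (i \<notin> {..<d} \<longrightarrow> f i = 0)}"
    by (rule finite_set_of_finite_funs) auto
qed

text \<open>Grouping by total degree turns a multivariable power series on a line through its centre
  into an ordinary power series in the line parameter.\<close>

lemma has_sum_multi_idx_by_degree:
  fixes f :: "(nat \<Rightarrow> nat) \<Rightarrow> complex"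
  assumes "(f has_sum S) (multi_idx d)"
  shows "(\<lambda>n. \<Sum>k\<in>homog_idx d n. f k) sums S"
proof -
  have "((\<lambda>(n, k). f k) has_sum S) (Sigma UNIV (homog_idx d)) \<longleftrightarrow> (f has_sum S) (multi_idx d)"
    by (rule has_sum_reindex_bij_witness[where j = snd and i = "\<lambda>k. (\<Sum>i<d. k i, k)"])
       (auto simp: homog_idx_def)
  with assms have "((\<lambda>(n, k). f k) has_sum S) (Sigma UNIV (homog_idx d))" by simp
  then have "((\<lambda>n. \<Sum>k\<in>homog_idx d n. f k) has_sum S) UNIV"
    by (rule has_sum_SigmaD) (auto simp: has_sum_finite_iff)
  then show ?thesis by (rule has_sum_imp_sums)
qed

lemma prod_power_homog_idx:
  fixes v :: "nat \<Rightarrow> complex"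
  assumes "k \<in> homog_idx d n"
  shows "(\<Prod>i<d. (t * v i) ^ k i) = t ^ n * (\<Prod>i<d. v i ^ k i)"
  using assms by (simp add: homog_idx_def power_mult_distrib prod.distrib power_sum[symmetric])

lemma c_analytic_at_line:
  assumes f: "c_analytic_at d f p" and p: "p \<in> cspace d" and v: "v \<in> cspace d"
  shows "(\<lambda>t. f (cline p v t)) field_differentiable at 0"
proof -
  obtain e c where e: "e > 0" and c: "\<And>s. s \<in> polydisc d p e \<Longrightarrow> ((\<lambda>k. c k * (\<Prod>i<d. (s i - p i) ^ k i)) has_sum f s) (multi_idx d)"
    using f unfolding c_analytic_at_def by blast
  have "p \<in> polydisc d p e" using p e by (simp add: polydisc_iff)
  then have "(0 :: complex) \<in> {t. cline p v t \<in> polydisc d p e}" by simp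
  then obtain r :: real where r: "r > 0" "ball 0 r \<subseteq> {t. cline p v t \<in> polydisc d p e}"
    using open_polydisc_line[OF p v] open_contains_ball by blast
  have "(\<lambda>t. f (cline p v t)) holomorphic_on ball 0 r"
  proof (rule power_series_holomorphic)
    fix t :: complex assume "t \<in> ball 0 r"
    then have "cline p v t \<in> polydisc d p e" using r by auto
    from has_sum_multi_idx_by_degree[OF c[OF this]]
    have "(\<lambda>n. \<Sum>k\<in>homog_idx d n. c k * (\<Prod>i<d. (t * v i) ^ k i)) sums f (cline p v t)"
      by (simp add: cline_def)
    then show "(\<lambda>n. (\<Sum>k\<in>homog_idx d n. c k * (\<Prod>i<d. v i ^ k i)) * (t - 0) ^ n) sums f (cline p v t)"
      by (simp add: prod_power_homog_idx sum_distrib_left mult_ac cong: sum.cong)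
  qed
  then show ?thesis by (rule holomorphic_on_imp_differentiable_at) (use r(1) in auto)
qed

text \<open>Serves to keep denominators nonzero in a whole polydisc around a point where they do not
  vanish.\<close>

lemma c_analytic_at_continuous:
  assumes f: "c_analytic_at d f p" and p: "p \<in> cspace d" and \<eta>: "\<eta> > 0"
  obtains e where "e > 0" "\<And>q. q \<in> polydisc d p e \<Longrightarrow> cmod (f q - f p) < \<eta>"
proof -
  obtain e c where e: "e > 0" and c: "\<And>s. s \<in> polydisc d p e \<Longrightarrow> ((\<lambda>k. c k * (\<Prod>i<d. (s i - p i) ^ k i)) has_sum f s) (multi_idx d)"
    using f unfolding c_analytic_at_def by blast
  define w where "w = (\<lambda>i. if i < d then p i + of_real (e / 2) else 0)"
  have "w \<in> polydisc d p e" using e by (auto simp: w_def polydisc_def)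
  from c[OF this] have "(\<lambda>k. c k * (\<Prod>i<d. (w i - p i) ^ k i)) summable_on multi_idx d"
    by (auto simp: summable_on_def)
  then have sm: "(\<lambda>k. cmod (c k * (\<Prod>i<d. (w i - p i) ^ k i))) summable_on multi_idx d"
    by (simp add: summable_on_iff_abs_summable_on_complex)
  have weq: "cmod (c k * (\<Prod>i<d. (w i - p i) ^ k i)) = cmod (c k) * (\<Prod>i<d. (e / 2) ^ k i)" for k
  proof -
    have "(\<Prod>i<d. (w i - p i) ^ k i) = (\<Prod>i<d. of_real (e / 2) ^ k i)"
      by (intro prod.cong) (auto simp: w_def)
    then show ?thesis using e by (simp add: norm_mult prod_norm[symmetric] norm_power)
  qed
  define A where "A = (\<Sum>\<^sub>\<infinity>k\<in>multi_idx d. cmod (c k) * (\<Prod>i<d. (e / 2) ^ k i))"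
  have A: "((\<lambda>k. cmod (c k) * (\<Prod>i<d. (e / 2) ^ k i)) has_sum A) (multi_idx d)"
    using sm unfolding weq A_def by (rule has_sum_infsum)
  have A0: "A \<ge> 0" unfolding A_def by (intro infsum_nonneg mult_nonneg_nonneg prod_nonneg) (use e in auto)
  \<comment> \<open>Shrinking the half-size polydisc by this factor multiplies every nonconstant
    monomial by at most \<open>\<theta>\<close>, so f varies by at most \<open>\<theta> * A\<close>,
    which the choice makes smaller than \<open>\<eta>\<close>.\<close>
  define \<theta> where "\<theta> = min 1 (\<eta> / (2 * (A + 1)))"
  have th: "\<theta> > 0" "\<theta> \<le> 1" using \<eta> A0 by (auto simp: \<theta>_def)
  have "\<theta> * A < \<eta>"
  proof -
    have "\<theta> * A \<le> \<eta> / (2 * (A + 1)) * A" unfolding \<theta>_def by (intro mult_right_mono) (use A0 in auto)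
    moreover have "\<eta> * A < \<eta> * (2 * (A + 1))" using \<eta> A0 by (intro mult_strict_left_mono) auto
    then have "\<eta> / (2 * (A + 1)) * A < \<eta>" using A0 by (simp add: divide_less_eq)
    ultimately show ?thesis by linarith
  qed
  show ?thesis
  proof (rule that[of "\<theta> * (e / 2)"])
    show "\<theta> * (e / 2) > 0" using th e by simp
    fix q assume q: "q \<in> polydisc d p (\<theta> * (e / 2))"
    have "\<theta> * (e / 2) \<le> 1 * (e / 2)" using th e by (intro mult_right_mono) auto
    then have "\<theta> * (e / 2) \<le> e" using e by simp
    then have q': "q \<in> polydisc d p e" using q by (force simp: polydisc_def)
    have "p \<in> polydisc d p e" using p e by (simp add: polydisc_iff)
    have D: "((\<lambda>k. c k * (\<Prod>i<d. (q i - p i) ^ k i) - c k * (\<Prod>i<d. (p i - p i) ^ k i)) has_sum (f q - f p)) (multi_idx d)"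
      using has_sum_add[OF c[OF q'] has_sum_uminus[THEN iffD2], of "\<lambda>k. c k * (\<Prod>i<d. (p i - p i) ^ k i)" "- f p"]
        c[OF \<open>p \<in> polydisc d p e\<close>] by simp
    have "cmod (f q - f p) \<le> \<theta> * A"
    proof (rule norm_infsum_le[OF D has_sum_cmult_right[OF A]])
      fix k assume k: "k \<in> multi_idx d"
      show "cmod (c k * (\<Prod>i<d. (q i - p i) ^ k i) - c k * (\<Prod>i<d. (p i - p i) ^ k i)) \<le> \<theta> * (cmod (c k) * (\<Prod>i<d. (e / 2) ^ k i))"
      proof (cases "\<forall>i<d. k i = 0")
        case True
        then show ?thesis using th e by (simp add: mult_nonneg_nonneg)
      next
        case False
        then obtain j where j: "j < d" "k j \<noteq> 0" by auto
        have "(\<Prod>i<d. (p i - p i) ^ k i) = 0" by (rule prod_zero) (use j in auto)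
        moreover have "cmod (\<Prod>i<d. (q i - p i) ^ k i) \<le> \<theta> * (\<Prod>i<d. (e / 2) ^ k i)"
        proof -
          have "cmod (\<Prod>i<d. (q i - p i) ^ k i) \<le> (\<Prod>i<d. (\<theta> * (e / 2)) ^ k i)"
            unfolding prod_norm[symmetric] norm_power
            by (intro prod_mono conjI power_mono) (use q in \<open>auto simp: polydisc_def less_imp_le\<close>)
          also have "\<dots> = \<theta> ^ (\<Sum>i<d. k i) * (\<Prod>i<d. (e / 2) ^ k i)"
            by (simp only: power_mult_distrib prod.distrib power_sum)
          also have "\<dots> \<le> \<theta> ^ 1 * (\<Prod>i<d. (e / 2) ^ k i)"
          proof (intro mult_right_mono power_decreasing)
            have "k j \<le> (\<Sum>i<d. k i)" using j by (intro member_le_sum) auto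
            then show "1 \<le> (\<Sum>i<d. k i)" using j by simp
          qed (use th e in \<open>auto intro!: prod_nonneg\<close>)
          finally show ?thesis by simp
        qed
        ultimately show ?thesis
          by (simp only: mult_zero_right diff_zero norm_mult mult.left_commute[of "\<theta>"]) (intro mult_left_mono norm_ge_zero)
      qed
    qed
    then show "cmod (f q - f p) < \<eta>" using \<open>\<theta> * A < \<eta>\<close> by simp
  qed
qed

section \<open>Identity principle on polydiscs and its globalisation\<close>

definition line_analytic :: "nat \<Rightarrow> (nat \<Rightarrow> complex) set \<Rightarrow> ((nat \<Rightarrow> complex) \<Rightarrow> complex) \<Rightarrow> bool" where
  "line_analytic d S f \<longleftrightarrow> (\<forall>s\<in>S. \<forall>v\<in>cspace d. (\<lambda>t. f (cline s v t)) field_differentiable at 0)"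

lemma line_analytic_mult: "line_analytic d S f \<Longrightarrow> line_analytic d S g \<Longrightarrow> line_analytic d S (\<lambda>s. f s * g s)"
  unfolding line_analytic_def by (auto intro!: field_differentiable_mult)

lemma line_analytic_diff: "line_analytic d S f \<Longrightarrow> line_analytic d S g \<Longrightarrow> line_analytic d S (\<lambda>s. f s - g s)"
  unfolding line_analytic_def by (auto intro!: field_differentiable_diff)

lemma line_analytic_subset: "line_analytic d S f \<Longrightarrow> T \<subseteq> S \<Longrightarrow> line_analytic d T f"
  unfolding line_analytic_def by blast

text \<open>A complex line meets a polydisc in a convex, hence connected, open set of parameters;
  the one-variable identity theorem on the line through u and q applies.\<close>

lemma line_analytic_identity:
  assumes f: "line_analytic d (polydisc d p e) f" and u: "u \<in> polydisc d p e" and \<delta>: "\<delta> > 0"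
    and z: "\<And>q. q \<in> polydisc d u \<delta> \<Longrightarrow> q \<in> polydisc d p e \<Longrightarrow> f q = 0"
    and q: "q \<in> polydisc d p e"
  shows "f q = 0"
proof -
  define v where "v = (\<lambda>i. q i - u i)"
  have uc: "u \<in> cspace d" using u by (simp add: polydisc_iff)
  have v: "v \<in> cspace d" using u q by (auto simp: v_def polydisc_def cspace_def)
  define T where "T = {t. cline u v t \<in> polydisc d p e}"
  define T' where "T' = T \<inter> {t. cline u v t \<in> polydisc d u \<delta>}"
  have oT: "open T" "open T'" unfolding T_def T'_def
    by (intro open_Int open_polydisc_line[OF uc v])+
  have "connected T" unfolding T_def by (intro convex_connected convex_polydisc_line[OF uc v])
  have "u \<in> polydisc d u \<delta>" using uc \<delta> by (simp add: polydisc_iff)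
  then have "0 \<in> T'" using u by (simp add: T_def T'_def)
  then have "T' \<noteq> {}" by blast
  have "(\<lambda>t. f (cline u v t)) holomorphic_on T"
  proof (unfold holomorphic_on_def, intro ballI)
    fix t assume t: "t \<in> T"
    then obtain D where "((\<lambda>w. f (cline (cline u v t) v w)) has_field_derivative D) (at 0)"
      using f v unfolding line_analytic_def field_differentiable_def T_def by blast
    then have "((\<lambda>w. f (cline u v w)) has_field_derivative D) (at t)"
      using DERIV_at_within_shift[of "\<lambda>w. f (cline u v w)" D t 0 UNIV] by (simp add: cline_cline)
    then show "(\<lambda>t. f (cline u v t)) field_differentiable at t within T"
      by (auto simp: field_differentiable_def intro: has_field_derivative_at_within)
  qed
  from analytic_continuation_open[OF oT(2) oT(1) \<open>T' \<noteq> {}\<close> \<open>connected T\<close> _ this, of "\<lambda>_. 0" 1]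
  have "1 \<in> T \<Longrightarrow> f (cline u v 1) = 0"
    using z by (auto simp: T'_def T_def)
  moreover have "cline u v 1 = q" by (simp add: cline_def v_def)
  ultimately show ?thesis using q by (simp add: T_def)
qed

lemma c_analytic_imp_line_analytic:
  assumes "\<And>q. q \<in> S \<Longrightarrow> c_analytic_at d f q" "S \<subseteq> cspace d"
  shows "line_analytic d S f"
  unfolding line_analytic_def using assms c_analytic_at_line by blast

lemma polydisc_centre: "p \<in> cspace d \<Longrightarrow> e > 0 \<Longrightarrow> p \<in> polydisc d p e"
  by (simp add: polydisc_iff)

lemma polydisc_mono: "e \<le> e' \<Longrightarrow> polydisc d p e \<subseteq> polydisc d p e'"
  by (force simp: polydisc_def)

text \<open>Let \<open>U\<close> be the interior of the coincidence set. Cross-multiplying local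
  quotients shows that the closure of \<open>U\<close> is open. On the line from u to an arbitrary
  point its parameters therefore form an open, closed and nonempty set, so the closure is
  everything.\<close>

theorem c_meromorphic_unique:
  assumes F1: "c_meromorphic d F1" and F2: "c_meromorphic d F2"
    and u: "u \<in> cspace d" and \<delta>: "\<delta> > 0" and eq: "\<And>s. s \<in> polydisc d u \<delta> \<Longrightarrow> F1 s = F2 s"
  shows "mero_eq d F1 F2"
proof -
  define U where "U = {s \<in> cspace d. \<exists>e>0. \<forall>q\<in>polydisc d s e. F1 q = F2 q}"
  define cl where "cl = (\<lambda>p. \<forall>e>0. polydisc d p e \<inter> U \<noteq> {})"
  have op: "\<exists>e>0. polydisc d p e \<subseteq> U" if "p \<in> U" for p
  proof -
    obtain e where e: "e > 0" "\<forall>q\<in>polydisc d p e. F1 q = F2 q" using \<open>p \<in> U\<close> unfolding U_def by blast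
    have "polydisc d p e \<subseteq> U"
    proof
      fix q assume q: "q \<in> polydisc d p e"
      then obtain e' where "e' > 0" "polydisc d q e' \<subseteq> polydisc d p e" by (rule polydisc_nbhd)
      then show "q \<in> U" using e q unfolding U_def by (auto simp: polydisc_iff)
    qed
    then show ?thesis using e by blast
  qed
  have cl_step: "\<exists>e>0. \<forall>q\<in>polydisc d p e. cl q" if p: "p \<in> cspace d" and clp: "cl p" for p
  proof -
    from bspec[OF F1[unfolded c_meromorphic_def] p] obtain e1 g1 h1 where a1: "e1 > 0"
      "(\<forall>q\<in>polydisc d p e1. c_analytic_at d g1 q \<and> c_analytic_at d h1 q) \<and>
      (\<exists>q\<in>polydisc d p e1. h1 q \<noteq> 0) \<and>
      (\<forall>q\<in>polydisc d p e1. h1 q \<noteq> 0 \<longrightarrow> F1 q = g1 q / h1 q)" by (elim exE conjE) (rule that; simp)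
    have 1: "e1 > 0" "\<And>q. q \<in> polydisc d p e1 \<Longrightarrow> c_analytic_at d g1 q \<and> c_analytic_at d h1 q"
      "\<exists>q\<in>polydisc d p e1. h1 q \<noteq> 0" "\<And>q. q \<in> polydisc d p e1 \<Longrightarrow> h1 q \<noteq> 0 \<Longrightarrow> F1 q = g1 q / h1 q"
      using a1 by simp_all
    from bspec[OF F2[unfolded c_meromorphic_def] p] obtain e2 g2 h2 where a2: "e2 > 0"
      "(\<forall>q\<in>polydisc d p e2. c_analytic_at d g2 q \<and> c_analytic_at d h2 q) \<and>
      (\<exists>q\<in>polydisc d p e2. h2 q \<noteq> 0) \<and>
      (\<forall>q\<in>polydisc d p e2. h2 q \<noteq> 0 \<longrightarrow> F2 q = g2 q / h2 q)" by (elim exE conjE) (rule that; simp)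
    have 2: "e2 > 0" "\<And>q. q \<in> polydisc d p e2 \<Longrightarrow> c_analytic_at d g2 q \<and> c_analytic_at d h2 q"
      "\<exists>q\<in>polydisc d p e2. h2 q \<noteq> 0" "\<And>q. q \<in> polydisc d p e2 \<Longrightarrow> h2 q \<noteq> 0 \<Longrightarrow> F2 q = g2 q / h2 q"
      using a2 by simp_all
    define e where "e = min e1 e2"
    have e: "e > 0" using 1 2 by (simp add: e_def)
    have s1: "polydisc d p e \<subseteq> polydisc d p e1" and s2: "polydisc d p e \<subseteq> polydisc d p e2"
      by (auto simp: e_def intro!: polydisc_mono)
    have la: "line_analytic d (polydisc d p e1) h1" "line_analytic d (polydisc d p e1) g1"
       "line_analytic d (polydisc d p e2) h2" "line_analytic d (polydisc d p e2) g2"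
      using 1(2) 2(2) by (auto intro!: c_analytic_imp_line_analytic polydisc_subset_cspace)
    \<comment> \<open>The extra factor \<open>h1 s * h2 s\<close> forces zeros where a denominator
      vanishes: there the values of \<open>F1\<close> and \<open>F2\<close> are arbitrary and their
      agreement carries no information about the quotients.\<close>
    define \<Psi> where "\<Psi> = (\<lambda>s. (g1 s * h2 s - g2 s * h1 s) * (h1 s * h2 s))"
    have la\<Psi>: "line_analytic d (polydisc d p e) \<Psi>" unfolding \<Psi>_def
      by (intro line_analytic_mult line_analytic_diff line_analytic_subset[OF _ s1] line_analytic_subset[OF _ s2] la)
    obtain w where w: "w \<in> polydisc d p e" "w \<in> U" using clp e unfolding cl_def by blast
    obtain \<epsilon> where eps: "\<epsilon> > 0" "\<forall>q\<in>polydisc d w \<epsilon>. F1 q = F2 q" using w by (auto simp: U_def)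
    have \<Psi>0: "\<Psi> q = 0" if "q \<in> polydisc d p e" for q
    proof (rule line_analytic_identity[OF la\<Psi> w(1) eps(1) _ that])
      fix x assume x: "x \<in> polydisc d w \<epsilon>" "x \<in> polydisc d p e"
      show "\<Psi> x = 0"
      proof (cases "h1 x = 0 \<or> h2 x = 0")
        case False
        have x12: "x \<in> polydisc d p e1" "x \<in> polydisc d p e2" using x(2) s1 s2 by blast+
        have "g1 x / h1 x = g2 x / h2 x" using 1(4)[OF x12(1)] 2(4)[OF x12(2)] eps(2) x(1) False by simp
        then show ?thesis using False by (simp add: \<Psi>_def field_simps)
      qed (auto simp: \<Psi>_def)
    qed
    have "cl q" if q: "q \<in> polydisc d p e" for q
      unfolding cl_def
    proof (intro allI impI)
      fix \<epsilon> :: real assume "\<epsilon> > 0"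
      \<comment> \<open>Two successive small moves: the first leaves the zeros of \<open>h1\<close>,
        the second those of \<open>h2\<close> while staying in a polydisc where \<open>h1\<close>
        has no zero.\<close>
      obtain x1 where x1: "x1 \<in> polydisc d q \<epsilon>" "x1 \<in> polydisc d p e" "h1 x1 \<noteq> 0"
      proof -
        obtain r where r: "r > 0" "polydisc d q r \<subseteq> polydisc d p e" using polydisc_nbhd[OF q] by blast
        have "\<exists>x\<in>polydisc d q (min r \<epsilon>). h1 x \<noteq> 0"
        proof (rule ccontr)
          assume "\<not> ?thesis"
          then have "h1 x = 0" if "x \<in> polydisc d p e1" for x
            using line_analytic_identity[OF la(1), of q "min r \<epsilon>" x] that q s1 r \<open>\<epsilon> > 0\<close> by auto
          then show False using 1(3) by auto
        qed
        then show ?thesis using that r polydisc_mono[of "min r \<epsilon>" r d q] polydisc_mono[of "min r \<epsilon>" \<epsilon> d q] by auto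
      qed
      have x1c: "x1 \<in> cspace d" using x1 by (simp add: polydisc_iff)
      have near: "\<exists>r>0. \<forall>x\<in>polydisc d y r. h x \<noteq> 0" if h: "c_analytic_at d h y" "h y \<noteq> 0" "y \<in> cspace d" for h :: "(nat \<Rightarrow> complex) \<Rightarrow> complex" and y
      proof -
        obtain r where r: "r > 0" "\<And>x. x \<in> polydisc d y r \<Longrightarrow> cmod (h x - h y) < cmod (h y)"
          using c_analytic_at_continuous[OF h(1,3), of "cmod (h y)"] h(2) by auto
        have "h x \<noteq> 0" if "x \<in> polydisc d y r" for x
          using r(2)[OF that] by auto
        then show ?thesis using r(1) by blast
      qed
      obtain r1 where r1: "r1 > 0" "\<forall>x\<in>polydisc d x1 r1. h1 x \<noteq> 0" using near[of h1 x1] 1(2) x1 s1 x1c by blast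
      obtain r2 where r2: "r2 > 0" "polydisc d x1 r2 \<subseteq> polydisc d p e" using polydisc_nbhd[OF x1(2)] by blast
      obtain r3 where r3: "r3 > 0" "polydisc d x1 r3 \<subseteq> polydisc d q \<epsilon>" using polydisc_nbhd[OF x1(1)] by blast
      define r where "r = min r1 (min r2 r3)"
      have r: "r > 0" "polydisc d x1 r \<subseteq> polydisc d x1 r1" "polydisc d x1 r \<subseteq> polydisc d x1 r2" "polydisc d x1 r \<subseteq> polydisc d x1 r3"
        using r1 r2 r3 by (auto simp: r_def intro!: polydisc_mono)
      have "\<exists>x\<in>polydisc d x1 r. h2 x \<noteq> 0"
      proof (rule ccontr)
        assume "\<not> ?thesis"
        then have "h2 x = 0" if "x \<in> polydisc d p e2" for x
          using line_analytic_identity[OF la(3), of x1 r x] that x1 s2 r by auto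
        then show False using 2(3) by auto
      qed
      then obtain x2 where x2: "x2 \<in> polydisc d x1 r" "h2 x2 \<noteq> 0" by blast
      have x2e: "x2 \<in> polydisc d p e" using x2 r r2 by blast
      have x2c: "x2 \<in> cspace d" using x2 by (simp add: polydisc_iff)
      obtain r4 where r4: "r4 > 0" "\<forall>x\<in>polydisc d x2 r4. h2 x \<noteq> 0" using near[of h2 x2] 2(2) x2 x2e s2 x2c by blast
      obtain r5 where r5: "r5 > 0" "polydisc d x2 r5 \<subseteq> polydisc d x1 r" using polydisc_nbhd[OF x2(1)] by blast
      have "F1 x = F2 x" if "x \<in> polydisc d x2 (min r4 r5)" for x
      proof -
        have x: "x \<in> polydisc d x2 r4" "x \<in> polydisc d x2 r5"
          using that polydisc_mono[of "min r4 r5" r4 d x2] polydisc_mono[of "min r4 r5" r5 d x2] by auto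
        then have h: "h1 x \<noteq> 0" "h2 x \<noteq> 0" "x \<in> polydisc d p e" using r4 r5 r r1 r2 by blast+
        then have "g1 x * h2 x - g2 x * h1 x = 0" using \<Psi>0[OF h(3)] by (simp add: \<Psi>_def)
        then have "g1 x / h1 x = g2 x / h2 x" using h by (simp add: field_simps)
        moreover have "x \<in> polydisc d p e1" "x \<in> polydisc d p e2" using h(3) s1 s2 by blast+
        ultimately show ?thesis using 1(4)[of x] 2(4)[of x] h by simp
      qed
      then have "x2 \<in> U" unfolding U_def using x2c r4(1) r5(1) by (auto intro!: exI[of _ "min r4 r5"])
      then show "polydisc d q \<epsilon> \<inter> U \<noteq> {}" using x2(1) r r3 by blast
    qed
    then show ?thesis using e by blast
  qed
  have uU: "u \<in> U" using u \<delta> eq by (auto simp: U_def)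
  have dense: "cl p" if p: "p \<in> cspace d" for p
  proof -
    define v where "v = (\<lambda>i. p i - u i)"
    have v: "v \<in> cspace d" using p u by (auto simp: v_def cspace_def)
    have "cl (cline u v 1)"
    proof (rule connected_induction_simple[where S = "UNIV :: complex set" and P = "\<lambda>t. cl (cline u v t)" and a = 0])
      show "cl (cline u v 0)" using uU polydisc_centre[OF u] by (auto simp: cl_def)
      fix t :: complex
      define y where "y = cline u v t"
      have y: "y \<in> cspace d" unfolding y_def using u v by blast
      have "\<exists>e>0. (\<forall>q\<in>polydisc d y e. cl q) \<or> (\<forall>q\<in>polydisc d y e. \<not> cl q)"
      proof (cases "cl y")
        case True
        then show ?thesis using cl_step[OF y] by blast
      next
        case False
        then obtain e where e: "e > 0" "polydisc d y e \<inter> U = {}" unfolding cl_def by blast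
        have "\<not> cl q" if q: "q \<in> polydisc d y e" for q
        proof -
          obtain e' where "e' > 0" "polydisc d q e' \<subseteq> polydisc d y e" using polydisc_nbhd[OF q] by blast
          then show ?thesis using e unfolding cl_def by blast
        qed
        then show ?thesis using e by blast
      qed
      then obtain e where e: "e > 0" "(\<forall>q\<in>polydisc d y e. cl q) \<or> (\<forall>q\<in>polydisc d y e. \<not> cl q)" by blast
      show "\<exists>T. openin (top_of_set UNIV) T \<and> t \<in> T \<and> (\<forall>x\<in>T. \<forall>z\<in>T. cl (cline u v x) \<longrightarrow> cl (cline u v z))"
        by (rule exI[of _ "{t. cline u v t \<in> polydisc d y e}"])
           (use e polydisc_centre[OF y e(1)] open_polydisc_line[OF u v] in \<open>auto simp: y_def\<close>)
    qed auto
    moreover have "cline u v 1 = p" by (simp add: cline_def v_def)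
    ultimately show ?thesis by simp
  qed
  have "F1 s = F2 s" if s: "s \<in> U" for s
  proof -
    obtain e where e: "e > 0" "\<forall>q\<in>polydisc d s e. F1 q = F2 q" and sc: "s \<in> cspace d"
      using s unfolding U_def by blast
    show ?thesis using e(2) polydisc_centre[OF sc e(1)] by blast
  qed
  then show ?thesis unfolding mero_eq_def using op dense
    by (intro exI[of _ U]) (auto simp: U_def cl_def)
qed

section \<open>Holomorphic extension across the polar hyperplanes\<close>

text \<open>In 1-based notation this is s_(j+1) + ... + s_i; half-open ranges behave well under
  dropping initial coordinates.\<close>

definition seg_sum :: "nat \<Rightarrow> nat \<Rightarrow> (nat \<Rightarrow> complex) \<Rightarrow> complex" where
  "seg_sum j i s = (\<Sum>t=j..<i. s t)"

definition generic :: "nat \<Rightarrow> (nat \<Rightarrow> complex) set" where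
  "generic d = {s \<in> cspace d. \<forall>j i. j < i \<longrightarrow> i \<le> d \<longrightarrow> seg_sum j i s \<notin> \<int>}"

definition seg_pairs :: "nat \<Rightarrow> (nat \<times> nat) set" where
  "seg_pairs d = {(j, i). j < i \<and> i \<le> d}"

text \<open>A sine vanishes at all integers, so one factor clears every parallel hyperplane of a
  segment, however far the asymptotic expansion is carried.\<close>

definition polar :: "nat \<Rightarrow> (nat \<Rightarrow> complex) \<Rightarrow> complex" where
  "polar d s = (\<Prod>(j, i)\<in>seg_pairs d. sin (of_real pi * seg_sum j i s))"

definition shiftn :: "nat \<Rightarrow> (nat \<Rightarrow> 'a) \<Rightarrow> nat \<Rightarrow> 'a" where
  "shiftn n f = (\<lambda>j. f (n + j))"

lemma shiftn_0 [simp]: "shiftn 0 f = f"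
  by (simp add: shiftn_def)

lemma shiftn_shiftn [simp]: "shiftn m (shiftn n f) = shiftn (m + n) f"
  by (simp add: shiftn_def ac_simps)

lemma seg_sum_shiftn: "seg_sum j i (shiftn n s) = seg_sum (n + j) (n + i) s"
  unfolding seg_sum_def shiftn_def using sum.shift_bounds_nat_ivl[of s j n i] by (simp add: add.commute)

lemma seg_sum_cline: "seg_sum j i (cline s v t) = seg_sum j i s + t * seg_sum j i v"
  by (simp add: seg_sum_def cline_def sum.distrib sum_distrib_left)

lemma seg_sum_Suc: "seg_sum 0 (Suc i) s = s 0 + seg_sum 0 i (shiftn 1 s)"
  unfolding seg_sum_def shiftn_def by (simp add: sum.atLeast0_lessThan_Suc_shift del: sum.op_ivl_Suc)

lemma norm_seg_sum_le: "(\<And>t. t < i \<Longrightarrow> cmod (s t) \<le> B) \<Longrightarrow> cmod (seg_sum j i s) \<le> real i * B"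
proof -
  assume B: "\<And>t. t < i \<Longrightarrow> cmod (s t) \<le> B"
  show ?thesis
  proof (cases "j < i")
    case True
    have "cmod (seg_sum j i s) \<le> (\<Sum>t=j..<i. B)" unfolding seg_sum_def
      by (intro sum_norm_le) (use B in auto)
    also have "\<dots> \<le> real i * B"
    proof -
      have "B \<ge> 0" using B[of j] True by (meson norm_ge_zero order_trans)
      then show ?thesis by (simp add: mult_right_mono)
    qed
    finally show ?thesis .
  next
    case False
    then show ?thesis using B[of 0] by (cases "i = 0") (auto simp: seg_sum_def intro: mult_nonneg_nonneg order_trans[OF norm_ge_zero])
  qed
qed

lemma finite_seg_pairs [simp, intro]: "finite (seg_pairs d)"
  by (rule finite_subset[of _ "{..d} \<times> {..d}"]) (auto simp: seg_pairs_def)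

lemma genericD: "s \<in> generic d \<Longrightarrow> j < i \<Longrightarrow> i \<le> d \<Longrightarrow> seg_sum j i s \<notin> \<int>"
  by (simp add: generic_def)

lemma generic_subset_cspace: "generic d \<subseteq> cspace d"
  by (auto simp: generic_def)

lemma shiftn_cspace: "s \<in> cspace (n + d) \<Longrightarrow> shiftn n s \<in> cspace d"
  by (auto simp: cspace_def shiftn_def)

lemma shiftn_generic: "s \<in> generic (n + d) \<Longrightarrow> shiftn n s \<in> generic d"
  by (auto simp: generic_def seg_sum_shiftn shiftn_cspace)

lemma shiftn_polydisc: "s \<in> polydisc (n + d) (\<lambda>_. 0) B \<Longrightarrow> shiftn n s \<in> polydisc d (\<lambda>_. 0) B"
  by (auto simp: polydisc_def shiftn_def)

lemma sin_pi_eq_0_iff: "sin (of_real pi * x :: complex) = 0 \<longleftrightarrow> x \<in> \<int>"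
proof -
  have "sin (of_real pi * x :: complex) = 0 \<longleftrightarrow> (\<exists>n::int. x = of_int n)"
    unfolding sin_eq_0 by (auto simp: algebra_simps)
  then show ?thesis by (auto elim: Ints_cases)
qed

lemma generic_iff_polar: "s \<in> generic d \<longleftrightarrow> s \<in> cspace d \<and> polar d s \<noteq> 0"
proof -
  have "polar d s \<noteq> 0 \<longleftrightarrow> (\<forall>x\<in>seg_pairs d. seg_sum (fst x) (snd x) s \<notin> \<int>)"
    unfolding polar_def case_prod_beta by (simp add: sin_pi_eq_0_iff)
  also have "\<dots> \<longleftrightarrow> (\<forall>j i. j < i \<longrightarrow> i \<le> d \<longrightarrow> seg_sum j i s \<notin> \<int>)"
    unfolding seg_pairs_def by auto
  finally show ?thesis by (simp add: generic_def)
qed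

lemma polar_nonzero: "s \<in> generic d \<Longrightarrow> polar d s \<noteq> 0"
  by (simp add: generic_iff_polar)

lemma eventually_line_notin_Ints:
  fixes x c :: complex
  assumes "c \<noteq> 0"
  shows "eventually (\<lambda>t. x + t * c \<notin> \<int>) (at 0)"
proof -
  have "closed (\<int> - {x})" by (rule closed_subset_Ints) auto
  then have "open ((\<lambda>t. x + t * c) -` (- (\<int> - {x})))"
    by (rule open_vimage[OF open_Compl]) (intro continuous_intros)
  then have "eventually (\<lambda>t. t \<in> (\<lambda>t. x + t * c) -` (- (\<int> - {x})) - {0}) (at 0)"
    by (intro eventually_at_in_open) auto
  then show ?thesis by eventually_elim (use assms in auto)
qed

lemma eventually_line_generic:
  assumes s: "s \<in> cspace d" and v: "v \<in> cspace d" and nz: "\<And>j i. j < i \<Longrightarrow> i \<le> d \<Longrightarrow> seg_sum j i v \<noteq> 0"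
  shows "eventually (\<lambda>t. cline s v t \<in> generic d) (at 0)"
proof -
  have "eventually (\<lambda>t. \<forall>x\<in>seg_pairs d. seg_sum (fst x) (snd x) s + t * seg_sum (fst x) (snd x) v \<notin> \<int>) (at 0)"
    by (intro eventually_ball_finite ballI eventually_line_notin_Ints finite_seg_pairs) (auto simp: seg_pairs_def nz)
  then show ?thesis
    by eventually_elim (use s v in \<open>auto simp: generic_def seg_sum_cline seg_pairs_def\<close>)
qed

text \<open>A direction along which no segment sum stays constant, so every point is a limit of
  generic points on its diagonal line.\<close>

definition diag_vec :: "nat \<Rightarrow> nat \<Rightarrow> complex" where
  "diag_vec d = (\<lambda>i. if i < d then 1 else 0)"

lemma diag_vec_cspace [simp]: "diag_vec d \<in> cspace d"
  by (simp add: diag_vec_def cspace_def)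

lemma seg_sum_diag_vec: "i \<le> d \<Longrightarrow> seg_sum j i (diag_vec d) = of_nat (i - j)"
  by (simp add: seg_sum_def diag_vec_def)

lemma eventually_diag_generic: "s \<in> cspace d \<Longrightarrow> eventually (\<lambda>t. cline s (diag_vec d) t \<in> generic d) (at 0)"
  by (rule eventually_line_generic) (auto simp: seg_sum_diag_vec)

text \<open>Continuity along the diagonal line carries an estimate from generic points to the
  excluded hyperplanes.\<close>

lemma bound_from_generic:
  assumes g: "bdd_gateaux d (polydisc d p e) g"
    and le: "\<And>s. s \<in> generic d \<inter> polydisc d p e \<Longrightarrow> cmod (g s) \<le> C"
    and s: "s \<in> polydisc d p e"
  shows "cmod (g s) \<le> C"
proof -
  have sc: "s \<in> cspace d" using s by (simp add: polydisc_iff)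
  let ?l = "\<lambda>t. cline s (diag_vec d) t"
  have "(\<lambda>t. g (?l t)) field_differentiable at 0"
    using g s unfolding bdd_gateaux_def by simp
  then have "isCont (\<lambda>t. g (?l t)) 0" by (rule field_differentiable_imp_continuous_at)
  then have "((\<lambda>t. cmod (g (?l t))) \<longlongrightarrow> cmod (g s)) (at 0)"
    using isCont_def tendsto_norm by fastforce
  moreover have "eventually (\<lambda>t. ?l t \<in> polydisc d p e) (at 0)"
    using eventually_at_in_open'[OF open_polydisc_line[OF sc diag_vec_cspace], of 0 p e] s by simp
  then have "eventually (\<lambda>t. cmod (g (?l t)) \<le> C) (at 0)"
    using eventually_diag_generic[OF sc] by eventually_elim (use le in auto)
  ultimately show ?thesis by (rule tendsto_upperbound) auto
qed

text \<open>The continued functions are only known on \<open>generic d\<close>; this predicate says that a function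
  extends holomorphically across the excluded hyperplanes.\<close>

definition extends_holo :: "nat \<Rightarrow> ((nat \<Rightarrow> complex) \<Rightarrow> complex) \<Rightarrow> bool" where
  "extends_holo d f \<longleftrightarrow> (\<forall>B. \<exists>g. bdd_gateaux d (polydisc d (\<lambda>_. 0) B) g \<and>
     (\<forall>s\<in>generic d \<inter> polydisc d (\<lambda>_. 0) B. g s = f s))"

lemma extends_holo_cong:
  "extends_holo d f \<Longrightarrow> (\<And>s. s \<in> generic d \<Longrightarrow> f s = f' s) \<Longrightarrow> extends_holo d f'"
  unfolding extends_holo_def by simp

lemma extends_holoI: "(\<And>B. bdd_gateaux d (polydisc d (\<lambda>_. 0) B) f) \<Longrightarrow> extends_holo d f"
  unfolding extends_holo_def by blast

lemma extends_holo_bound: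
  assumes "extends_holo d f"
  obtains C where "C \<ge> 0" "\<And>s. s \<in> generic d \<inter> polydisc d (\<lambda>_. 0) B \<Longrightarrow> cmod (f s) \<le> C"
proof -
  obtain g where g: "bdd_gateaux d (polydisc d (\<lambda>_. 0) B) g" "\<forall>s\<in>generic d \<inter> polydisc d (\<lambda>_. 0) B. g s = f s"
    using assms unfolding extends_holo_def by blast
  obtain C where C: "C \<ge> 0" "\<And>s. s \<in> polydisc d (\<lambda>_. 0) B \<Longrightarrow> cmod (g s) \<le> C" using bdd_gateauxE[OF g(1)] by blast
  show ?thesis
  proof (rule that[OF C(1)])
    fix s assume s: "s \<in> generic d \<inter> polydisc d (\<lambda>_. 0) B"
    then have "g s = f s" using g(2) by blast
    then show "cmod (f s) \<le> C" using C(2)[of s] s by simp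
  qed
qed

lemma extends_holo_const [intro]: "extends_holo d (\<lambda>_. c)"
  by (rule extends_holoI) blast

lemma extends_holo_add:
  assumes "extends_holo d f" "extends_holo d g"
  shows "extends_holo d (\<lambda>s. f s + g s)"
  unfolding extends_holo_def
proof
  fix B
  obtain f' where f': "bdd_gateaux d (polydisc d (\<lambda>_. 0) B) f'" "\<forall>s\<in>generic d \<inter> polydisc d (\<lambda>_. 0) B. f' s = f s"
    using assms(1) unfolding extends_holo_def by blast
  obtain g' where g': "bdd_gateaux d (polydisc d (\<lambda>_. 0) B) g'" "\<forall>s\<in>generic d \<inter> polydisc d (\<lambda>_. 0) B. g' s = g s"
    using assms(2) unfolding extends_holo_def by blast
  show "\<exists>h. bdd_gateaux d (polydisc d (\<lambda>_. 0) B) h \<and> (\<forall>s\<in>generic d \<inter> polydisc d (\<lambda>_. 0) B. h s = f s + g s)"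
    using bdd_gateaux_add[OF f'(1) g'(1)] f'(2) g'(2) by (intro exI[of _ "\<lambda>s. f' s + g' s"]) simp
qed

lemma extends_holo_mult:
  assumes "extends_holo d f" "extends_holo d g"
  shows "extends_holo d (\<lambda>s. f s * g s)"
  unfolding extends_holo_def
proof
  fix B
  obtain f' where f': "bdd_gateaux d (polydisc d (\<lambda>_. 0) B) f'" "\<forall>s\<in>generic d \<inter> polydisc d (\<lambda>_. 0) B. f' s = f s"
    using assms(1) unfolding extends_holo_def by blast
  obtain g' where g': "bdd_gateaux d (polydisc d (\<lambda>_. 0) B) g'" "\<forall>s\<in>generic d \<inter> polydisc d (\<lambda>_. 0) B. g' s = g s"
    using assms(2) unfolding extends_holo_def by blast
  show "\<exists>h. bdd_gateaux d (polydisc d (\<lambda>_. 0) B) h \<and> (\<forall>s\<in>generic d \<inter> polydisc d (\<lambda>_. 0) B. h s = f s * g s)"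
    using bdd_gateaux_mult[OF f'(1) g'(1)] f'(2) g'(2) by (intro exI[of _ "\<lambda>s. f' s * g' s"]) simp
qed

lemma extends_holo_diff:
  "extends_holo d f \<Longrightarrow> extends_holo d g \<Longrightarrow> extends_holo d (\<lambda>s. f s - g s)"
  using extends_holo_add[of d f "\<lambda>s. (-1) * g s"] extends_holo_mult[of d "\<lambda>_. -1" g] by auto

lemma extends_holo_sum: "(\<And>x. x \<in> A \<Longrightarrow> extends_holo d (f x)) \<Longrightarrow> extends_holo d (\<lambda>s. \<Sum>x\<in>A. f x s)"
  by (induction A rule: infinite_finite_induct) (auto intro!: extends_holo_add)

lemma extends_holo_prod: "(\<And>x. x \<in> A \<Longrightarrow> extends_holo d (f x)) \<Longrightarrow> extends_holo d (\<lambda>s. \<Prod>x\<in>A. f x s)"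
  by (induction A rule: infinite_finite_induct) (auto intro!: extends_holo_mult)

lemma bdd_gateaux_seg_sum:
  assumes \<phi>: "\<phi> holomorphic_on UNIV" and i: "i \<le> d"
  shows "bdd_gateaux d (polydisc d p e) (\<lambda>s. \<phi> (seg_sum j i s))"
proof (rule bdd_gateaux_compose_linear[OF \<phi>])
  show "seg_sum j i (cline s v t) = seg_sum j i s + t * seg_sum j i v" for s v t
    by (rule seg_sum_cline)
  define B where "B = (\<Sum>t<d. cmod (p t)) + e"
  show "cmod (seg_sum j i s) \<le> real i * B" if s: "s \<in> polydisc d p e" for s
  proof (rule norm_seg_sum_le)
    fix t assume t: "t < i"
    have "cmod (s t) \<le> cmod (p t) + cmod (s t - p t)" using norm_triangle_sub by blast
    also have "cmod (s t - p t) \<le> e" using s t i by (auto simp: polydisc_def less_imp_le)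
    also have "cmod (p t) \<le> (\<Sum>t<d. cmod (p t))" using t i by (intro member_le_sum) auto
    finally show "cmod (s t) \<le> B" by (simp add: B_def)
  qed
qed

lemma extends_holo_seg_sum: "\<phi> holomorphic_on UNIV \<Longrightarrow> i \<le> d \<Longrightarrow> extends_holo d (\<lambda>s. \<phi> (seg_sum j i s))"
  by (intro extends_holoI bdd_gateaux_seg_sum)

lemma bdd_gateaux_polar: "bdd_gateaux d (polydisc d p e) (polar d)"
  unfolding polar_def case_prod_beta
  by (intro bdd_gateaux_prod bdd_gateaux_seg_sum[where \<phi> = "\<lambda>x. sin (of_real pi * x)"] holomorphic_intros)
     (auto simp: seg_pairs_def)

lemma extends_holo_sin: "i \<le> d \<Longrightarrow> extends_holo d (\<lambda>s. sin (of_real pi * seg_sum j i s))"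
  by (rule extends_holo_seg_sum[where \<phi> = "\<lambda>x. sin (of_real pi * x)"]) (auto intro!: holomorphic_intros)

lemma extends_holo_powr:
  assumes "N \<ge> 1" "i \<le> d"
  shows "extends_holo d (\<lambda>s. of_nat N powr (- (seg_sum j i s + c)))"
proof -
  have "extends_holo d (\<lambda>s. exp (- (seg_sum j i s + c) * of_real (ln (real N))))"
    by (rule extends_holo_seg_sum[where \<phi> = "\<lambda>x. exp (- (x + c) * of_real (ln (real N)))"])
       (use assms in \<open>auto intro!: holomorphic_intros\<close>)
  then show ?thesis
    by (rule extends_holo_cong) (use assms in \<open>simp add: powr_def Ln_of_nat\<close>)
qed

lemma extends_holo_shiftn:
  assumes f: "extends_holo d f"
  shows "extends_holo (n + d) (\<lambda>s. f (shiftn n s))"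
  unfolding extends_holo_def
proof
  fix B
  obtain g where g: "bdd_gateaux d (polydisc d (\<lambda>_. 0) B) g" "\<forall>s\<in>generic d \<inter> polydisc d (\<lambda>_. 0) B. g s = f s"
    using f unfolding extends_holo_def by blast
  obtain C where C: "\<And>s. s \<in> polydisc d (\<lambda>_. 0) B \<Longrightarrow> cmod (g s) \<le> C" using bdd_gateauxE[OF g(1)] by blast
  have "bdd_gateaux (n + d) (polydisc (n + d) (\<lambda>_. 0) B) (\<lambda>s. g (shiftn n s))"
    unfolding bdd_gateaux_def
  proof (intro conjI ballI)
    fix s v assume s: "s \<in> polydisc (n + d) (\<lambda>_. 0) B" and v: "v \<in> cspace (n + d)"
    have "shiftn n (cline s v t) = cline (shiftn n s) (shiftn n v) t" for t
      by (simp add: shiftn_def cline_def)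
    then show "(\<lambda>t. g (shiftn n (cline s v t))) field_differentiable at 0"
      using g(1) shiftn_polydisc[OF s] shiftn_cspace[OF v] unfolding bdd_gateaux_def by simp
  next
    show "\<exists>C. \<forall>s\<in>polydisc (n + d) (\<lambda>_. 0) B. cmod (g (shiftn n s)) \<le> C"
      using C shiftn_polydisc by blast
  qed
  then show "\<exists>h. bdd_gateaux (n + d) (polydisc (n + d) (\<lambda>_. 0) B) h \<and>
      (\<forall>s\<in>generic (n + d) \<inter> polydisc (n + d) (\<lambda>_. 0) B. h s = f (shiftn n s))"
    using g(2) shiftn_polydisc shiftn_generic by (intro exI[of _ "\<lambda>s. g (shiftn n s)"]) blast
qed

text \<open>The rate C/N is known at generic points only. The resulting bound for differences passes
  to the extensions of the approximants, which become uniformly Cauchy on the whole polydisc; their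
  limit extends f.\<close>

lemma extends_holo_limit:
  assumes "\<And>B. \<exists>h C. \<forall>N::nat\<ge>1. extends_holo d (h N) \<and>
      (\<forall>s\<in>generic d \<inter> polydisc d (\<lambda>_. 0) B. cmod (f s - h N s) \<le> C / real N)"
  shows "extends_holo d f"
  unfolding extends_holo_def
proof
  fix B
  let ?P = "polydisc d (\<lambda>_. 0) B"
  from assms[of B] obtain h C where "\<forall>N::nat\<ge>1. extends_holo d (h N) \<and>
      (\<forall>s\<in>generic d \<inter> ?P. cmod (f s - h N s) \<le> C / real N)" by (elim exE)
  then have h: "\<And>N. N \<ge> 1 \<Longrightarrow> extends_holo d (h N)"
    "\<And>N s. N \<ge> 1 \<Longrightarrow> s \<in> generic d \<inter> ?P \<Longrightarrow> cmod (f s - h N s) \<le> C / real N"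
    by simp_all
  have "\<forall>N. \<exists>g. bdd_gateaux d ?P g \<and> (\<forall>s\<in>generic d \<inter> ?P. g s = h (Suc N) s)"
    using h(1)[unfolded extends_holo_def] by simp
  from choice[OF this] obtain g where g: "\<And>N. bdd_gateaux d ?P (g N)"
    "\<And>N s. s \<in> generic d \<inter> ?P \<Longrightarrow> g N s = h (Suc N) s" by blast
  have le0: "cmod (g M s - g N s) \<le> C / real (Suc N) + C / real (Suc M)" if s: "s \<in> generic d \<inter> ?P" for M N s
  proof -
    have "cmod (g M s - g N s) = cmod ((f s - h (Suc N) s) - (f s - h (Suc M) s))"
      using g(2)[OF s] by simp
    also have "\<dots> \<le> cmod (f s - h (Suc N) s) + cmod (f s - h (Suc M) s)" by (rule norm_triangle_ineq4)
    also have "\<dots> \<le> C / real (Suc N) + C / real (Suc M)" by (intro add_mono h(2) s) auto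
    finally show ?thesis .
  qed
  have le: "cmod (g M s - g N s) \<le> C / real (Suc N) + C / real (Suc M)" if "s \<in> ?P" for M N s
  proof (rule bound_from_generic[OF _ le0 that])
    show "bdd_gateaux d ?P (\<lambda>s. g M s - g N s)"
      using bdd_gateaux_add[OF g(1)[of M] bdd_gateaux_mult[OF bdd_gateaux_const[of d ?P "-1"] g(1)[of N]]] by simp
  qed
  have "uniformly_Cauchy_on ?P g"
  proof (rule uniformly_Cauchy_onI)
    fix e :: real assume "e > 0"
    have "(\<lambda>N. C / real (Suc N)) \<longlonglongrightarrow> 0"
      by (rule LIMSEQ_Suc[OF lim_const_over_n])
    then have "eventually (\<lambda>N. C / real (Suc N) < e / 2) sequentially"
      by (rule order_tendstoD) (use \<open>e > 0\<close> in simp)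
    then obtain N0 where N0: "\<And>N. N \<ge> N0 \<Longrightarrow> C / real (Suc N) < e / 2"
      unfolding eventually_sequentially by blast
    have "dist (g m x) (g n x) < e" if "x \<in> ?P" "m \<ge> N0" "n \<ge> N0" for x m n
      using le[OF that(1), of m n] N0[OF that(2)] N0[OF that(3)] unfolding dist_norm by linarith
    then show "\<exists>M. \<forall>x\<in>?P. \<forall>m\<ge>M. \<forall>n\<ge>M. dist (g m x) (g n x) < e" by blast
  qed
  then have "uniformly_convergent_on ?P g" by (rule Cauchy_uniformly_convergent)
  then obtain l where l: "uniform_limit ?P g l sequentially" by (auto simp: uniformly_convergent_on_def)
  have "l s = f s" if s: "s \<in> generic d \<inter> ?P" for s
  proof -
    have "(\<lambda>N. g N s) \<longlonglongrightarrow> l s" by (rule tendsto_uniform_limitI[OF l]) (use s in blast)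
    moreover have "(\<lambda>N. g N s) \<longlonglongrightarrow> f s"
    proof (rule LIM_zero_cancel, rule Lim_null_comparison)
      have "norm (g N s - f s) \<le> C / real (Suc N)" for N
        using h(2)[OF _ s, of "Suc N"] g(2)[OF s] by (simp add: norm_minus_commute)
      then show "\<forall>\<^sub>F N in sequentially. norm (g N s - f s) \<le> C / real (Suc N)" by simp
      show "(\<lambda>N. C / real (Suc N)) \<longlonglongrightarrow> 0" by (rule LIMSEQ_Suc[OF lim_const_over_n])
    qed
    ultimately show ?thesis by (rule LIMSEQ_unique)
  qed
  then show "\<exists>g. bdd_gateaux d ?P g \<and> (\<forall>s\<in>generic d \<inter> ?P. g s = f s)"
    using bdd_gateaux_uniform_limit[OF g(1) l] by blast
qed

text \<open>The only possible pole comes from 1/(x + n - 1); it sits at an integer, where the sine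
  vanishes, and is removable.\<close>

lemma holomorphic_sin_pi_gpoch:
  "\<exists>\<phi>. \<phi> holomorphic_on UNIV \<and> (\<forall>x. x \<notin> \<int> \<longrightarrow> \<phi> x = sin (of_real pi * x) * gpoch (x + of_int n) m)"
proof -
  consider "m \<ge> 0" | "m = -1" | "m < -1" by linarith
  then show ?thesis
  proof cases
    case 1
    then show ?thesis
      by (intro exI[of _ "\<lambda>x. sin (of_real pi * x) * pochhammer (x + of_int n) (nat m)"])
         (auto simp: gpoch_def pochhammer_prod intro!: holomorphic_intros)
  next
    case 2
    define a :: complex where "a = of_int (1 - n)"
    define \<phi> where "\<phi> = (\<lambda>z. if z = a then deriv (\<lambda>x. sin (of_real pi * x)) a else (sin (of_real pi * z) - sin (of_real pi * a)) / (z - a))"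
    have "\<phi> holomorphic_on UNIV" unfolding \<phi>_def
      by (rule pole_lemma_open) (auto intro!: holomorphic_intros)
    moreover have "sin (of_real pi * a) = 0" unfolding sin_pi_eq_0_iff by (simp add: a_def)
    then have "\<phi> x = sin (of_real pi * x) * gpoch (x + of_int n) m" if "x \<notin> \<int>" for x
    proof -
      have "x \<noteq> a" using that by (auto simp: a_def)
      then show ?thesis using \<open>sin (of_real pi * a) = 0\<close> by (simp add: \<phi>_def gpoch_def 2 a_def algebra_simps)
    qed
    ultimately show ?thesis by blast
  next
    case 3
    then show ?thesis by (intro exI[of _ "\<lambda>_. 0"]) (auto simp: gpoch_def)
  qed
qed

lemma extends_holo_sin_gpoch:
  assumes "j < i" "i \<le> d"
  shows "extends_holo d (\<lambda>s. sin (of_real pi * seg_sum j i s) * gpoch (seg_sum j i s + of_int n) m)"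
proof -
  obtain \<phi> where \<phi>: "\<phi> holomorphic_on UNIV"
    "\<And>x. x \<notin> \<int> \<Longrightarrow> \<phi> x = sin (of_real pi * x) * gpoch (x + of_int n) m"
    using holomorphic_sin_pi_gpoch[of n m] by auto
  have "extends_holo d (\<lambda>s. \<phi> (seg_sum j i s))" by (rule extends_holo_seg_sum) (use \<phi> assms in auto)
  then show ?thesis by (rule extends_holo_cong) (use \<phi>(2) assms in \<open>auto dest: genericD\<close>)
qed

text \<open>Segments starting at i or later clear the poles of the polylogarithm in the variables
  from i on, and segments ending at i clear those of \<open>tail_coeff i\<close>. The two families
  are disjoint, and \<open>R\<close> collects the sines of the other segments.\<close>

lemma polar_factor:
  assumes "i \<le> d"
  obtains R where "extends_holo d R"
    "\<And>s. polar d s = R s * polar (d - i) (shiftn i s) * (\<Prod>j<i. sin (of_real pi * seg_sum j i s))"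
proof
  define A where "A = (\<lambda>(j, l). (i + j, i + l)) ` seg_pairs (d - i)"
  define B where "B = (\<lambda>j. (j, i)) ` {..<i}"
  let ?f = "\<lambda>s (j, l). sin (of_real pi * seg_sum j l s) :: complex"
  have sub: "A \<subseteq> seg_pairs d" "B \<subseteq> seg_pairs d" "A \<inter> B = {}"
    using assms by (auto simp: A_def B_def seg_pairs_def)
  show "extends_holo d (\<lambda>s. prod (?f s) (seg_pairs d - (A \<union> B)))"
    unfolding case_prod_beta by (intro extends_holo_prod extends_holo_sin) (auto simp: seg_pairs_def)
  show "polar d s = prod (?f s) (seg_pairs d - (A \<union> B)) * polar (d - i) (shiftn i s) * (\<Prod>j<i. sin (of_real pi * seg_sum j i s))" for s
  proof -
    have fin: "finite A" "finite B" by (auto simp: A_def B_def)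
    have "polar d s = prod (?f s) (seg_pairs d - (A \<union> B)) * prod (?f s) (A \<union> B)"
      unfolding polar_def by (rule prod.subset_diff) (use sub in auto)
    also have "prod (?f s) (A \<union> B) = prod (?f s) A * prod (?f s) B"
      by (rule prod.union_disjoint) (use fin sub in auto)
    also have "prod (?f s) A = polar (d - i) (shiftn i s)"
      unfolding A_def polar_def by (subst prod.reindex) (auto simp: inj_on_def seg_sum_shiftn intro!: prod.cong)
    also have "prod (?f s) B = (\<Prod>j<i. sin (of_real pi * seg_sum j i s))"
      unfolding B_def by (subst prod.reindex) (auto simp: inj_on_def)
    finally show ?thesis by (simp add: mult_ac)
  qed
qed

lemma polar_Suc:
  obtains V where "extends_holo (Suc d) V" "\<And>s. polar (Suc d) s = V s * polar d (shiftn 1 s)"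
proof -
  obtain R where R: "extends_holo (Suc d) R"
    "\<And>s. polar (Suc d) s = R s * polar (Suc d - 1) (shiftn 1 s) * (\<Prod>j<1. sin (of_real pi * seg_sum j 1 s))"
    using polar_factor[of 1 "Suc d"] by auto
  show ?thesis
    by (rule that[of "\<lambda>s. R s * (\<Prod>j<1. sin (of_real pi * seg_sum j 1 s))"])
       (auto intro!: extends_holo_mult R extends_holo_prod extends_holo_sin simp: R(2))
qed

section \<open>Asymptotic expansion of the partial sums\<close>

definition head_prod :: "nat \<Rightarrow> (nat \<Rightarrow> complex) \<Rightarrow> complex" where
  "head_prod i z = (\<Prod>t<i. z t)"

lemma head_prod_Suc: "head_prod (Suc i) z = z 0 * head_prod i (shiftn 1 z)"
  unfolding head_prod_def shiftn_def by (subst prod.lessThan_Suc_shift) simp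

lemma norm_head_prod: "(\<And>t. t < i \<Longrightarrow> cmod (z t) = 1) \<Longrightarrow> cmod (head_prod i z) = 1"
  by (simp add: head_prod_def prod_norm[symmetric])

text \<open>An Euler-Maclaurin term of index k turns N^(-s) into N^(-(s + k - q)), with q = 1
  exactly when the accumulated root of unity is 1.\<close>

primrec tail_exp :: "nat \<Rightarrow> (nat \<Rightarrow> complex) \<Rightarrow> (nat \<Rightarrow> nat) \<Rightarrow> int" where
  "tail_exp 0 z k = 0"
| "tail_exp (Suc i) z k = tail_exp i (shiftn 1 z) (shiftn 1 k) + int (k 0) - int (dq (head_prod (Suc i) z))"

text \<open>Inner sums are expanded first: the exponent they leave behind, together with the
  exponent of the current variable, is the argument of the next \<open>gpoch\<close>.\<close>

primrec tail_coeff :: "nat \<Rightarrow> (nat \<Rightarrow> complex) \<Rightarrow> (nat \<Rightarrow> complex) \<Rightarrow> (nat \<Rightarrow> nat) \<Rightarrow> complex" where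
  "tail_coeff 0 z s k = 1"
| "tail_coeff (Suc i) z s k = - em_coeff (head_prod (Suc i) z) (k 0) *
     gpoch (seg_sum 0 (Suc i) s + of_int (tail_exp i (shiftn 1 z) (shiftn 1 k)))
       (int (k 0) - int (dq (head_prod (Suc i) z))) *
     tail_coeff i (shiftn 1 z) (shiftn 1 s) (shiftn 1 k)"

definition idx_box :: "nat \<Rightarrow> nat \<Rightarrow> (nat \<Rightarrow> nat) set" where
  "idx_box i K = {k. (\<forall>j<i. k j \<le> K) \<and> (\<forall>j\<ge>i. k j = 0)}"

text \<open>The factor multiplying the polylogarithm of the inner variables: these have been
  replaced by the constant term of their sum, and the i outer variables are then summed by
  Euler-Maclaurin.\<close>

definition tail_sum :: "nat \<Rightarrow> nat \<Rightarrow> (nat \<Rightarrow> complex) \<Rightarrow> nat \<Rightarrow> (nat \<Rightarrow> complex) \<Rightarrow> complex" where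
  "tail_sum i K z N s = head_prod i z ^ N *
     (\<Sum>k\<in>idx_box i K. tail_coeff i z s k * of_nat N powr (- (seg_sum 0 i s + of_int (tail_exp i z k))))"

primrec nested_psum :: "nat \<Rightarrow> (nat \<Rightarrow> complex) \<Rightarrow> nat \<Rightarrow> (nat \<Rightarrow> complex) \<Rightarrow> complex" where
  "nested_psum 0 z N s = 1"
| "nested_psum (Suc d) z N s = (\<Sum>n\<in>{1..<N}. z 0 ^ n * of_nat n powr (- s 0) * nested_psum d (shiftn 1 z) n (shiftn 1 s))"

text \<open>The analytic continuation of the polylogarithm as the constant term of the asymptotic
  expansion of its partial sums. The expansion is truncated at order \<open>K\<close>; the limit
  does not depend on \<open>K\<close> once \<open>K\<close> is large.\<close>

fun Li_cont :: "nat \<Rightarrow> (nat \<Rightarrow> complex) \<Rightarrow> (nat \<Rightarrow> complex) \<Rightarrow> complex" where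
  "Li_cont 0 z s = 1"
| "Li_cont (Suc d) z s = (THE l. \<forall>\<^sub>F K in sequentially.
     (\<lambda>N. nested_psum (Suc d) z N s -
        (\<Sum>i<Suc d. Li_cont (d - i) (shiftn (Suc i) z) (shiftn (Suc i) s) * tail_sum (Suc i) K z N s)) \<longlonglongrightarrow> l)"

declare Li_cont.simps(2) [simp del]

lemma finite_idx_box [simp, intro]: "finite (idx_box i K)"
proof -
  have "idx_box i K = {f. \<forall>j. (j \<in> {..<i} \<longrightarrow> f j \<in> {..K}) \<and> (j \<notin> {..<i} \<longrightarrow> f j = 0)}"
    by (auto simp: idx_box_def not_less)
  also have "finite \<dots>" by (rule finite_set_of_finite_funs) auto
  finally show ?thesis .
qed

lemma idx_box_0 [simp]: "idx_box 0 K = {\<lambda>_. 0}"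
  by (auto simp: idx_box_def)

lemma sum_idx_box_Suc:
  fixes F :: "nat \<Rightarrow> (nat \<Rightarrow> nat) \<Rightarrow> complex"
  shows "(\<Sum>k\<in>idx_box (Suc i) K. F (k 0) (shiftn 1 k)) = (\<Sum>k\<in>idx_box i K. \<Sum>m\<le>K. F m k)"
proof -
  have "(\<Sum>k\<in>idx_box (Suc i) K. F (k 0) (shiftn 1 k)) = (\<Sum>(k, m)\<in>idx_box i K \<times> {..K}. F m k)"
  proof (rule sum.reindex_bij_witness[where j = "\<lambda>k. (shiftn 1 k, k 0)" and i = "\<lambda>(k, m). case_nat m k"])
    show "(\<lambda>(k, m). case_nat m k) b \<in> idx_box (Suc i) K" if "b \<in> idx_box i K \<times> {..K}" for b
      using that by (auto simp: idx_box_def split: nat.splits)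
    show "(\<lambda>(k, m). case_nat m k) (shiftn 1 k, k 0) = k" for k :: "nat \<Rightarrow> nat"
      by (auto simp: fun_eq_iff shiftn_def split: nat.splits)
    show "(shiftn 1 k, k 0) \<in> idx_box i K \<times> {..K}" if "k \<in> idx_box (Suc i) K" for k
      using that by (auto simp: idx_box_def shiftn_def)
  qed (auto simp: shiftn_def)
  then show ?thesis by (simp add: sum.cartesian_product)
qed

lemma tail_sum_0 [simp]: "tail_sum 0 K z N s = 1" if "N \<ge> 1"
  using that by (simp add: tail_sum_def head_prod_def seg_sum_def powr_def)

lemma tail_sum_Suc:
  "tail_sum (Suc i) K z N s = head_prod (Suc i) z ^ N *
     (\<Sum>k\<in>idx_box i K. tail_coeff i (shiftn 1 z) (shiftn 1 s) k *
        em_sum K (head_prod (Suc i) z) N (seg_sum 0 (Suc i) s + of_int (tail_exp i (shiftn 1 z) k)))"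
proof -
  let ?w = "head_prod (Suc i) z"
  define F where "F = (\<lambda>m k. - em_coeff ?w m *
     gpoch (seg_sum 0 (Suc i) s + of_int (tail_exp i (shiftn 1 z) k)) (int m - int (dq ?w)) *
     tail_coeff i (shiftn 1 z) (shiftn 1 s) k *
     of_nat N powr (- (seg_sum 0 (Suc i) s + of_int (tail_exp i (shiftn 1 z) k + int m - int (dq ?w)))))"
  have "(\<Sum>k\<in>idx_box (Suc i) K. tail_coeff (Suc i) z s k * of_nat N powr (- (seg_sum 0 (Suc i) s + of_int (tail_exp (Suc i) z k))))
     = (\<Sum>k\<in>idx_box (Suc i) K. F (k 0) (shiftn 1 k))"
    by (simp add: F_def)
  also have "\<dots> = (\<Sum>k\<in>idx_box i K. \<Sum>m\<le>K. F m k)" by (rule sum_idx_box_Suc)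
  also have "\<dots> = (\<Sum>k\<in>idx_box i K. tail_coeff i (shiftn 1 z) (shiftn 1 s) k *
        em_sum K ?w N (seg_sum 0 (Suc i) s + of_int (tail_exp i (shiftn 1 z) k)))"
    unfolding em_sum_def F_def by (simp add: sum_distrib_left sum_negf mult_ac algebra_simps)
  finally show ?thesis unfolding tail_sum_def by simp
qed

text \<open>\<open>tail_sum (Suc i)\<close> is designed to satisfy, up to Euler-Maclaurin errors,
  the first-order recursion in N of a nested sum whose inner part is \<open>tail_sum i\<close>.
  Subtracting it from the partial sum therefore cancels the growing increments.\<close>

lemma tail_sum_step:
  assumes "N \<ge> 1"
  shows "tail_sum (Suc i) K z (N + 1) s - tail_sum (Suc i) K z N s
       - z 0 ^ N * of_nat N powr (- s 0) * tail_sum i K (shiftn 1 z) N (shiftn 1 s)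
     = head_prod (Suc i) z ^ N * (\<Sum>k\<in>idx_box i K. tail_coeff i (shiftn 1 z) (shiftn 1 s) k *
        (let w = head_prod (Suc i) z; \<sigma> = seg_sum 0 (Suc i) s + of_int (tail_exp i (shiftn 1 z) k)
         in w * em_sum K w (N + 1) \<sigma> - em_sum K w N \<sigma> - of_nat N powr (- \<sigma>)))"
proof -
  have "z 0 ^ N * of_nat N powr (- s 0) * tail_sum i K (shiftn 1 z) N (shiftn 1 s)
     = head_prod (Suc i) z ^ N * (\<Sum>k\<in>idx_box i K. tail_coeff i (shiftn 1 z) (shiftn 1 s) k *
         of_nat N powr (- (seg_sum 0 (Suc i) s + of_int (tail_exp i (shiftn 1 z) k))))"
  proof -
    have pw: "of_nat N powr (- (s 0 + seg_sum 0 i (shiftn 1 s) + c)) = of_nat N powr (- s 0) * of_nat N powr (- (seg_sum 0 i (shiftn 1 s) + c))" for c :: complex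
    proof -
      have "- (s 0 + seg_sum 0 i (shiftn 1 s) + c) = - s 0 + - (seg_sum 0 i (shiftn 1 s) + c)" by simp
      then show ?thesis by (simp only: powr_add)
    qed
    show ?thesis
      unfolding tail_sum_def head_prod_Suc seg_sum_Suc power_mult_distrib pw
      by (simp only: sum_distrib_left mult_ac)
  qed
  then show ?thesis
    unfolding tail_sum_Suc Let_def
    by (simp add: sum_subtractf right_diff_distrib sum_distrib_left mult_ac)
qed

section \<open>Poles of the expansion terms\<close>

lemma extends_holo_tail_coeff:
  "i \<le> d \<Longrightarrow> extends_holo d (\<lambda>s. (\<Prod>j<i. sin (of_real pi * seg_sum j i s)) * tail_coeff i z s k)"
proof (induction i arbitrary: d z k)
  case 0
  then show ?case by (simp add: extends_holo_const)
next
  case (Suc i)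
  then obtain d' where d: "d = Suc d'" "i \<le> d'" by (cases d) auto
  have "extends_holo (1 + d') (\<lambda>s. (\<Prod>j<i. sin (of_real pi * seg_sum j i (shiftn 1 s))) * tail_coeff i (shiftn 1 z) (shiftn 1 s) (shiftn 1 k))"
    by (rule extends_holo_shiftn[where f = "\<lambda>s. (\<Prod>j<i. sin (of_real pi * seg_sum j i s)) * tail_coeff i (shiftn 1 z) s (shiftn 1 k)"])
       (rule Suc.IH[OF d(2)])
  then have e1: "extends_holo d (\<lambda>s. (\<Prod>j<i. sin (of_real pi * seg_sum j i (shiftn 1 s))) * tail_coeff i (shiftn 1 z) (shiftn 1 s) (shiftn 1 k))"
    by (simp add: d)
  have e2: "extends_holo d (\<lambda>s. sin (of_real pi * seg_sum 0 (Suc i) s) *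
     gpoch (seg_sum 0 (Suc i) s + of_int (tail_exp i (shiftn 1 z) (shiftn 1 k))) (int (k 0) - int (dq (head_prod (Suc i) z))))"
    by (rule extends_holo_sin_gpoch) (use Suc.prems in auto)
  have "extends_holo d (\<lambda>s. (- em_coeff (head_prod (Suc i) z) (k 0) *
     (sin (of_real pi * seg_sum 0 (Suc i) s) *
     gpoch (seg_sum 0 (Suc i) s + of_int (tail_exp i (shiftn 1 z) (shiftn 1 k))) (int (k 0) - int (dq (head_prod (Suc i) z))))) *
     ((\<Prod>j<i. sin (of_real pi * seg_sum j i (shiftn 1 s))) * tail_coeff i (shiftn 1 z) (shiftn 1 s) (shiftn 1 k)))"
    by (intro extends_holo_mult[OF extends_holo_mult] e1 e2 extends_holo_const)
  then show ?case
    by (rule extends_holo_cong) (simp add: prod.lessThan_Suc_shift seg_sum_shiftn mult_ac del: prod.lessThan_Suc)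
qed

lemma extends_holo_polar_Li_tail:
  assumes ext: "extends_holo (d - i) (\<lambda>s. polar (d - i) s * f s)" and i: "i \<le> d"
  shows "extends_holo d (\<lambda>s. polar d s * (f (shiftn i s) * tail_coeff i z s k))"
proof -
  obtain R where R: "extends_holo d R"
    "\<And>s. polar d s = R s * polar (d - i) (shiftn i s) * (\<Prod>j<i. sin (of_real pi * seg_sum j i s))"
    using polar_factor[OF i] by blast
  have "extends_holo (i + (d - i)) (\<lambda>s. polar (d - i) (shiftn i s) * f (shiftn i s))"
    by (rule extends_holo_shiftn[OF ext])
  then have e: "extends_holo d (\<lambda>s. polar (d - i) (shiftn i s) * f (shiftn i s))" using i by simp
  have "extends_holo d (\<lambda>s. R s * (polar (d - i) (shiftn i s) * f (shiftn i s)) *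
     ((\<Prod>j<i. sin (of_real pi * seg_sum j i s)) * tail_coeff i z s k))"
    by (intro extends_holo_mult R e extends_holo_tail_coeff i)
  then show ?thesis by (rule extends_holo_cong) (simp add: R(2) mult_ac)
qed

text \<open>Each step loses at most 1, so one large index in any position forces a large exponent.
  Hence terms outside a big box are negligible and each fixed exponent occurs finitely
  often.\<close>

lemma tail_exp_ge: "j < i \<Longrightarrow> tail_exp i z k \<ge> int (k j) - int i"
  and tail_exp_ge': "tail_exp i z k \<ge> - int i"
proof -
  have dq: "int (dq w) \<le> 1" for w by (simp add: dq_def)
  show b: "tail_exp i z k \<ge> - int i" for i z k
  proof (induction i arbitrary: z k)
    case (Suc i)
    show ?case using Suc.IH[of "shiftn 1 z" "shiftn 1 k"] dq[of "head_prod (Suc i) z"] by simp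
  qed simp
  show "j < i \<Longrightarrow> tail_exp i z k \<ge> int (k j) - int i"
  proof (induction i arbitrary: j z k)
    case (Suc i)
    show ?case
    proof (cases j)
      case 0
      then show ?thesis using b[of i "shiftn 1 z" "shiftn 1 k"] dq[of "head_prod (Suc i) z"] by simp
    next
      case (Suc j')
      then show ?thesis using Suc.IH[of j' "shiftn 1 k" "shiftn 1 z"] Suc.prems dq[of "head_prod (Suc i) z"]
        by (simp add: shiftn_def)
    qed
  qed simp
qed

section \<open>Decay in N, uniform in the exponents\<close>

definition decays :: "(nat \<Rightarrow> complex) set \<Rightarrow> nat \<Rightarrow> (nat \<Rightarrow> (nat \<Rightarrow> complex) \<Rightarrow> complex) \<Rightarrow> bool" where
  "decays X A f \<longleftrightarrow> (\<exists>C\<ge>0. \<forall>s\<in>X. \<forall>N\<ge>1. cmod (f N s) \<le> C / real N ^ A)"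

lemma decays_add:
  assumes "decays X A f" "decays X A g"
  shows "decays X A (\<lambda>N s. f N s + g N s)"
proof -
  from assms obtain C D where C: "C \<ge> 0" "\<And>s N. s \<in> X \<Longrightarrow> N \<ge> 1 \<Longrightarrow> cmod (f N s) \<le> C / real N ^ A"
    and D: "D \<ge> 0" "\<And>s N. s \<in> X \<Longrightarrow> N \<ge> 1 \<Longrightarrow> cmod (g N s) \<le> D / real N ^ A"
    unfolding decays_def by blast
  have "cmod (f N s + g N s) \<le> (C + D) / real N ^ A" if "s \<in> X" "N \<ge> 1" for s N
    using C(2)[OF that] D(2)[OF that] norm_triangle_ineq[of "f N s" "g N s"] by (simp add: add_divide_distrib)
  then show ?thesis unfolding decays_def using C(1) D(1) by (intro exI[of _ "C + D"]) auto
qed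

lemma decays_zero: "decays X A (\<lambda>N s. 0)"
  unfolding decays_def by (intro exI[of _ 0]) simp

lemma decays_sum: "(\<And>x. x \<in> S \<Longrightarrow> decays X A (f x)) \<Longrightarrow> decays X A (\<lambda>N s. \<Sum>x\<in>S. f x N s)"
  by (induction S rule: infinite_finite_induct) (auto intro!: decays_add decays_zero)

lemma decays_bounded_mult:
  assumes f: "decays X A f" and g: "\<And>s N. s \<in> X \<Longrightarrow> N \<ge> 1 \<Longrightarrow> cmod (g N s) \<le> D * real N ^ E" and B: "A = B + E"
  shows "decays X B (\<lambda>N s. g N s * f N s)"
proof -
  from f obtain C where C: "C \<ge> 0" "\<And>s N. s \<in> X \<Longrightarrow> N \<ge> 1 \<Longrightarrow> cmod (f N s) \<le> C / real N ^ A"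
    unfolding decays_def by blast
  have "cmod (g N s * f N s) \<le> (\<bar>D\<bar> * C) / real N ^ B" if "s \<in> X" "N \<ge> 1" for s N
  proof -
    have "cmod (g N s * f N s) \<le> (\<bar>D\<bar> * real N ^ E) * (C / real N ^ A)"
      unfolding norm_mult
      by (intro mult_mono C(2) that order_trans[OF g[OF that]]) (auto intro!: mult_right_mono)
    also have "\<dots> = (\<bar>D\<bar> * C) / real N ^ B"
      using that by (simp add: B power_add)
    finally show ?thesis .
  qed
  then show ?thesis unfolding decays_def using C(1) by (intro exI[of _ "\<bar>D\<bar> * C"]) auto
qed

lemma decays_cong: "decays X A f \<Longrightarrow> (\<And>s N. s \<in> X \<Longrightarrow> N \<ge> 1 \<Longrightarrow> f N s = g N s) \<Longrightarrow> decays X A g"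
  unfolding decays_def by (metis (no_types, lifting))

text \<open>The error of one step has order N^(q - Re \<open>\<sigma>\<close> - K - 1) with q at
  most 1, which is O(N^(-A)) once K >= A + L.\<close>

lemma decays_em_sum_step:
  assumes w: "cmod w = 1" and K: "K \<ge> 1"
    and \<sigma>: "\<And>s. s \<in> X \<Longrightarrow> \<sigma> s \<noteq> 1" "\<And>s. s \<in> X \<Longrightarrow> cmod (\<sigma> s) \<le> R" "\<And>s. s \<in> X \<Longrightarrow> Re (\<sigma> s) \<ge> - L"
    and KA: "real K \<ge> real A + L"
  shows "decays X A (\<lambda>N s. w * em_sum K w (N + 1) (\<sigma> s) - em_sum K w N (\<sigma> s) - of_nat N powr (- \<sigma> s))"
proof -
  have qK: "dq w \<le> K" using K by (simp add: dq_def)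
  \<comment> \<open>The index of \<open>gpoch\<close> in the error term is nonnegative, so this
    factor is a polynomial and stays bounded near the pole at 1, although \<open>em_sum\<close>
    itself does not.\<close>
  define m where "m = K + 1 - dq w"
  have m: "int (K + 1) - int (dq w) = int m" using qK by (simp add: m_def)
  have "compact ((\<lambda>x :: complex. pochhammer x m) ` cball 0 R)"
    unfolding pochhammer_prod by (intro compact_continuous_image continuous_intros) auto
  from compact_imp_bounded[OF this] obtain P where P: "\<forall>y\<in>(\<lambda>x :: complex. pochhammer x m) ` cball 0 R. cmod y \<le> P"
    unfolding bounded_iff ..
  define D where "D = (\<Sum>k\<le>K. cmod (em_coeff w k))"
  have D: "D \<ge> 0" unfolding D_def by (intro sum_nonneg) auto
  define C where "C = \<bar>P\<bar> * D * 2 powr (R + real K + 1)"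
  have "cmod (w * em_sum K w (N + 1) (\<sigma> s) - em_sum K w N (\<sigma> s) - of_nat N powr (- \<sigma> s)) \<le> C / real N ^ A"
    if s: "s \<in> X" and N: "N \<ge> 1" for s N
  proof -
    have "\<sigma> s \<in> cball 0 R" using \<sigma>(2)[OF s] by simp
    then have "cmod (pochhammer (\<sigma> s) m) \<le> P" using P by blast
    then have 1: "cmod (gpoch (\<sigma> s) (int (K + 1) - int (dq w))) \<le> \<bar>P\<bar>"
      unfolding m by (simp add: gpoch_def)
    have 2: "real N powr (real (dq w) - Re (\<sigma> s) - real (K + 1)) \<le> real N powr (- real A)"
      using N \<sigma>(3)[OF s] KA by (intro powr_mono) (auto simp: dq_def)
    have 3: "(2::real) powr (\<bar>Re (\<sigma> s)\<bar> + real K + 1) \<le> 2 powr (R + real K + 1)"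
      using \<sigma>(2)[OF s] abs_Re_le_cmod[of "\<sigma> s"] by (intro powr_mono) auto
    have "cmod (w * em_sum K w (N + 1) (\<sigma> s) - em_sum K w N (\<sigma> s) - of_nat N powr (- \<sigma> s))
       \<le> cmod (gpoch (\<sigma> s) (int (K + 1) - int (dq w))) * D *
        2 powr (\<bar>Re (\<sigma> s)\<bar> + real K + 1) * real N powr (real (dq w) - Re (\<sigma> s) - real (K + 1))"
      unfolding D_def by (rule em_sum_step[OF w qK N \<sigma>(1)[OF s]])
    also have "\<dots> \<le> \<bar>P\<bar> * D * 2 powr (R + real K + 1) * real N powr (- real A)"
      by (intro mult_mono 1 2 3) (auto intro!: mult_nonneg_nonneg simp: D)
    also have "\<dots> = C / real N ^ A" using N by (simp add: C_def powr_minus_divide powr_realpow)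
    finally show ?thesis .
  qed
  moreover have "C \<ge> 0" using D by (simp add: C_def)
  ultimately show ?thesis unfolding decays_def by blast
qed

text \<open>Uses \<open>1 / n\<^sup>2 \<le> 2 (1 / n - 1 / (n + 1))\<close> to telescope.\<close>

lemma convergent_of_step_bound:
  fixes a :: "nat \<Rightarrow> complex"
  assumes step: "\<And>N. N \<ge> 1 \<Longrightarrow> cmod (a (N + 1) - a N) \<le> C / real N ^ (A + 2)" and C: "C \<ge> 0"
  obtains l where "a \<longlonglongrightarrow> l" "\<And>N. N \<ge> 1 \<Longrightarrow> cmod (a N - l) \<le> 2 * C / real N ^ (A + 1)"
proof -
  have tele: "cmod (a (N + m) - a N) \<le> 2 * C / real N ^ A * (1 / real N - 1 / real (N + m))" if N: "N \<ge> 1" for N m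
  proof (induction m)
    case 0
    then show ?case by simp
  next
    case (Suc m)
    let ?M = "N + m"
    have "cmod (a (?M + 1) - a ?M) \<le> C / real ?M ^ (A + 2)" by (rule step) (use N in simp)
    also have "\<dots> = C / real ?M ^ A * (1 / real ?M ^ 2)" by (simp add: power_add power2_eq_square)
    also have "\<dots> \<le> C / real N ^ A * (2 * (1 / real ?M - 1 / real (?M + 1)))"
    proof (intro mult_mono divide_left_mono)
      have "1 / real ?M ^ 2 \<le> 2 / (real ?M * (real ?M + 1))"
      proof -
        have x: "real ?M \<ge> 1" using N by simp
        have "1 / real ?M ^ 2 = 2 / (real ?M * (real ?M + real ?M))"
          using x by (simp add: power2_eq_square mult_2[symmetric] del: of_nat_add)
        also have "\<dots> \<le> 2 / (real ?M * (real ?M + 1))"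
        proof (intro divide_left_mono mult_left_mono mult_pos_pos)
          show "real ?M + 1 \<le> real ?M + real ?M" using x by linarith
        qed (use x in linarith)+
        finally show ?thesis .
      qed
      also have "\<dots> = 2 * (1 / real ?M - 1 / real (?M + 1))" using N by (simp add: field_simps)
      finally show "1 / real ?M ^ 2 \<le> 2 * (1 / real ?M - 1 / real (?M + 1))" .
    qed (use N C in \<open>auto intro!: power_mono\<close>)
    also have "\<dots> = 2 * C / real N ^ A * (1 / real ?M - 1 / real (?M + 1))"
    proof -
      have "C / p * (2 * q) = 2 * C / p * q" for p q :: real by simp
      then show ?thesis .
    qed
    finally have "cmod (a (?M + 1) - a ?M) \<le> 2 * C / real N ^ A * (1 / real ?M - 1 / real (?M + 1))" .
    moreover have "cmod (a (N + Suc m) - a N) \<le> cmod (a (?M + 1) - a ?M) + cmod (a ?M - a N)"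
      using norm_triangle_ineq[of "a (?M + 1) - a ?M" "a ?M - a N"] by simp
    ultimately show ?case using Suc by (simp add: right_diff_distrib)
  qed
  have tele': "cmod (a (N + m) - a N) \<le> 2 * C / real N ^ (A + 1)" if N: "N \<ge> 1" for N m
  proof -
    have "cmod (a (N + m) - a N) \<le> 2 * C / real N ^ A * (1 / real N - 1 / real (N + m))" by (rule tele[OF N])
    also have "\<dots> \<le> 2 * C / real N ^ A * (1 / real N)" using C by (intro mult_left_mono) auto
    finally show ?thesis by (simp add: mult_ac)
  qed
  have "Cauchy a"
  proof (rule CauchyI')
    fix e :: real assume e: "e > 0"
    obtain M where M: "2 * C / e < real M" using reals_Archimedean2 by blast
    have "norm (a m - a n) < e" if mn: "m \<ge> M + 1" "m < n" for m n
    proof -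
      have "norm (a m - a n) = cmod (a (m + (n - m)) - a m)" using mn by (simp add: norm_minus_commute)
      also have "\<dots> \<le> 2 * C / real m ^ (A + 1)" by (rule tele') (use mn in simp)
      also have "\<dots> \<le> 2 * C / real m ^ 1"
        using mn C by (intro divide_left_mono power_increasing) auto
      also have "\<dots> < e"
      proof -
        have "2 * C < real M * e" using M e by (simp add: divide_less_eq)
        also have "\<dots> \<le> real m * e" using mn e by (intro mult_right_mono) auto
        finally show ?thesis using mn by (simp add: divide_less_eq mult.commute)
      qed
      finally show ?thesis .
    qed
    then show "\<exists>M. \<forall>m\<ge>M. \<forall>n>m. dist (a m) (a n) < e" unfolding dist_norm by blast
  qed
  then obtain l where l: "a \<longlonglongrightarrow> l" using Cauchy_convergent_iff convergent_def by blast
  show ?thesis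
  proof (rule that[OF l])
    fix N :: nat assume N: "N \<ge> 1"
    have "(\<lambda>m. a (N + m)) \<longlonglongrightarrow> l" using LIMSEQ_ignore_initial_segment[OF l, of N] by (simp add: add.commute)
    then have "(\<lambda>m. cmod (a (N + m) - a N)) \<longlonglongrightarrow> cmod (l - a N)" by (intro tendsto_intros)
    then have "cmod (l - a N) \<le> 2 * C / real N ^ (A + 1)"
      by (rule LIMSEQ_le_const2) (use tele'[OF N] in blast)
    then show "cmod (a N - l) \<le> 2 * C / real N ^ (A + 1)" by (simp add: norm_minus_commute)
  qed
qed

lemma tendsto_nat_powr_zero:
  assumes "Re x < 0"
  shows "(\<lambda>N. of_nat N powr x) \<longlonglongrightarrow> 0"
proof (rule tendsto_norm_zero_cancel)
  have "(\<lambda>N. real N powr Re x) \<longlonglongrightarrow> 0"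
    by (rule tendsto_neg_powr[OF assms filterlim_real_sequentially])
  moreover have "eventually (\<lambda>N. real N powr Re x = cmod (of_nat N powr x)) sequentially"
    using eventually_ge_at_top[of 1] by eventually_elim (simp add: norm_powr_real_powr)
  ultimately show "(\<lambda>N. cmod (of_nat N powr x)) \<longlonglongrightarrow> 0" by (rule Lim_transform_eventually)
qed

text \<open>An additional term has some index above K, hence an exponent with positive real part.
  This is why the limit defining \<open>Li_cont\<close> does not depend on the truncation.\<close>

lemma tail_sum_truncation:
  assumes z: "\<And>t. t < i \<Longrightarrow> cmod (z t) = 1" and K: "K \<le> K'"
    and s: "Re (seg_sum 0 i s) + real K + 1 - real i > 0"
  shows "(\<lambda>N. tail_sum i K' z N s - tail_sum i K z N s) \<longlonglongrightarrow> 0"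
proof -
  have hp: "cmod (head_prod i z) = 1" by (rule norm_head_prod) (rule z)
  define D where "D = idx_box i K' - idx_box i K"
  have sub: "idx_box i K \<subseteq> idx_box i K'" using K by (auto simp: idx_box_def intro: order_trans)
  have eq: "tail_sum i K' z N s - tail_sum i K z N s = (\<Sum>k\<in>D. tail_coeff i z s k *
     (head_prod i z ^ N * of_nat N powr (- (seg_sum 0 i s + of_int (tail_exp i z k)))))" for N
    unfolding tail_sum_def D_def sum_diff[OF finite_idx_box sub] right_diff_distrib[symmetric]
    by (simp add: sum_diff[OF finite_idx_box sub] sum_distrib_left mult_ac right_diff_distrib)
  have "(\<lambda>N. \<Sum>k\<in>D. tail_coeff i z s k *
     (head_prod i z ^ N * of_nat N powr (- (seg_sum 0 i s + of_int (tail_exp i z k))))) \<longlonglongrightarrow> (\<Sum>k\<in>D. tail_coeff i z s k * 0)"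
  proof (intro tendsto_sum tendsto_mult tendsto_const)
    fix k assume k: "k \<in> D"
    then obtain j where j: "j < i" "k j > K" by (auto simp: D_def idx_box_def not_le)
    have "tail_exp i z k \<ge> int (k j) - int i" by (rule tail_exp_ge[OF j(1)])
    then have "real_of_int (tail_exp i z k) \<ge> real K + 1 - real i" using j(2) by linarith
    then have "Re (- (seg_sum 0 i s + of_int (tail_exp i z k))) < 0" using s by simp
    from tendsto_norm_zero[OF tendsto_nat_powr_zero[OF this]]
    have "(\<lambda>N. norm (head_prod i z ^ N * of_nat N powr (- (seg_sum 0 i s + of_int (tail_exp i z k))))) \<longlonglongrightarrow> 0"
      by (simp only: norm_mult norm_power hp power_one mult_1)
    then show "(\<lambda>N. head_prod i z ^ N * of_nat N powr (- (seg_sum 0 i s + of_int (tail_exp i z k)))) \<longlonglongrightarrow> 0"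
      by (rule tendsto_norm_zero_cancel)
  qed
  then show ?thesis unfolding eq by simp
qed

section \<open>Induction on the depth\<close>

definition Li_remainder :: "nat \<Rightarrow> nat \<Rightarrow> (nat \<Rightarrow> complex) \<Rightarrow> nat \<Rightarrow> (nat \<Rightarrow> complex) \<Rightarrow> complex" where
  "Li_remainder d K z N s = nested_psum d z N s -
     (\<Sum>i\<le>d. Li_cont (d - i) (shiftn i z) (shiftn i s) * tail_sum i K z N s)"

text \<open>The partial sum of depth d + 1 minus all tails except the one for i = 0: that one is the
  constant which the limit is going to define.\<close>

definition Li_approx :: "nat \<Rightarrow> nat \<Rightarrow> (nat \<Rightarrow> complex) \<Rightarrow> nat \<Rightarrow> (nat \<Rightarrow> complex) \<Rightarrow> complex" where
  "Li_approx d K z N s = nested_psum (Suc d) z N s -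
     (\<Sum>i<Suc d. Li_cont (d - i) (shiftn (Suc i) z) (shiftn (Suc i) s) * tail_sum (Suc i) K z N s)"

definition em_error :: "nat \<Rightarrow> complex \<Rightarrow> nat \<Rightarrow> complex \<Rightarrow> complex" where
  "em_error K w N \<sigma> = w * em_sum K w (N + 1) \<sigma> - em_sum K w N \<sigma> - of_nat N powr (- \<sigma>)"

lemma Li_cont_eqI:
  assumes "\<forall>\<^sub>F K in sequentially. (\<lambda>N. Li_approx d K z N s) \<longlonglongrightarrow> l"
  shows "Li_cont (Suc d) z s = l"
  unfolding Li_cont.simps(2) Li_approx_def[symmetric]
proof (rule the_equality)
  show "\<forall>\<^sub>F K in sequentially. (\<lambda>N. Li_approx d K z N s) \<longlonglongrightarrow> l" by (rule assms)
next
  fix l' assume "\<forall>\<^sub>F K in sequentially. (\<lambda>N. Li_approx d K z N s) \<longlonglongrightarrow> l'"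
  with assms have "\<forall>\<^sub>F K :: nat in sequentially. l' = l"
    by eventually_elim (rule LIMSEQ_unique)
  then show "l' = l" by simp
qed

lemma Li_remainder_Suc:
  assumes "N \<ge> 1"
  shows "Li_remainder (Suc d) K z N s = Li_approx d K z N s - Li_cont (Suc d) z s"
  using assms by (simp add: Li_remainder_def Li_approx_def sum.atMost_Suc_shift lessThan_Suc_atMost del: sum.atMost_Suc nested_psum.simps)

text \<open>Passing from N to N + 1 adds the summand with outermost index N. Its depth-d expansion
  is matched by the increments of the tails, and what survives is the depth-d remainder and the
  Euler-Maclaurin errors.\<close>

lemma Li_approx_step:
  assumes "N \<ge> 1"
  shows "Li_approx d K z (N + 1) s - Li_approx d K z N s =
      z 0 ^ N * of_nat N powr (- s 0) * Li_remainder d K (shiftn 1 z) N (shiftn 1 s) +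
      (\<Sum>i\<le>d. \<Sum>k\<in>idx_box i K. - (Li_cont (d - i) (shiftn (Suc i) z) (shiftn (Suc i) s) *
         tail_coeff i (shiftn 1 z) (shiftn 1 s) k * head_prod (Suc i) z ^ N) *
         em_error K (head_prod (Suc i) z) N (seg_sum 0 (Suc i) s + of_int (tail_exp i (shiftn 1 z) k)))"
proof -
  define L where "L = (\<lambda>i. Li_cont (d - i) (shiftn (Suc i) z) (shiftn (Suc i) s))"
  define c where "c = z 0 ^ N * of_nat N powr (- s 0)"
  define X where "X = (\<lambda>i. \<Sum>k\<in>idx_box i K. tail_coeff i (shiftn 1 z) (shiftn 1 s) k *
         em_error K (head_prod (Suc i) z) N (seg_sum 0 (Suc i) s + of_int (tail_exp i (shiftn 1 z) k)))"
  have ts: "tail_sum (Suc i) K z (N + 1) s - tail_sum (Suc i) K z N s = c * tail_sum i K (shiftn 1 z) N (shiftn 1 s) + head_prod (Suc i) z ^ N * X i" for i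
    using tail_sum_step[OF assms, of i K z s] unfolding X_def em_error_def c_def Let_def by (simp add: algebra_simps)
  have np: "nested_psum (Suc d) z (N + 1) s - nested_psum (Suc d) z N s = c * nested_psum d (shiftn 1 z) N (shiftn 1 s)"
  proof -
    have "{1..<N + 1} = insert N {1..<N}" using assms by auto
    then show ?thesis by (simp add: c_def)
  qed
  have "Li_approx d K z (N + 1) s - Li_approx d K z N s
     = (nested_psum (Suc d) z (N + 1) s - nested_psum (Suc d) z N s)
       - (\<Sum>i\<le>d. L i * (tail_sum (Suc i) K z (N + 1) s - tail_sum (Suc i) K z N s))"
    unfolding Li_approx_def L_def by (simp add: sum_subtractf right_diff_distrib lessThan_Suc_atMost del: nested_psum.simps)
  also have "\<dots> = c * nested_psum d (shiftn 1 z) N (shiftn 1 s) - (\<Sum>i\<le>d. c * (L i * tail_sum i K (shiftn 1 z) N (shiftn 1 s)) + L i * head_prod (Suc i) z ^ N * X i)"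
    unfolding np ts by (simp add: algebra_simps)
  also have "\<dots> = c * Li_remainder d K (shiftn 1 z) N (shiftn 1 s) + (\<Sum>i\<le>d. - (L i * head_prod (Suc i) z ^ N * X i))"
    unfolding Li_remainder_def L_def
    by (simp add: sum.distrib sum_distrib_left right_diff_distrib sum_negf)
  also have "(\<Sum>i\<le>d. - (L i * head_prod (Suc i) z ^ N * X i)) =
      (\<Sum>i\<le>d. \<Sum>k\<in>idx_box i K. - (L i *
         tail_coeff i (shiftn 1 z) (shiftn 1 s) k * head_prod (Suc i) z ^ N) *
         em_error K (head_prod (Suc i) z) N (seg_sum 0 (Suc i) s + of_int (tail_exp i (shiftn 1 z) k)))"
    unfolding X_def by (simp add: sum_distrib_left sum_negf mult_ac)
  finally show ?thesis by (simp add: c_def L_def)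
qed

text \<open>The induction hypothesis. Every decay order A is demanded because the next depth
  multiplies the remainder by N^(-s_0), which can grow like a power of N; the factor
  \<open>polar\<close> keeps the estimates uniform up to the poles.\<close>

definition Li_expansion :: "nat \<Rightarrow> bool" where
  "Li_expansion d \<longleftrightarrow> (\<forall>z. (\<forall>i<d. cmod (z i) = 1) \<longrightarrow>
     extends_holo d (\<lambda>s. polar d s * Li_cont d z s) \<and>
     (\<forall>B A. \<exists>K0. \<forall>K\<ge>K0. decays (generic d \<inter> polydisc d (\<lambda>_. 0) B) A
        (\<lambda>N s. polar d s * Li_remainder d K z N s)))"

lemma norm_nat_powr_le:
  assumes "N \<ge> 1" "cmod x \<le> real E"
  shows "cmod (of_nat N powr x) \<le> real N ^ E"
proof -
  have "cmod (of_nat N powr x) = real N powr Re x"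
    using assms by (simp add: norm_powr_real_powr)
  also have "\<dots> \<le> real N powr real E"
    using assms abs_Re_le_cmod[of x] by (intro powr_mono) auto
  also have "\<dots> = real N ^ E" using assms by (simp add: powr_realpow)
  finally show ?thesis .
qed

lemma Li_approx_step_decays:
  assumes IH: "\<And>e. e \<le> d \<Longrightarrow> Li_expansion e" and z: "\<forall>i<Suc d. cmod (z i) = 1"
  shows "\<exists>K0. \<forall>K\<ge>K0. decays (generic (Suc d) \<inter> polydisc (Suc d) (\<lambda>_. 0) B) A
     (\<lambda>N s. polar (Suc d) s * (Li_approx d K z (N + 1) s - Li_approx d K z N s))"
proof -
  define X where "X = generic (Suc d) \<inter> polydisc (Suc d) (\<lambda>_. 0) B"
  \<comment> \<open>On the polydisc |N^(-s_0)| is at most N^E, so the remainder of depth d is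
    requested to order A + E.\<close>
  define E where "E = nat \<lceil>\<bar>B\<bar>\<rceil>"
  have E: "\<bar>B\<bar> \<le> real E" unfolding E_def by linarith
  have sB: "cmod (s t) \<le> \<bar>B\<bar>" if "s \<in> X" "t < Suc d" for s t
    using that by (force simp: X_def polydisc_def)
  have z1: "\<forall>i<d. cmod (shiftn 1 z i) = 1" using z by (simp add: shiftn_def)
  obtain V where V: "extends_holo (Suc d) V" "\<And>s. polar (Suc d) s = V s * polar d (shiftn 1 s)"
    using polar_Suc by blast
  obtain K1 where K1: "\<And>K. K \<ge> K1 \<Longrightarrow> decays (generic d \<inter> polydisc d (\<lambda>_. 0) B) (A + E) (\<lambda>N s. polar d s * Li_remainder d K (shiftn 1 z) N s)"
    using IH[of d] z1 unfolding Li_expansion_def by blast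
  \<comment> \<open>-L bounds the real parts of all exponents from below: segment sums are at most
    (d + 1)|B| in modulus, and \<open>tail_exp\<close> is at least -d.\<close>
  define L where "L = real (Suc d) * \<bar>B\<bar> + real d"
  define K0 where "K0 = max K1 (nat \<lceil>real A + L\<rceil> + 1)"
  have "decays X A (\<lambda>N s. polar (Suc d) s * (Li_approx d K z (N + 1) s - Li_approx d K z N s))" if K: "K \<ge> K0" for K
  proof -
    have "K \<ge> K1" using K by (simp add: K0_def)
    from K1[OF this] have d1: "decays X (A + E) (\<lambda>N s. polar d (shiftn 1 s) * Li_remainder d K (shiftn 1 z) N (shiftn 1 s))"
      unfolding decays_def X_def using shiftn_generic[of _ 1 d] shiftn_polydisc[of _ 1 d B]
      by (simp add: Ball_def) blast
    obtain CV where CV: "CV \<ge> 0" "\<And>s. s \<in> X \<Longrightarrow> cmod (V s) \<le> CV"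
      using extends_holo_bound[OF V(1), of B] unfolding X_def by blast
    have D1: "decays X A (\<lambda>N s. (V s * (z 0 ^ N * of_nat N powr (- s 0))) * (polar d (shiftn 1 s) * Li_remainder d K (shiftn 1 z) N (shiftn 1 s)))"
    proof (rule decays_bounded_mult[OF d1])
      fix s and N :: nat assume s: "s \<in> X" and N: "N \<ge> 1"
      have "cmod (- s 0) \<le> real E" using sB[OF s, of 0] E by simp
      from norm_nat_powr_le[OF N this] CV(2)[OF s] CV(1)
      show "cmod (V s * (z 0 ^ N * of_nat N powr (- s 0))) \<le> CV * real N ^ E"
        using z by (simp add: norm_mult norm_power mult_mono)
    qed simp
    have D2: "decays X A (\<lambda>N s. - (polar (Suc d) s * (Li_cont (d - i) (shiftn (Suc i) z) (shiftn (Suc i) s) *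
         tail_coeff i (shiftn 1 z) (shiftn 1 s) k) * head_prod (Suc i) z ^ N) *
         em_error K (head_prod (Suc i) z) N (seg_sum 0 (Suc i) s + of_int (tail_exp i (shiftn 1 z) k)))"
      if i: "i \<le> d" for i k
    proof -
      have hp: "cmod (head_prod (Suc i) z) = 1" by (rule norm_head_prod) (use z i in auto)
      have "\<forall>j<d - i. cmod (shiftn (Suc i) z j) = 1" using z i by (simp add: shiftn_def)
      then have "extends_holo (d - i) (\<lambda>s. polar (d - i) s * Li_cont (d - i) (shiftn (Suc i) z) s)"
        using IH[of "d - i"] unfolding Li_expansion_def by simp
      from extends_holo_polar_Li_tail[OF this i, of "shiftn 1 z" k]
      have "extends_holo (1 + d) (\<lambda>s. polar d (shiftn 1 s) * (Li_cont (d - i) (shiftn (Suc i) z) (shiftn i (shiftn 1 s)) *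
         tail_coeff i (shiftn 1 z) (shiftn 1 s) k))" by (rule extends_holo_shiftn)
      then have e: "extends_holo (Suc d) (\<lambda>s. polar d (shiftn 1 s) * (Li_cont (d - i) (shiftn (Suc i) z) (shiftn (Suc i) s) *
         tail_coeff i (shiftn 1 z) (shiftn 1 s) k))" by simp
      have "extends_holo (Suc d) (\<lambda>s. V s * (polar d (shiftn 1 s) * (Li_cont (d - i) (shiftn (Suc i) z) (shiftn (Suc i) s) *
         tail_coeff i (shiftn 1 z) (shiftn 1 s) k)))" by (rule extends_holo_mult[OF V(1) e])
      then obtain C where C: "\<And>s. s \<in> X \<Longrightarrow> cmod (V s * (polar d (shiftn 1 s) * (Li_cont (d - i) (shiftn (Suc i) z) (shiftn (Suc i) s) *
         tail_coeff i (shiftn 1 z) (shiftn 1 s) k))) \<le> C"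
        using extends_holo_bound[of "Suc d" _ B] unfolding X_def by blast
      show ?thesis
      proof (rule decays_bounded_mult[where E = 0 and A = A and D = C])
      show "cmod (- (polar (Suc d) s * (Li_cont (d - i) (shiftn (Suc i) z) (shiftn (Suc i) s) *
         tail_coeff i (shiftn 1 z) (shiftn 1 s) k) * head_prod (Suc i) z ^ N)) \<le> C * real N ^ 0" if "s \<in> X" for s N
        using C[OF that] by (simp add: V(2) norm_mult norm_power hp mult_ac)
      show "decays X A (\<lambda>N s. em_error K (head_prod (Suc i) z) N (seg_sum 0 (Suc i) s + of_int (tail_exp i (shiftn 1 z) k)))"
        unfolding em_error_def
      proof (rule decays_em_sum_step[OF hp, where L = L and R = "real (Suc d) * \<bar>B\<bar> + \<bar>real_of_int (tail_exp i (shiftn 1 z) k)\<bar>"])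
        show "K \<ge> 1" using K by (simp add: K0_def)
        show "real K \<ge> real A + L" using K unfolding K0_def by linarith
        fix s assume s: "s \<in> X"
        have "seg_sum 0 (Suc i) s \<notin> \<int>" using s i by (auto simp: X_def dest: genericD)
        then show "seg_sum 0 (Suc i) s + of_int (tail_exp i (shiftn 1 z) k) \<noteq> 1"
          by (metis Ints_1 Ints_diff Ints_of_int add_diff_cancel_right')
        have "cmod (seg_sum 0 (Suc i) s) \<le> real (Suc i) * \<bar>B\<bar>"
          by (rule norm_seg_sum_le) (use sB[OF s] i in auto)
        also have "\<dots> \<le> real (Suc d) * \<bar>B\<bar>" using i by (intro mult_right_mono) auto
        finally have sg: "cmod (seg_sum 0 (Suc i) s) \<le> real (Suc d) * \<bar>B\<bar>" .
        show "cmod (seg_sum 0 (Suc i) s + of_int (tail_exp i (shiftn 1 z) k)) \<le> real (Suc d) * \<bar>B\<bar> + \<bar>real_of_int (tail_exp i (shiftn 1 z) k)\<bar>"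
          using norm_triangle_ineq[of "seg_sum 0 (Suc i) s" "of_int (tail_exp i (shiftn 1 z) k)"] sg by simp
        have "real_of_int (tail_exp i (shiftn 1 z) k) \<ge> - real i"
          using tail_exp_ge'[of i "shiftn 1 z" k] by linarith
        then show "Re (seg_sum 0 (Suc i) s + of_int (tail_exp i (shiftn 1 z) k)) \<ge> - L"
          using sg abs_Re_le_cmod[of "seg_sum 0 (Suc i) s"] i by (simp add: L_def)
      qed
      qed simp
    qed
    have "decays X A (\<lambda>N s. (V s * (z 0 ^ N * of_nat N powr (- s 0))) * (polar d (shiftn 1 s) * Li_remainder d K (shiftn 1 z) N (shiftn 1 s)) +
       (\<Sum>i\<le>d. \<Sum>k\<in>idx_box i K. - (polar (Suc d) s * (Li_cont (d - i) (shiftn (Suc i) z) (shiftn (Suc i) s) *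
         tail_coeff i (shiftn 1 z) (shiftn 1 s) k) * head_prod (Suc i) z ^ N) *
         em_error K (head_prod (Suc i) z) N (seg_sum 0 (Suc i) s + of_int (tail_exp i (shiftn 1 z) k))))"
      by (intro decays_add[OF D1] decays_sum D2) auto
    then show ?thesis
    proof (rule decays_cong)
      fix s and N :: nat assume N: "N \<ge> 1"
      show "(V s * (z 0 ^ N * of_nat N powr (- s 0))) * (polar d (shiftn 1 s) * Li_remainder d K (shiftn 1 z) N (shiftn 1 s)) +
       (\<Sum>i\<le>d. \<Sum>k\<in>idx_box i K. - (polar (Suc d) s * (Li_cont (d - i) (shiftn (Suc i) z) (shiftn (Suc i) s) *
         tail_coeff i (shiftn 1 z) (shiftn 1 s) k) * head_prod (Suc i) z ^ N) *
         em_error K (head_prod (Suc i) z) N (seg_sum 0 (Suc i) s + of_int (tail_exp i (shiftn 1 z) k)))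
        = polar (Suc d) s * (Li_approx d K z (N + 1) s - Li_approx d K z N s)"
        unfolding Li_approx_step[OF N] distrib_left sum_distrib_left
        by (intro arg_cong2[where f = "(+)"] sum.cong refl) (simp_all add: V(2) mult_ac)
    qed
  qed
  then show ?thesis unfolding X_def by blast
qed

lemma extends_holo_nested_psum: "extends_holo d (\<lambda>s. nested_psum d z N s)"
proof (induction d arbitrary: z N)
  case 0
  then show ?case by (simp add: extends_holo_const)
next
  case (Suc d)
  have "extends_holo (Suc d) (\<lambda>s. z 0 ^ n * of_nat n powr (- s 0) * nested_psum d (shiftn 1 z) n (shiftn 1 s))"
    if n: "n \<in> {1..<N}" for n
  proof (intro extends_holo_mult extends_holo_const)
    have "extends_holo (Suc d) (\<lambda>s. of_nat n powr (- (seg_sum 0 1 s + 0)))"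
      by (rule extends_holo_powr) (use n in auto)
    then show "extends_holo (Suc d) (\<lambda>s. of_nat n powr (- s 0))" by (simp add: seg_sum_def)
    show "extends_holo (Suc d) (\<lambda>s. nested_psum d (shiftn 1 z) n (shiftn 1 s))"
      using extends_holo_shiftn[OF Suc.IH[of "shiftn 1 z" n], of 1] by simp
  qed
  then show ?case by (simp only: nested_psum.simps) (rule extends_holo_sum)
qed

text \<open>Steps of order A + 2 sum up to a tail of order A + 1, which gives convergence with a
  rate for one K. Truncation independence gives the same limit for all larger K, so it is the value
  selected by \<open>Li_cont\<close>.\<close>

lemma Li_approx_limit:
  assumes IH: "\<And>e. e \<le> d \<Longrightarrow> Li_expansion e" and z: "\<forall>i<Suc d. cmod (z i) = 1"
  shows "\<exists>K0. \<forall>K\<ge>K0. decays (generic (Suc d) \<inter> polydisc (Suc d) (\<lambda>_. 0) B) A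
     (\<lambda>N s. polar (Suc d) s * (Li_approx d K z N s - Li_cont (Suc d) z s))"
proof -
  define X where "X = generic (Suc d) \<inter> polydisc (Suc d) (\<lambda>_. 0) B"
  obtain K1 where K1: "\<And>K. K \<ge> K1 \<Longrightarrow> decays X (A + 2)
     (\<lambda>N s. polar (Suc d) s * (Li_approx d K z (N + 1) s - Li_approx d K z N s))"
    using Li_approx_step_decays[OF IH z] unfolding X_def by blast
  define K0 where "K0 = max K1 (nat \<lceil>real (Suc d) * \<bar>B\<bar> + real (Suc d)\<rceil>)"
  have "decays X A (\<lambda>N s. polar (Suc d) s * (Li_approx d K z N s - Li_cont (Suc d) z s))" if K: "K \<ge> K0" for K
  proof -
    have "K \<ge> K1" using K by (simp add: K0_def)
    from K1[OF this] obtain C where C: "C \<ge> 0" "\<And>s N. s \<in> X \<Longrightarrow> N \<ge> 1 \<Longrightarrow>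
       cmod (polar (Suc d) s * (Li_approx d K z (N + 1) s - Li_approx d K z N s)) \<le> C / real N ^ (A + 2)"
      unfolding decays_def by blast
    have "cmod (polar (Suc d) s * (Li_approx d K z N s - Li_cont (Suc d) z s)) \<le> 2 * C / real N ^ A"
      if s: "s \<in> X" and N: "N \<ge> 1" for s N
    proof -
      define p where "p = polar (Suc d) s"
      have p: "p \<noteq> 0" using s unfolding p_def X_def by (simp add: polar_nonzero)
      have sB: "cmod (s t) \<le> \<bar>B\<bar>" if "t < Suc d" for t
        using that s by (force simp: X_def polydisc_def)
      have "cmod (p * Li_approx d K z (n + 1) s - p * Li_approx d K z n s) \<le> C / real n ^ (A + 2)" if "n \<ge> 1" for n
        using C(2)[OF s that] by (simp add: p_def right_diff_distrib)
      from convergent_of_step_bound[of "\<lambda>n. p * Li_approx d K z n s", OF this C(1)]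
      obtain l where l: "(\<lambda>n. p * Li_approx d K z n s) \<longlonglongrightarrow> l"
        "\<And>n. n \<ge> 1 \<Longrightarrow> cmod (p * Li_approx d K z n s - l) \<le> 2 * C / real n ^ (A + 1)" by blast
      have lim: "(\<lambda>n. Li_approx d K z n s) \<longlonglongrightarrow> l / p"
        using tendsto_divide[OF l(1) tendsto_const[of p]] p by simp
      have "(\<lambda>n. Li_approx d K' z n s) \<longlonglongrightarrow> l / p" if K': "K' \<ge> K" for K'
      proof -
        have "(\<lambda>n. \<Sum>i<Suc d. Li_cont (d - i) (shiftn (Suc i) z) (shiftn (Suc i) s) * (tail_sum (Suc i) K' z n s - tail_sum (Suc i) K z n s))
           \<longlonglongrightarrow> (\<Sum>i<Suc d. Li_cont (d - i) (shiftn (Suc i) z) (shiftn (Suc i) s) * 0)"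
        proof (intro tendsto_sum tendsto_mult tendsto_const tail_sum_truncation K')
          fix i t assume "i \<in> {..<Suc d}" "t < Suc i"
          then show "cmod (z t) = 1" using z by simp
        next
          fix i assume i: "i \<in> {..<Suc d}"
          have "cmod (seg_sum 0 (Suc i) s) \<le> real (Suc i) * \<bar>B\<bar>"
            by (rule norm_seg_sum_le) (use sB i in auto)
          also have "\<dots> \<le> real (Suc d) * \<bar>B\<bar>" using i by (intro mult_right_mono) auto
          finally have "Re (seg_sum 0 (Suc i) s) \<ge> - (real (Suc d) * \<bar>B\<bar>)"
            using abs_Re_le_cmod[of "seg_sum 0 (Suc i) s"] by linarith
          moreover have "real K \<ge> real (Suc d) * \<bar>B\<bar> + real (Suc d)" using K unfolding K0_def by linarith
          moreover have "real (Suc i) \<le> real (Suc d)" using i by simp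
          ultimately show "Re (seg_sum 0 (Suc i) s) + real K + 1 - real (Suc i) > 0" by linarith
        qed
        from tendsto_diff[OF lim this] show ?thesis
          unfolding Li_approx_def by (simp add: right_diff_distrib sum_subtractf del: sum.lessThan_Suc nested_psum.simps)
      qed
      then have "\<forall>\<^sub>F K in sequentially. (\<lambda>n. Li_approx d K z n s) \<longlonglongrightarrow> l / p"
        unfolding eventually_sequentially by blast
      then have "Li_cont (Suc d) z s = l / p" by (rule Li_cont_eqI)
      then have "polar (Suc d) s * (Li_approx d K z N s - Li_cont (Suc d) z s) = p * Li_approx d K z N s - l"
        using p by (simp add: p_def right_diff_distrib)
      also have "cmod \<dots> \<le> 2 * C / real N ^ (A + 1)" by (rule l(2)[OF N])
      also have "\<dots> \<le> 2 * C / real N ^ A"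
        using N C(1) by (intro divide_left_mono power_increasing) auto
      finally show ?thesis .
    qed
    then show ?thesis unfolding decays_def using C(1) by (intro exI[of _ "2 * C"]) auto
  qed
  then show ?thesis unfolding X_def by blast
qed

text \<open>Beyond the limit lemma only the holomorphic extension remains. For fixed N,
  \<open>polar\<close> times \<open>Li_approx\<close> is a finite combination of functions that
  extend by induction, and it converges at rate 1/N.\<close>

theorem Li_expansion_holds: "Li_expansion d"
proof (induction d rule: less_induct)
  case (less d)
  show ?case
  proof (cases d)
    case 0
    have "decays (generic 0 \<inter> polydisc 0 (\<lambda>_. 0) B) A (\<lambda>N s. polar 0 s * Li_remainder 0 K z N s)" for B A K z
      by (rule decays_cong[OF decays_zero]) (simp add: Li_remainder_def)
    moreover have "polar 0 s = 1" for s
    proof -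
      have "seg_pairs 0 = {}" by (auto simp: seg_pairs_def)
      then show ?thesis by (simp add: polar_def)
    qed
    then have "extends_holo 0 (\<lambda>s. polar 0 s * Li_cont 0 z s)" for z
      by (simp add: extends_holo_const)
    ultimately show ?thesis unfolding 0 Li_expansion_def by blast
  next
    case (Suc e)
    have IH: "\<And>e'. e' \<le> e \<Longrightarrow> Li_expansion e'" using less Suc by simp
    show ?thesis unfolding Suc Li_expansion_def
    proof (intro allI impI conjI)
      fix z :: "nat \<Rightarrow> complex" assume z: "\<forall>i<Suc e. cmod (z i) = 1"
      note lim = Li_approx_limit[OF IH z]
      show "\<exists>K0. \<forall>K\<ge>K0. decays (generic (Suc e) \<inter> polydisc (Suc e) (\<lambda>_. 0) B) A (\<lambda>N s. polar (Suc e) s * Li_remainder (Suc e) K z N s)" for B A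
      proof -
        obtain K0 where K0: "\<And>K. K \<ge> K0 \<Longrightarrow> decays (generic (Suc e) \<inter> polydisc (Suc e) (\<lambda>_. 0) B) A
             (\<lambda>N s. polar (Suc e) s * (Li_approx e K z N s - Li_cont (Suc e) z s))" using lim by blast
        have "decays (generic (Suc e) \<inter> polydisc (Suc e) (\<lambda>_. 0) B) A (\<lambda>N s. polar (Suc e) s * Li_remainder (Suc e) K z N s)" if "K \<ge> K0" for K
          by (rule decays_cong[OF K0[OF that]]) (simp add: Li_remainder_Suc)
        then show ?thesis by blast
      qed
      show "extends_holo (Suc e) (\<lambda>s. polar (Suc e) s * Li_cont (Suc e) z s)"
      proof (rule extends_holo_limit)
        fix B
        obtain K where K: "decays (generic (Suc e) \<inter> polydisc (Suc e) (\<lambda>_. 0) B) 1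
             (\<lambda>N s. polar (Suc e) s * (Li_approx e K z N s - Li_cont (Suc e) z s))" using lim by blast
        then obtain C where C: "\<And>s N. s \<in> generic (Suc e) \<inter> polydisc (Suc e) (\<lambda>_. 0) B \<Longrightarrow> N \<ge> 1 \<Longrightarrow>
           cmod (polar (Suc e) s * (Li_approx e K z N s - Li_cont (Suc e) z s)) \<le> C / real N ^ 1"
          unfolding decays_def by blast
        have "extends_holo (Suc e) (\<lambda>s. polar (Suc e) s * Li_approx e K z N s)" if N: "N \<ge> 1" for N
        proof -
          have t: "extends_holo (Suc e) (\<lambda>s. \<Sum>k\<in>idx_box (Suc i) K. head_prod (Suc i) z ^ N * (polar (Suc e) s * (Li_cont (e - i) (shiftn (Suc i) z) (shiftn (Suc i) s) * tail_coeff (Suc i) z s k) *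
              of_nat N powr (- (seg_sum 0 (Suc i) s + of_int (tail_exp (Suc i) z k)))))" if i: "i \<in> {..<Suc e}" for i
          proof -
            have "\<forall>j<e - i. cmod (shiftn (Suc i) z j) = 1" using z i by (simp add: shiftn_def)
            then have "extends_holo (Suc e - Suc i) (\<lambda>s. polar (Suc e - Suc i) s * Li_cont (e - i) (shiftn (Suc i) z) s)"
              using IH[of "e - i"] unfolding Li_expansion_def by simp
            from extends_holo_polar_Li_tail[OF this, of z] i
            have q: "extends_holo (Suc e) (\<lambda>s. polar (Suc e) s * (Li_cont (e - i) (shiftn (Suc i) z) (shiftn (Suc i) s) * tail_coeff (Suc i) z s k))" for k
              by (simp del: tail_coeff.simps)
            have pw: "extends_holo (Suc e) (\<lambda>s. of_nat N powr (- (seg_sum 0 (Suc i) s + c)))" for c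
              by (rule extends_holo_powr[OF N]) (use i in auto)
            show ?thesis
              by (intro extends_holo_sum extends_holo_mult[OF extends_holo_const extends_holo_mult[OF q pw]])
          qed
          have "extends_holo (Suc e) (\<lambda>s. polar (Suc e) s * nested_psum (Suc e) z N s - (\<Sum>i<Suc e. \<Sum>k\<in>idx_box (Suc i) K. head_prod (Suc i) z ^ N * (polar (Suc e) s * (Li_cont (e - i) (shiftn (Suc i) z) (shiftn (Suc i) s) * tail_coeff (Suc i) z s k) *
              of_nat N powr (- (seg_sum 0 (Suc i) s + of_int (tail_exp (Suc i) z k))))))"
            by (intro extends_holo_diff extends_holo_mult extends_holo_nested_psum extends_holoI bdd_gateaux_polar extends_holo_sum[OF t])
          then show ?thesis
            by (rule extends_holo_cong)
               (simp add: Li_approx_def tail_sum_def right_diff_distrib sum_distrib_left mult_ac del: nested_psum.simps sum.lessThan_Suc tail_coeff.simps tail_exp.simps)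
        qed
        moreover have "cmod (polar (Suc e) s * Li_cont (Suc e) z s - polar (Suc e) s * Li_approx e K z N s) \<le> C / real N"
          if "s \<in> generic (Suc e) \<inter> polydisc (Suc e) (\<lambda>_. 0) B" "N \<ge> 1" for s N
          using C[OF that] by (simp add: right_diff_distrib norm_minus_commute)
        ultimately show "\<exists>h C. \<forall>N::nat\<ge>1. extends_holo (Suc e) (h N) \<and>
          (\<forall>s\<in>generic (Suc e) \<inter> polydisc (Suc e) (\<lambda>_. 0) B. cmod (polar (Suc e) s * Li_cont (Suc e) z s - h N s) \<le> C / real N)"
          by (intro exI[of _ "\<lambda>N s. polar (Suc e) s * Li_approx e K z N s"] exI[of _ C]) simp
      qed
    qed
  qed
qed

section \<open>The analytic continuation of the polylogarithm\<close>

lemma trunc_tuples_0: "trunc_tuples 0 N = {\<lambda>_. 0}"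
  by (auto simp: trunc_tuples_def decr_tuples_def)

lemma trunc_tuples_Suc_bij:
  "bij_betw (\<lambda>n. (n 0, shiftn 1 n)) (trunc_tuples (Suc d) N) (SIGMA m:{1..<N}. trunc_tuples d m)"
proof (rule bij_betw_byWitness[where f' = "\<lambda>(m, n). case_nat m n"])
  show "\<forall>a\<in>trunc_tuples (Suc d) N. (\<lambda>(m, n). case_nat m n) (a 0, shiftn 1 a) = a"
    by (auto simp: fun_eq_iff shiftn_def split: nat.splits)
  show "\<forall>a\<in>SIGMA m:{1..<N}. trunc_tuples d m. (\<lambda>n. (n 0, shiftn 1 n)) ((\<lambda>(m, n). case_nat m n) a) = a"
    by (auto simp: shiftn_def)
  show "(\<lambda>n. (n 0, shiftn 1 n)) ` trunc_tuples (Suc d) N \<subseteq> (SIGMA m:{1..<N}. trunc_tuples d m)"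
    by (auto simp: trunc_tuples_def decr_tuples_def shiftn_def Suc_le_eq)
  show "(\<lambda>(m, n). case_nat m n) ` (SIGMA m:{1..<N}. trunc_tuples d m) \<subseteq> trunc_tuples (Suc d) N"
    by (auto simp: trunc_tuples_def decr_tuples_def Suc_le_eq split: nat.splits)
qed

lemma finite_trunc_tuples [simp, intro]: "finite (trunc_tuples d N)"
proof (induction d arbitrary: N)
  case 0
  then show ?case by (simp add: trunc_tuples_0)
next
  case (Suc d)
  then show ?case using bij_betw_finite[OF trunc_tuples_Suc_bij[of d N]] by auto
qed

lemma sum_trunc_tuples_Suc:
  fixes g :: "nat \<Rightarrow> nat \<Rightarrow> 'a :: comm_semiring_1"
  shows "(\<Sum>n\<in>trunc_tuples (Suc d) N. \<Prod>i<Suc d. g i (n i)) =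
    (\<Sum>m\<in>{1..<N}. g 0 m * (\<Sum>n\<in>trunc_tuples d m. \<Prod>i<d. g (Suc i) (n i)))"
proof -
  have "(\<Sum>n\<in>trunc_tuples (Suc d) N. \<Prod>i<Suc d. g i (n i)) =
     (\<Sum>(m, n)\<in>(SIGMA m:{1..<N}. trunc_tuples d m). g 0 m * (\<Prod>i<d. g (Suc i) (n i)))"
    by (subst sum.reindex_bij_betw[OF trunc_tuples_Suc_bij, symmetric])
       (simp add: prod.lessThan_Suc_shift shiftn_def del: prod.lessThan_Suc)
  also have "\<dots> = (\<Sum>m\<in>{1..<N}. \<Sum>n\<in>trunc_tuples d m. g 0 m * (\<Prod>i<d. g (Suc i) (n i)))"
    by (subst sum.Sigma) auto
  finally show ?thesis by (simp add: sum_distrib_left)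
qed

lemma nested_psum_eq_trunc:
  "nested_psum d z N s = (\<Sum>n\<in>trunc_tuples d N. \<Prod>i<d. z i ^ n i * of_nat (n i) powr (- s i))"
proof (induction d arbitrary: z N s)
  case 0
  then show ?case by (simp add: trunc_tuples_0)
next
  case (Suc d)
  show ?case
    unfolding sum_trunc_tuples_Suc[where g = "\<lambda>i m. z i ^ m * of_nat m powr (- s i)"] nested_psum.simps Suc.IH
    by (simp add: shiftn_def)
qed

lemma tail_sum_tendsto_0:
  assumes z: "\<And>t. t < i \<Longrightarrow> cmod (z t) = 1" and s: "Re (seg_sum 0 i s) > real i"
  shows "(\<lambda>N. tail_sum i K z N s) \<longlonglongrightarrow> 0"
proof -
  have hp: "cmod (head_prod i z) = 1" by (rule norm_head_prod) (rule z)
  have "(\<lambda>N. \<Sum>k\<in>idx_box i K. tail_coeff i z s k *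
     (head_prod i z ^ N * of_nat N powr (- (seg_sum 0 i s + of_int (tail_exp i z k))))) \<longlonglongrightarrow> (\<Sum>k\<in>idx_box i K. tail_coeff i z s k * 0)"
  proof (intro tendsto_sum tendsto_mult tendsto_const)
    fix k
    have "real_of_int (tail_exp i z k) \<ge> - real i" using tail_exp_ge'[of i z k] by linarith
    then have "Re (- (seg_sum 0 i s + of_int (tail_exp i z k))) < 0" using s by simp
    from tendsto_norm_zero[OF tendsto_nat_powr_zero[OF this]]
    have "(\<lambda>N. norm (head_prod i z ^ N * of_nat N powr (- (seg_sum 0 i s + of_int (tail_exp i z k))))) \<longlonglongrightarrow> 0"
      by (simp only: norm_mult norm_power hp power_one mult_1)
    then show "(\<lambda>N. head_prod i z ^ N * of_nat N powr (- (seg_sum 0 i s + of_int (tail_exp i z k)))) \<longlonglongrightarrow> 0"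
      by (rule tendsto_norm_zero_cancel)
  qed
  then show ?thesis unfolding tail_sum_def by (simp add: sum_distrib_left mult_ac)
qed

lemma cspace_in_polydisc:
  assumes "s \<in> cspace d"
  shows "s \<in> polydisc d (\<lambda>_. 0) (1 + (\<Sum>t<d. cmod (s t)))"
  unfolding polydisc_iff
proof (intro conjI allI impI assms)
  fix i assume "i < d"
  then have "cmod (s i) \<le> (\<Sum>t<d. cmod (s t))" by (intro member_le_sum) auto
  then show "cmod (s i - 0) < 1 + (\<Sum>t<d. cmod (s t))" by simp
qed

text \<open>In the domain of convergence every tail with i > 0 tends to 0, so the constant term is
  the limit of the partial sums.\<close>

lemma nested_psum_tendsto_Li_cont:
  assumes z: "\<forall>i<d. cmod (z i) = 1" and s: "s \<in> generic d"
    and dom: "\<And>j. 1 \<le> j \<Longrightarrow> j \<le> d \<Longrightarrow> Re (seg_sum 0 j s) > real j"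
  shows "(\<lambda>N. nested_psum d z N s) \<longlonglongrightarrow> Li_cont d z s"
proof -
  have sc: "s \<in> cspace d" using s generic_subset_cspace by blast
  obtain K where "decays (generic d \<inter> polydisc d (\<lambda>_. 0) (1 + (\<Sum>t<d. cmod (s t)))) 1 (\<lambda>N s. polar d s * Li_remainder d K z N s)"
    using Li_expansion_holds[of d] z unfolding Li_expansion_def by blast
  then obtain C where C: "\<And>N. N \<ge> 1 \<Longrightarrow> cmod (polar d s * Li_remainder d K z N s) \<le> C / real N ^ 1"
    unfolding decays_def using s cspace_in_polydisc[OF sc] by blast
  have "(\<lambda>N. polar d s * Li_remainder d K z N s) \<longlonglongrightarrow> 0"
  proof (rule Lim_null_comparison)
    show "\<forall>\<^sub>F N in sequentially. norm (polar d s * Li_remainder d K z N s) \<le> C / real N"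
      using eventually_ge_at_top[of 1] by eventually_elim (use C in simp)
  qed (rule lim_const_over_n)
  from tendsto_divide[OF this tendsto_const[of "polar d s"]]
  have rem: "(\<lambda>N. Li_remainder d K z N s) \<longlonglongrightarrow> 0" using polar_nonzero[OF s] by simp
  have "(\<lambda>N. \<Sum>i\<le>d. Li_cont (d - i) (shiftn i z) (shiftn i s) * tail_sum i K z N s) \<longlonglongrightarrow>
    (\<Sum>i\<le>d. Li_cont (d - i) (shiftn i z) (shiftn i s) * (if i = 0 then 1 else 0))"
  proof (intro tendsto_sum tendsto_mult tendsto_const)
    fix i assume i: "i \<in> {..d}"
    show "(\<lambda>N. tail_sum i K z N s) \<longlonglongrightarrow> (if i = 0 then 1 else 0)"
    proof (cases "i = 0")
      case True
      have "\<forall>\<^sub>F N in sequentially. tail_sum i K z N s = 1"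
        using eventually_ge_at_top[of 1] by eventually_elim (simp add: True)
      then show ?thesis using True by (simp add: tendsto_eventually)
    next
      case False
      have "(\<lambda>N. tail_sum i K z N s) \<longlonglongrightarrow> 0"
        by (rule tail_sum_tendsto_0) (use z i False dom[of i] in auto)
      then show ?thesis using False by simp
    qed
  qed
  also have "(\<Sum>i\<le>d. Li_cont (d - i) (shiftn i z) (shiftn i s) * (if i = 0 then 1 else 0)) = Li_cont d z s"
    by (simp add: if_distrib[of "\<lambda>x. _ * x"] cong: if_cong)
  finally have "(\<lambda>N. Li_remainder d K z N s + (\<Sum>i\<le>d. Li_cont (d - i) (shiftn i z) (shiftn i s) * tail_sum i K z N s)) \<longlonglongrightarrow> 0 + Li_cont d z s"
    by (intro tendsto_add rem)
  then show ?thesis by (simp add: Li_remainder_def)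
qed

section \<open>The polylogarithm series as an unconditional sum\<close>

lemma trunc_tuples_mono: "M \<le> N \<Longrightarrow> trunc_tuples d M \<subseteq> trunc_tuples d N"
  by (auto simp: trunc_tuples_def)

lemma finite_subset_trunc_tuples:
  assumes "finite F" "F \<subseteq> decr_tuples d"
  obtains N where "F \<subseteq> trunc_tuples d N"
proof
  have "n 0 < Suc (\<Sum>n\<in>F. n 0)" if "n \<in> F" for n
    using member_le_sum[OF that, of "\<lambda>n. n 0"] assms(1) by (simp add: less_Suc_eq_le)
  then show "F \<subseteq> trunc_tuples d (Suc (\<Sum>n\<in>F. n 0))"
    using assms(2) by (auto simp: trunc_tuples_def)
qed

lemma filterlim_trunc_tuples:
  "filterlim (trunc_tuples d) (finite_subsets_at_top (decr_tuples d)) sequentially"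
  unfolding filterlim_finite_subsets_at_top
proof (intro allI impI)
  fix F assume "finite F \<and> F \<subseteq> decr_tuples d"
  then obtain N where N: "F \<subseteq> trunc_tuples d N" using finite_subset_trunc_tuples by blast
  show "\<forall>\<^sub>F N in sequentially. finite (trunc_tuples d N) \<and> F \<subseteq> trunc_tuples d N \<and> trunc_tuples d N \<subseteq> decr_tuples d"
    using eventually_ge_at_top[of N]
  proof eventually_elim
    case (elim M)
    have "trunc_tuples d M \<subseteq> decr_tuples d" by (auto simp: trunc_tuples_def)
    then show ?case using N trunc_tuples_mono[OF elim, of d] by blast
  qed
qed

lemma Li_domain_iff: "s \<in> Li_domain d \<longleftrightarrow> s \<in> cspace d \<and> (\<forall>j. 1 \<le> j \<and> j \<le> d \<longrightarrow> Re (seg_sum 0 j s) > real j)"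
  by (simp add: Li_domain_def seg_sum_def lessThan_atLeast0)

text \<open>A real point of the domain is moved slightly to a generic one with smaller coordinates; there
  the asymptotic expansion for \<open>z = (1, ..., 1)\<close> bounds the partial sums.\<close>

lemma Li_terms_abs_summable:
  assumes s: "s \<in> Li_domain d" and z: "\<forall>i<d. cmod (z i) = 1"
  shows "(\<lambda>n. norm (\<Prod>i<d. z i ^ n i / (of_nat (n i)) powr (s i))) summable_on decr_tuples d"
proof -
  define x where "x = (\<lambda>i. complex_of_real (Re (s i)))"
  have sc: "s \<in> cspace d" using s by (simp add: Li_domain_iff)
  have xc: "x \<in> cspace d" using sc by (simp add: x_def cspace_def)
  have "\<forall>\<^sub>F \<eta> in at_right (0::real). \<forall>j\<in>{1..d}. real j < Re (seg_sum 0 j s) - real j * \<eta>"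
  proof (intro eventually_ball_finite ballI)
    fix j assume j: "j \<in> {1..d}"
    have "((\<lambda>\<eta>. Re (seg_sum 0 j s) - real j * \<eta>) \<longlongrightarrow> Re (seg_sum 0 j s) - real j * 0) (at_right 0)"
      by (intro tendsto_intros)
    then show "\<forall>\<^sub>F \<eta> in at_right (0::real). real j < Re (seg_sum 0 j s) - real j * \<eta>"
      by (rule order_tendstoD) (use s j in \<open>simp add: Li_domain_iff\<close>)
  qed simp
  moreover have "\<forall>\<^sub>F \<eta> in at_right (0::real). cline x (diag_vec d) (of_real (- \<eta>)) \<in> generic d"
  proof (rule eventually_compose_filterlim[OF eventually_diag_generic[OF xc]])
    show "filterlim (\<lambda>\<eta>. complex_of_real (- \<eta>)) (at 0) (at_right 0)"
      unfolding filterlim_at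
      by (auto intro!: tendsto_eq_intros simp: eventually_at_filter)
  qed
  moreover have "\<forall>\<^sub>F \<eta> in at_right (0::real). \<eta> > 0" by (simp add: eventually_at_right_less)
  ultimately have "\<forall>\<^sub>F \<eta> in at_right (0::real). (\<forall>j\<in>{1..d}. real j < Re (seg_sum 0 j s) - real j * \<eta>) \<and>
     cline x (diag_vec d) (of_real (- \<eta>)) \<in> generic d \<and> \<eta> > 0" by (intro eventually_conj)
  then obtain \<eta> where \<eta>: "\<forall>j\<in>{1..d}. real j < Re (seg_sum 0 j s) - real j * \<eta>"
     "cline x (diag_vec d) (of_real (- \<eta>)) \<in> generic d" "\<eta> > 0"
    using eventually_happens'[OF trivial_limit_at_right_real] by blast
  define y where "y = cline x (diag_vec d) (of_real (- \<eta>))"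
  have y: "y i = of_real (Re (s i) - \<eta>)" if "i < d" for i
    using that by (simp add: y_def x_def cline_def diag_vec_def)
  have "Re (seg_sum 0 j y) > real j" if "1 \<le> j" "j \<le> d" for j
  proof -
    have "Re (seg_sum 0 j y) = (\<Sum>t<j. Re (s t) - \<eta>)"
      using that by (simp add: seg_sum_def y lessThan_atLeast0)
    also have "\<dots> = Re (seg_sum 0 j s) - real j * \<eta>"
      by (simp add: seg_sum_def sum_subtractf lessThan_atLeast0)
    finally show ?thesis using \<eta>(1) that by simp
  qed
  then have "(\<lambda>N. nested_psum d (\<lambda>_. 1) N y) \<longlonglongrightarrow> Li_cont d (\<lambda>_. 1) y"
    by (intro nested_psum_tendsto_Li_cont) (use \<eta>(2) in \<open>auto simp: y_def\<close>)
  then have "Bseq (\<lambda>N. nested_psum d (\<lambda>_. 1) N y)" by (intro convergent_imp_Bseq convergentI)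
  then obtain M where M: "\<And>N. cmod (nested_psum d (\<lambda>_. 1) N y) \<le> M" unfolding Bseq_def by blast
  define T where "T = (\<lambda>n :: nat \<Rightarrow> nat. \<Prod>i<d. real (n i) powr (- (Re (s i) - \<eta>)))"
  have T0: "T n \<ge> 0" for n by (simp add: T_def prod_nonneg)
  have pos: "n i > 0" if "n \<in> decr_tuples d" "i < d" for n i
    using that by (simp add: decr_tuples_def)
  have T_sum: "sum T (trunc_tuples d N) \<le> M" for N
  proof -
    have eq: "(\<Prod>i<d. 1 ^ n i * of_nat (n i) powr (- y i)) = complex_of_real (T n)" if "n \<in> trunc_tuples d N" for n
    proof -
      have "of_nat (n i) powr (- y i) = complex_of_real (real (n i) powr (- (Re (s i) - \<eta>)))" if "i < d" for i
        using powr_of_real[of "real (n i)" "- (Re (s i) - \<eta>)"] by (simp add: y[OF that])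
      then show ?thesis by (simp add: T_def)
    qed
    have "nested_psum d (\<lambda>_. 1) N y = complex_of_real (sum T (trunc_tuples d N))"
      unfolding nested_psum_eq_trunc of_real_sum by (intro sum.cong refl eq)
    then have "cmod (nested_psum d (\<lambda>_. 1) N y) = sum T (trunc_tuples d N)"
      by (simp only: norm_of_real) (simp add: T0 sum_nonneg)
    then show ?thesis using M[of N] by simp
  qed
  have "T summable_on decr_tuples d"
  proof (rule nonneg_bdd_above_summable_on)
    show "bdd_above (sum T ` {F. F \<subseteq> decr_tuples d \<and> finite F})"
    proof (rule bdd_aboveI2)
      fix F assume "F \<in> {F. F \<subseteq> decr_tuples d \<and> finite F}"
      then obtain N where "F \<subseteq> trunc_tuples d N" using finite_subset_trunc_tuples by blast
      then have "sum T F \<le> sum T (trunc_tuples d N)" by (intro sum_mono2) (auto simp: T0)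
      then show "sum T F \<le> M" using T_sum[of N] by simp
    qed
  qed (simp add: T0)
  then show ?thesis
  proof (rule Infinite_Sum.abs_summable_on_comparison_test')
    fix n assume n: "n \<in> decr_tuples d"
    have "cmod (\<Prod>i<d. z i ^ n i / (of_nat (n i)) powr (s i)) = (\<Prod>i<d. 1 / real (n i) powr Re (s i))"
      unfolding prod_norm[symmetric]
    proof (rule prod.cong[OF refl])
      fix i assume i: "i \<in> {..<d}"
      then have "n i > 0" using pos[OF n] by simp
      then show "cmod (z i ^ n i / (of_nat (n i)) powr (s i)) = 1 / real (n i) powr Re (s i)"
        using z i by (simp add: norm_divide norm_power norm_powr_real_powr)
    qed
    also have "\<dots> \<le> T n" unfolding T_def
    proof (rule prod_mono)
      fix i assume i: "i \<in> {..<d}"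
      then have "n i > 0" using pos[OF n] by simp
      then have "real (n i) powr (- Re (s i)) \<le> real (n i) powr (- (Re (s i) - \<eta>))"
        using \<eta>(3) by (intro powr_mono) auto
      then show "0 \<le> 1 / real (n i) powr Re (s i) \<and> 1 / real (n i) powr Re (s i) \<le> real (n i) powr (- (Re (s i) - \<eta>))"
        by (simp add: powr_minus_divide)
    qed
    finally show "norm (\<Prod>i<d. z i ^ n i / (of_nat (n i)) powr (s i)) \<le> T n" .
  qed
qed

lemma Li_series_eq_Li_cont:
  assumes s: "s \<in> Li_domain d" "s \<in> generic d" and z: "\<forall>i<d. cmod (z i) = 1"
  shows "Li_series d z s = Li_cont d z s"
proof -
  let ?f = "\<lambda>n. \<Prod>i<d. z i ^ n i / (of_nat (n i)) powr (s i)"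
  have "(?f has_sum Li_series d z s) (decr_tuples d)"
    unfolding Li_series_def by (rule has_sum_infsum, rule Infinite_Sum.abs_summable_summable, rule Li_terms_abs_summable[OF s(1) z])
  then have "(\<lambda>N. sum ?f (trunc_tuples d N)) \<longlonglongrightarrow> Li_series d z s"
    unfolding has_sum_def by (rule filterlim_compose[OF _ filterlim_trunc_tuples])
  moreover have "sum ?f (trunc_tuples d N) = nested_psum d z N s" for N
    unfolding nested_psum_eq_trunc by (simp add: powr_minus divide_inverse)
  ultimately have "(\<lambda>N. nested_psum d z N s) \<longlonglongrightarrow> Li_series d z s" by simp
  moreover have "(\<lambda>N. nested_psum d z N s) \<longlonglongrightarrow> Li_cont d z s"
    by (rule nested_psum_tendsto_Li_cont) (use s z in \<open>auto simp: Li_domain_iff\<close>)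
  ultimately show ?thesis by (rule LIMSEQ_unique)
qed

text \<open>The admissible sets in \<open>mero_eq\<close>. They have to be stable under intersection
  and under adding initial coordinates, because the right-hand side contains one polylogarithm for
  every suffix of the variables.\<close>

definition open_dense :: "nat \<Rightarrow> (nat \<Rightarrow> complex) set \<Rightarrow> bool" where
  "open_dense d U \<longleftrightarrow> U \<subseteq> cspace d \<and> (\<forall>p\<in>U. \<exists>e>0. polydisc d p e \<subseteq> U) \<and>
      (\<forall>p\<in>cspace d. \<forall>e>0. polydisc d p e \<inter> U \<noteq> {})"

lemma open_dense_Int:
  assumes U: "open_dense d U" and V: "open_dense d V"
  shows "open_dense d (U \<inter> V)"
  unfolding open_dense_def
proof (intro conjI ballI allI impI)
  show "U \<inter> V \<subseteq> cspace d" using U by (auto simp: open_dense_def)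
next
  fix p assume p: "p \<in> U \<inter> V"
  obtain e where e: "e > 0" "polydisc d p e \<subseteq> U" using U p unfolding open_dense_def by blast
  obtain e' where e': "e' > 0" "polydisc d p e' \<subseteq> V" using V p unfolding open_dense_def by blast
  have "polydisc d p (min e e') \<subseteq> U \<inter> V"
    using e(2) e'(2) polydisc_mono[of "min e e'" e d p] polydisc_mono[of "min e e'" e' d p] by auto
  then show "\<exists>e>0. polydisc d p e \<subseteq> U \<inter> V" using e(1) e'(1) by (intro exI[of _ "min e e'"]) auto
next
  fix p and e :: real assume p: "p \<in> cspace d" and e: "e > 0"
  obtain q where q: "q \<in> polydisc d p e" "q \<in> U" using U p e unfolding open_dense_def by blast
  obtain r where r: "r > 0" "polydisc d q r \<subseteq> polydisc d p e" using polydisc_nbhd[OF q(1)] by blast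
  obtain r' where r': "r' > 0" "polydisc d q r' \<subseteq> U" using U q(2) unfolding open_dense_def by blast
  have "q \<in> cspace d" using q(1) polydisc_subset_cspace by blast
  moreover have "min r r' > 0" using r r' by simp
  ultimately obtain x where x: "x \<in> polydisc d q (min r r')" "x \<in> V" using V unfolding open_dense_def by blast
  have "x \<in> polydisc d q r" "x \<in> polydisc d q r'"
    using x(1) polydisc_mono[of "min r r'" r d q] polydisc_mono[of "min r r'" r' d q] by auto
  then show "polydisc d p e \<inter> (U \<inter> V) \<noteq> {}" using r(2) r'(2) x(2) by blast
qed

lemma open_dense_generic: "open_dense d (generic d)"
  unfolding open_dense_def
proof (intro conjI ballI allI impI)
  show "generic d \<subseteq> cspace d" by (rule generic_subset_cspace)
next
  fix p assume p: "p \<in> generic d"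
  have pc: "p \<in> cspace d" using p generic_subset_cspace by blast
  have "c_analytic_at d (polar d) p"
    by (rule bdd_gateaux_imp_c_analytic_at[OF bdd_gateaux_polar polydisc_centre[OF pc zero_less_one]])
  from c_analytic_at_continuous[OF this pc, of "cmod (polar d p)"] polar_nonzero[OF p]
  obtain e where e: "e > 0" "\<And>q. q \<in> polydisc d p e \<Longrightarrow> cmod (polar d q - polar d p) < cmod (polar d p)"
    by auto
  have "q \<in> generic d" if q: "q \<in> polydisc d p e" for q
  proof -
    have "polar d q \<noteq> 0" using e(2)[OF q] by auto
    then show ?thesis using q by (simp add: generic_iff_polar polydisc_iff)
  qed
  then show "\<exists>e>0. polydisc d p e \<subseteq> generic d" using e(1) by blast
next
  fix p and e :: real assume p: "p \<in> cspace d" and e: "e > 0"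
  have "\<forall>\<^sub>F t in at 0. cline p (diag_vec d) t \<in> polydisc d p e"
    using eventually_at_in_open'[OF open_polydisc_line[OF p diag_vec_cspace], of 0 p e] polydisc_centre[OF p e] by simp
  with eventually_diag_generic[OF p] have "\<forall>\<^sub>F t in at 0. cline p (diag_vec d) t \<in> polydisc d p e \<inter> generic d"
    by eventually_elim simp
  then have "\<exists>t. cline p (diag_vec d) t \<in> polydisc d p e \<inter> generic d"
    using eventually_happens'[OF trivial_limit_at] by blast
  then show "polydisc d p e \<inter> generic d \<noteq> {}" by blast
qed

lemma open_dense_shiftn:
  assumes U: "open_dense d U"
  shows "open_dense (n + d) {s \<in> cspace (n + d). shiftn n s \<in> U}"
  unfolding open_dense_def
proof (intro conjI ballI allI impI)
  fix p assume p: "p \<in> {s \<in> cspace (n + d). shiftn n s \<in> U}"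
  then obtain e where e: "e > 0" "polydisc d (shiftn n p) e \<subseteq> U" using U unfolding open_dense_def by blast
  have "shiftn n q \<in> polydisc d (shiftn n p) e" if "q \<in> polydisc (n + d) p e" for q
    using that by (auto simp: polydisc_def shiftn_def)
  then show "\<exists>e>0. polydisc (n + d) p e \<subseteq> {s \<in> cspace (n + d). shiftn n s \<in> U}"
    using e polydisc_subset_cspace by blast
next
  fix p and e :: real assume p: "p \<in> cspace (n + d)" and e: "e > 0"
  obtain q where q: "q \<in> polydisc d (shiftn n p) e" "q \<in> U"
    using U shiftn_cspace[OF p] e unfolding open_dense_def by blast
  define q' where "q' = (\<lambda>i. if i < n then p i else q (i - n))"
  have "shiftn n q' = q" by (simp add: q'_def shiftn_def)
  moreover have "q' \<in> polydisc (n + d) p e"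
    unfolding polydisc_def
  proof (intro CollectI conjI allI impI)
    fix i assume i: "i < n + d"
    show "cmod (q' i - p i) < e"
    proof (cases "i < n")
      case True
      then show ?thesis using e by (simp add: q'_def)
    next
      case False
      then obtain j where j: "i = n + j" "j < d" using i by (metis add_diff_inverse_nat nat_add_left_cancel_less)
      then show ?thesis using q(1) by (simp add: q'_def polydisc_def shiftn_def)
    qed
  next
    fix i assume "n + d \<le> i"
    then show "q' i = 0" using q(1) by (simp add: q'_def polydisc_def)
  qed
  ultimately show "polydisc (n + d) p e \<inter> {s \<in> cspace (n + d). shiftn n s \<in> U} \<noteq> {}"
    using q(2) polydisc_subset_cspace[of "n + d" p e] by blast
qed auto

text \<open>Local quotients have an extension of \<open>polar d s * f s\<close> as numerator and
  \<open>polar d\<close> as denominator. Nongeneric points are the zeros of this denominator, so F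
  may take any values there.\<close>

lemma c_meromorphic_of_extends_holo:
  assumes f: "extends_holo d (\<lambda>s. polar d s * f s)" and F: "\<And>s. s \<in> generic d \<Longrightarrow> F s = f s"
  shows "c_meromorphic d F"
  unfolding c_meromorphic_def
proof
  fix p assume p: "p \<in> cspace d"
  define B where "B = 2 + (\<Sum>t<d. cmod (p t))"
  have sub: "polydisc d p 1 \<subseteq> polydisc d (\<lambda>_. 0) B"
  proof
    fix s assume s: "s \<in> polydisc d p 1"
    have "cmod (s i) < B" if i: "i < d" for i
    proof -
      have "cmod (s i) \<le> cmod (p i) + cmod (s i - p i)" using norm_triangle_sub by blast
      moreover have "cmod (p i) \<le> (\<Sum>t<d. cmod (p t))" using i by (intro member_le_sum) auto
      moreover have "cmod (s i - p i) < 1" using s i by (simp add: polydisc_def)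
      ultimately show ?thesis by (simp add: B_def)
    qed
    then show "s \<in> polydisc d (\<lambda>_. 0) B" using s by (simp add: polydisc_iff)
  qed
  obtain g where g: "bdd_gateaux d (polydisc d (\<lambda>_. 0) B) g"
    "\<forall>s\<in>generic d \<inter> polydisc d (\<lambda>_. 0) B. g s = polar d s * f s"
    using f unfolding extends_holo_def by blast
  have 1: "c_analytic_at d g q \<and> c_analytic_at d (polar d) q" if "q \<in> polydisc d p 1" for q
    using bdd_gateaux_imp_c_analytic_at[OF bdd_gateaux_polar that] bdd_gateaux_imp_c_analytic_at[OF g(1), of q] that sub by blast
  obtain q where q: "q \<in> polydisc d p 1" "q \<in> generic d"
    using open_dense_generic[of d] p unfolding open_dense_def using zero_less_one by blast
  have 3: "F q = g q / polar d q" if "q \<in> polydisc d p 1" "polar d q \<noteq> 0" for q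
  proof -
    have qg: "q \<in> generic d" using that by (simp add: generic_iff_polar polydisc_iff)
    have "q \<in> polydisc d (\<lambda>_. 0) B" using that(1) sub by blast
    then have "g q = polar d q * f q" using g(2) qg by blast
    then show ?thesis using F[OF qg] that(2) by simp
  qed
  have M: "(\<forall>q\<in>polydisc d p 1. c_analytic_at d g q \<and> c_analytic_at d (polar d) q) \<and>
      (\<exists>q\<in>polydisc d p 1. polar d q \<noteq> 0) \<and> (\<forall>q\<in>polydisc d p 1. polar d q \<noteq> 0 \<longrightarrow> F q = g q / polar d q)"
  proof (intro conjI)
    show "\<forall>q\<in>polydisc d p 1. c_analytic_at d g q \<and> c_analytic_at d (polar d) q" using 1 by (rule ballI)
    show "\<exists>q\<in>polydisc d p 1. polar d q \<noteq> 0" using polar_nonzero[OF q(2)] q(1) by (rule bexI)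
    show "\<forall>q\<in>polydisc d p 1. polar d q \<noteq> 0 \<longrightarrow> F q = g q / polar d q" by (intro ballI impI 3)
  qed
  show "\<exists>e>0. \<exists>g h. (\<forall>q\<in>polydisc d p e. c_analytic_at d g q \<and> c_analytic_at d h q) \<and>
      (\<exists>q\<in>polydisc d p e. h q \<noteq> 0) \<and> (\<forall>q\<in>polydisc d p e. h q \<noteq> 0 \<longrightarrow> F q = g q / h q)"
    by (rule exI[of _ 1], rule conjI[OF zero_less_one], rule exI[of _ g], rule exI[of _ "polar d"], rule M)
qed

text \<open>Since \<open>Li_mero\<close> is a choice, a witness comes first: \<open>Li_cont\<close>
  overwritten by the series on its domain, meromorphic because both agree at generic points.
  Whatever is chosen coincides with this witness on a polydisc, hence on an open dense set.\<close>

theorem Li_mero_eq_Li_cont: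
  assumes z: "\<forall>i<d. cmod (z i) = 1"
  obtains U where "open_dense d U" "\<And>s. s \<in> U \<Longrightarrow> Li_mero d z s = Li_cont d z s"
proof -
  define F where "F = (\<lambda>s. if s \<in> Li_domain d then Li_series d z s else Li_cont d z s)"
  have Fg: "F s = Li_cont d z s" if "s \<in> generic d" for s
    using Li_series_eq_Li_cont[OF _ that z] by (simp add: F_def)
  have "extends_holo d (\<lambda>s. polar d s * Li_cont d z s)"
    using Li_expansion_holds[of d] z unfolding Li_expansion_def by blast
  then have mF: "c_meromorphic d F" by (rule c_meromorphic_of_extends_holo) (rule Fg)
  then have "c_meromorphic d F \<and> (\<forall>s\<in>Li_domain d. F s = Li_series d z s)"
    by (simp add: F_def)
  then have "c_meromorphic d (Li_mero d z) \<and> (\<forall>s\<in>Li_domain d. Li_mero d z s = Li_series d z s)"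
    unfolding Li_mero_def
    by (rule someI[where P = "\<lambda>F. c_meromorphic d F \<and> (\<forall>s\<in>Li_domain d. F s = Li_series d z s)"])
  then have mL: "c_meromorphic d (Li_mero d z)" and eq: "\<And>s. s \<in> Li_domain d \<Longrightarrow> Li_mero d z s = F s"
    by (auto simp: F_def)
  \<comment> \<open>The unit polydisc around (3, ..., 3) lies in the domain of convergence: real
    parts are at least 2 there, so the first j of them add up to more than j.\<close>
  define u :: "nat \<Rightarrow> complex" where "u = (\<lambda>i. if i < d then 3 else 0)"
  have "mero_eq d (Li_mero d z) F"
  proof (rule c_meromorphic_unique[OF mL mF])
    show "u \<in> cspace d" by (simp add: u_def cspace_def)
    show "(1::real) > 0" by simp
    fix s assume s: "s \<in> polydisc d u 1"
    have "Re (seg_sum 0 j s) > real j" if j: "1 \<le> j" "j \<le> d" for j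
    proof -
      have "Re (s t) \<ge> 2" if "t < d" for t
      proof -
        have "cmod (s t - 3) < 1" using s that by (auto simp: polydisc_def u_def)
        then show ?thesis using abs_Re_le_cmod[of "s t - 3"] by simp
      qed
      then have "(\<Sum>t=0..<j. 2) \<le> (\<Sum>t=0..<j. Re (s t))" using j by (intro sum_mono) auto
      then show ?thesis using j by (simp add: seg_sum_def)
    qed
    then have "s \<in> Li_domain d" using s by (auto simp: Li_domain_iff polydisc_iff)
    then show "Li_mero d z s = F s" by (rule eq)
  qed
  then obtain U where U: "open_dense d U" "\<forall>s\<in>U. Li_mero d z s = F s"
    unfolding mero_eq_def open_dense_def by blast
  show ?thesis
    by (rule that[OF open_dense_Int[OF U(1) open_dense_generic]]) (use U(2) Fg in auto)
qed

section \<open>Uniqueness of asymptotic expansions\<close>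

definition log_scale :: "nat \<Rightarrow> nat \<Rightarrow> nat \<Rightarrow> complex" where
  "log_scale l m N = of_real (ln (real N)) ^ l * of_nat N ^ m"

text \<open>\<open>reg_expansion\<close> for an arbitrary sequence, so that taking the regularised
  value can be used as a linear operation.\<close>

definition has_reg :: "complex set \<Rightarrow> (nat \<Rightarrow> complex) \<Rightarrow> complex \<Rightarrow> bool" where
  "has_reg X f c \<longleftrightarrow> (\<exists>(L::nat) (M::nat) (u :: nat \<Rightarrow> nat \<Rightarrow> complex \<Rightarrow> complex).
      ((\<lambda>N. f N - (\<Sum>l\<le>L. \<Sum>m\<le>M. \<Sum>\<xi>\<in>X.
              u l m \<xi> * \<xi> ^ N * (of_real (ln (real N))) ^ l * (of_nat N) ^ m)) \<longlonglongrightarrow> 0)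
      \<and> c = u 0 0 1)"

lemma reg_expansion_iff_has_reg: "reg_expansion r z a k c \<longleftrightarrow> has_reg (monomial_vals r z) (partial_sum r z a k) c"
  by (simp add: reg_expansion_def has_reg_def)

text \<open>After setting the coefficients to zero outside a box, the size of the box can be enlarged freely.\<close>

lemma has_regE:
  assumes "has_reg X f c"
  obtains K u where "c = u 0 0 1"
    "\<And>K'. K' \<ge> K \<Longrightarrow> (\<lambda>N. f N - (\<Sum>l\<le>K'. \<Sum>m\<le>K'. \<Sum>\<xi>\<in>X. u l m \<xi> * \<xi> ^ N * log_scale l m N)) \<longlonglongrightarrow> 0"
proof -
  obtain L M u where u: "(\<lambda>N. f N - (\<Sum>l\<le>L. \<Sum>m\<le>M. \<Sum>\<xi>\<in>X.
              u l m \<xi> * \<xi> ^ N * (of_real (ln (real N))) ^ l * (of_nat N) ^ m)) \<longlonglongrightarrow> 0" and c: "c = u 0 0 1"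
    using assms unfolding has_reg_def by (elim exE conjE)
  define v where "v = (\<lambda>l m \<xi>. if l \<le> L \<and> m \<le> M then u l m \<xi> else 0)"
  have eq: "(\<Sum>l\<le>K'. \<Sum>m\<le>K'. \<Sum>\<xi>\<in>X. v l m \<xi> * \<xi> ^ N * log_scale l m N)
     = (\<Sum>l\<le>L. \<Sum>m\<le>M. \<Sum>\<xi>\<in>X. u l m \<xi> * \<xi> ^ N * (of_real (ln (real N))) ^ l * (of_nat N) ^ m)" if "K' \<ge> max L M" for K' N
  proof -
    have "(\<Sum>l\<le>K'. \<Sum>m\<le>K'. \<Sum>\<xi>\<in>X. v l m \<xi> * \<xi> ^ N * log_scale l m N)
      = (\<Sum>l\<le>L. \<Sum>m\<le>K'. \<Sum>\<xi>\<in>X. v l m \<xi> * \<xi> ^ N * log_scale l m N)"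
      by (rule sum.mono_neutral_right) (use that in \<open>auto simp: v_def\<close>)
    also have "\<dots> = (\<Sum>l\<le>L. \<Sum>m\<le>M. \<Sum>\<xi>\<in>X. v l m \<xi> * \<xi> ^ N * log_scale l m N)"
      by (intro sum.cong refl sum.mono_neutral_right) (use that in \<open>auto simp: v_def\<close>)
    finally show ?thesis by (simp add: v_def log_scale_def mult_ac)
  qed
  show ?thesis
  proof (rule that[of v "max L M"])
    show "c = v 0 0 1" using c by (simp add: v_def)
    show "(\<lambda>N. f N - (\<Sum>l\<le>K'. \<Sum>m\<le>K'. \<Sum>\<xi>\<in>X. v l m \<xi> * \<xi> ^ N * log_scale l m N)) \<longlonglongrightarrow> 0" if "K' \<ge> max L M" for K'
      unfolding eq[OF that] by (rule u)
  qed
qed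

lemma has_regI:
  assumes "(\<lambda>N. f N - (\<Sum>l\<le>K. \<Sum>m\<le>K. \<Sum>\<xi>\<in>X. u l m \<xi> * \<xi> ^ N * log_scale l m N)) \<longlonglongrightarrow> 0"
  shows "has_reg X f (u 0 0 1)"
  unfolding has_reg_def using assms
  by (intro exI[of _ K] exI[of _ u]) (simp add: log_scale_def mult_ac)

lemma has_reg_lincomb:
  assumes f: "has_reg X f c" and g: "has_reg X g d"
  shows "has_reg X (\<lambda>N. \<alpha> * f N + \<beta> * g N) (\<alpha> * c + \<beta> * d)"
proof -
  obtain K1 u where u: "c = u 0 0 1"
    "\<And>K'. K' \<ge> K1 \<Longrightarrow> (\<lambda>N. f N - (\<Sum>l\<le>K'. \<Sum>m\<le>K'. \<Sum>\<xi>\<in>X. u l m \<xi> * \<xi> ^ N * log_scale l m N)) \<longlonglongrightarrow> 0"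
    by (rule has_regE[OF f]) (rule that)
  obtain K2 v where v: "d = v 0 0 1"
    "\<And>K'. K' \<ge> K2 \<Longrightarrow> (\<lambda>N. g N - (\<Sum>l\<le>K'. \<Sum>m\<le>K'. \<Sum>\<xi>\<in>X. v l m \<xi> * \<xi> ^ N * log_scale l m N)) \<longlonglongrightarrow> 0"
    by (rule has_regE[OF g]) (rule that)
  define K where "K = max K1 K2"
  have "(\<lambda>N. \<alpha> * (f N - (\<Sum>l\<le>K. \<Sum>m\<le>K. \<Sum>\<xi>\<in>X. u l m \<xi> * \<xi> ^ N * log_scale l m N)) +
     \<beta> * (g N - (\<Sum>l\<le>K. \<Sum>m\<le>K. \<Sum>\<xi>\<in>X. v l m \<xi> * \<xi> ^ N * log_scale l m N))) \<longlonglongrightarrow> \<alpha> * 0 + \<beta> * 0"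
    by (intro tendsto_intros u v) (auto simp: K_def)
  then have "has_reg X (\<lambda>N. \<alpha> * f N + \<beta> * g N) ((\<lambda>l m \<xi>. \<alpha> * u l m \<xi> + \<beta> * v l m \<xi>) 0 0 1)"
    by (intro has_regI[where K = K])
       (simp add: algebra_simps sum.distrib sum_distrib_left)
  then show ?thesis by (simp add: u(1) v(1))
qed

lemma has_reg_null: "f \<longlonglongrightarrow> 0 \<Longrightarrow> has_reg X f 0"
  using has_regI[where f = f and K = 0 and u = "\<lambda>_ _ _. 0"] by simp

lemma has_reg_add: "has_reg X f c \<Longrightarrow> has_reg X g d \<Longrightarrow> has_reg X (\<lambda>N. f N + g N) (c + d)"
  using has_reg_lincomb[of X f c g d 1 1] by simp

lemma has_reg_cmult: "has_reg X f c \<Longrightarrow> has_reg X (\<lambda>N. \<alpha> * f N) (\<alpha> * c)"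
  using has_reg_lincomb[of X f c f c \<alpha> 0] by simp

lemma has_reg_sum: "(\<And>x. x \<in> A \<Longrightarrow> has_reg X (f x) (c x)) \<Longrightarrow> has_reg X (\<lambda>N. \<Sum>x\<in>A. f x N) (\<Sum>x\<in>A. c x)"
  by (induction A rule: infinite_finite_induct) (auto intro!: has_reg_add has_reg_null)

lemma has_reg_basis:
  assumes "\<xi> \<in> X" "finite X"
  shows "has_reg X (\<lambda>N. \<xi> ^ N * log_scale l m N) (if l = 0 \<and> m = 0 \<and> \<xi> = 1 then 1 else 0)"
proof -
  define u where "u = (\<lambda>l' m' \<xi>'. if l' = l then if m' = m then if \<xi>' = \<xi> then 1 else 0 else 0 else 0 :: complex)"
  have s3: "(\<Sum>\<xi>'\<in>X. u l' m' \<xi>' * \<xi>' ^ N * log_scale l' m' N) = (if l' = l then if m' = m then \<xi> ^ N * log_scale l m N else 0 else 0)" for l' m' N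
  proof -
    have "(\<Sum>\<xi>'\<in>X. u l' m' \<xi>' * \<xi>' ^ N * log_scale l' m' N) = (\<Sum>\<xi>'\<in>X. if \<xi>' = \<xi> then (if l' = l then if m' = m then \<xi> ^ N * log_scale l m N else 0 else 0) else 0)"
      by (rule sum.cong) (auto simp: u_def)
    then show ?thesis using assms by simp
  qed
  have "(\<Sum>l'\<le>l + m. \<Sum>m'\<le>l + m. \<Sum>\<xi>'\<in>X. u l' m' \<xi>' * \<xi>' ^ N * log_scale l' m' N) = \<xi> ^ N * log_scale l m N" for N
  proof -
    have "(\<Sum>l'\<le>l + m. \<Sum>m'\<le>l + m. \<Sum>\<xi>'\<in>X. u l' m' \<xi>' * \<xi>' ^ N * log_scale l' m' N)
      = (\<Sum>l'\<le>l + m. if l' = l then \<xi> ^ N * log_scale l m N else 0)"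
      unfolding s3 by (rule sum.cong) auto
    then show ?thesis by simp
  qed
  then have "has_reg X (\<lambda>N. \<xi> ^ N * log_scale l m N) (u 0 0 1)"
    by (intro has_regI[where K = "l + m"]) simp
  moreover have "u 0 0 1 = (if l = 0 \<and> m = 0 \<and> \<xi> = 1 then 1 else 0)" by (auto simp: u_def)
  ultimately show ?thesis by simp
qed

section \<open>Linear independence of the asymptotic scale\<close>

lemma poly_tendsto_0_imp_coeff_0:
  fixes c :: "nat \<Rightarrow> complex" and y :: "nat \<Rightarrow> real"
  assumes y: "filterlim y at_top sequentially"
    and lim: "(\<lambda>n. \<Sum>l\<le>L. c l * of_real (y n) ^ l) \<longlonglongrightarrow> 0"
  shows "\<forall>l\<le>L. c l = 0"
  using lim
proof (induction L)
  case 0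
  then show ?case by (simp add: tendsto_const_iff)
next
  case (Suc L)
  have pos: "\<forall>\<^sub>F n in sequentially. y n > 0" using y by (simp add: filterlim_at_top_dense)
  have inv: "(\<lambda>n. inverse (complex_of_real (y n))) \<longlonglongrightarrow> 0"
  proof -
    have "(\<lambda>n. inverse (y n)) \<longlonglongrightarrow> 0" by (rule tendsto_inverse_0_at_top[OF y])
    from tendsto_of_real[OF this, where 'a = complex] show ?thesis by simp
  qed
  have "(\<lambda>n. (\<Sum>l\<le>Suc L. c l * of_real (y n) ^ l) * inverse (of_real (y n)) ^ Suc L) \<longlonglongrightarrow> 0 * 0 ^ Suc L"
    by (intro tendsto_mult tendsto_power Suc.prems inv)
  then have 1: "(\<lambda>n. (\<Sum>l\<le>Suc L. c l * of_real (y n) ^ l) * inverse (of_real (y n)) ^ Suc L) \<longlonglongrightarrow> 0" by simp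
  have "(\<lambda>n. \<Sum>l\<le>Suc L. c l * inverse (of_real (y n)) ^ (Suc L - l)) \<longlonglongrightarrow> (\<Sum>l\<le>Suc L. c l * 0 ^ (Suc L - l))"
    by (intro tendsto_sum tendsto_mult tendsto_power tendsto_const inv)
  also have "(\<Sum>l\<le>Suc L. c l * 0 ^ (Suc L - l)) = c (Suc L)"
  proof -
    have "(\<Sum>l\<le>L. c l * 0 ^ (Suc L - l)) = 0" by (intro sum.neutral) auto
    then show ?thesis by simp
  qed
  finally have 2: "(\<lambda>n. \<Sum>l\<le>Suc L. c l * inverse (of_real (y n)) ^ (Suc L - l)) \<longlonglongrightarrow> c (Suc L)" .
  have "\<forall>\<^sub>F n in sequentially. (\<Sum>l\<le>Suc L. c l * inverse (of_real (y n)) ^ (Suc L - l)) = (\<Sum>l\<le>Suc L. c l * of_real (y n) ^ l) * inverse (of_real (y n)) ^ Suc L"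
    using pos
  proof eventually_elim
    case (elim n)
    have "inverse (of_real (y n)) ^ (Suc L - l) = complex_of_real (y n) ^ l * inverse (of_real (y n)) ^ Suc L" if "l \<le> Suc L" for l
    proof -
      have "inverse (of_real (y n)) ^ Suc L = inverse (complex_of_real (y n)) ^ l * inverse (of_real (y n)) ^ (Suc L - l)"
        using that by (simp only: power_add[symmetric]) simp
      moreover have "complex_of_real (y n) ^ l * inverse (of_real (y n)) ^ l = 1"
        using elim by (simp add: power_mult_distrib[symmetric])
      ultimately show ?thesis by (simp add: mult.assoc[symmetric])
    qed
    then show ?case unfolding sum_distrib_right by (intro sum.cong refl) (simp only: atMost_iff mult.assoc)
  qed
  from Lim_transform_eventually[OF 2 this] 1 have "c (Suc L) = 0" by (rule LIMSEQ_unique)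
  then have "(\<lambda>n. \<Sum>l\<le>L. c l * of_real (y n) ^ l) \<longlonglongrightarrow> 0" using Suc.prems by simp
  from Suc.IH[OF this] \<open>c (Suc L) = 0\<close> show ?case by (auto simp: le_Suc_eq)
qed

lemma log_power_over_power:
  fixes x :: "nat \<Rightarrow> nat"
  assumes x: "filterlim x at_top sequentially" and k: "k \<ge> 1"
  shows "(\<lambda>n. complex_of_real (ln (real (x n))) ^ l * inverse (of_nat (x n)) ^ k) \<longlonglongrightarrow> 0"
proof (rule Lim_null_comparison)
  have "((\<lambda>t :: real. t ^ l / exp t) \<longlongrightarrow> 0) at_top" by (rule tendsto_power_div_exp_0)
  moreover have "filterlim (\<lambda>n. ln (real (x n))) at_top sequentially"
    by (intro filterlim_compose[OF ln_at_top] filterlim_compose[OF filterlim_real_sequentially] x)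
  ultimately show "(\<lambda>n. ln (real (x n)) ^ l / exp (ln (real (x n)))) \<longlonglongrightarrow> 0"
    by (rule filterlim_compose)
  have "\<forall>\<^sub>F n in sequentially. x n \<ge> 1" using x by (simp add: filterlim_at_top)
  then show "\<forall>\<^sub>F n in sequentially. norm (complex_of_real (ln (real (x n))) ^ l * inverse (of_nat (x n)) ^ k) \<le> ln (real (x n)) ^ l / exp (ln (real (x n)))"
  proof eventually_elim
    case (elim n)
    have ln0: "ln (real (x n)) \<ge> 0" using elim by simp
    have "inverse (real (x n)) ^ k \<le> inverse (real (x n)) ^ 1"
      using elim k by (intro power_decreasing) (auto simp: field_simps)
    then have "ln (real (x n)) ^ l * inverse (real (x n)) ^ k \<le> ln (real (x n)) ^ l * inverse (real (x n))"
      using ln0 by (intro mult_left_mono) auto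
    moreover have "norm (complex_of_real (ln (real (x n))) ^ l * inverse (of_nat (x n)) ^ k) = ln (real (x n)) ^ l * inverse (real (x n)) ^ k"
      using ln0 by (simp add: norm_mult norm_power norm_inverse)
    ultimately show ?case using elim by (simp add: divide_inverse)
  qed
qed

text \<open>The highest power of N is isolated first, leaving a polynomial in log N to which the
  previous case applies. A subsequence x is allowed because the oscillating coefficients are
  constant only along residue classes.\<close>

lemma log_scale_tendsto_0_imp_coeff_0:
  fixes x :: "nat \<Rightarrow> nat"
  assumes x: "filterlim x at_top sequentially"
    and lim: "(\<lambda>n. \<Sum>m\<le>M. \<Sum>l\<le>L. v l m * log_scale l m (x n)) \<longlonglongrightarrow> 0"
  shows "\<forall>m\<le>M. \<forall>l\<le>L. v l m = 0"
  using lim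
proof (induction M)
  case 0
  have y: "filterlim (\<lambda>n. ln (real (x n))) at_top sequentially"
    by (intro filterlim_compose[OF ln_at_top] filterlim_compose[OF filterlim_real_sequentially] x)
  have "\<forall>l\<le>L. v l 0 = 0"
    by (rule poly_tendsto_0_imp_coeff_0[OF y]) (use 0 in \<open>simp add: log_scale_def\<close>)
  then show ?case by simp
next
  case (Suc M)
  have y: "filterlim (\<lambda>n. ln (real (x n))) at_top sequentially"
    by (intro filterlim_compose[OF ln_at_top] filterlim_compose[OF filterlim_real_sequentially] x)
  have inv: "(\<lambda>n. inverse (complex_of_nat (x n))) \<longlonglongrightarrow> 0"
    using log_power_over_power[OF x, of 1 0] by simp
  have "(\<lambda>n. (\<Sum>m\<le>Suc M. \<Sum>l\<le>L. v l m * log_scale l m (x n)) * inverse (of_nat (x n)) ^ Suc M) \<longlonglongrightarrow> 0 * 0 ^ Suc M"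
    by (intro tendsto_mult tendsto_power Suc.prems inv)
  then have 1: "(\<lambda>n. (\<Sum>m\<le>Suc M. \<Sum>l\<le>L. v l m * log_scale l m (x n)) * inverse (of_nat (x n)) ^ Suc M) \<longlonglongrightarrow> 0" by simp
  have 2: "(\<lambda>n. \<Sum>m\<le>M. \<Sum>l\<le>L. v l m * (of_real (ln (real (x n))) ^ l * inverse (of_nat (x n)) ^ (Suc M - m))) \<longlonglongrightarrow> (\<Sum>m\<le>M. \<Sum>l\<le>L. v l m * 0)"
    by (intro tendsto_sum tendsto_mult tendsto_const log_power_over_power x) auto
  have "\<forall>\<^sub>F n in sequentially. x n \<ge> 1" using x by (simp add: filterlim_at_top)
  then have "\<forall>\<^sub>F n in sequentially. (\<Sum>m\<le>Suc M. \<Sum>l\<le>L. v l m * log_scale l m (x n)) * inverse (of_nat (x n)) ^ Suc M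
     - (\<Sum>m\<le>M. \<Sum>l\<le>L. v l m * (of_real (ln (real (x n))) ^ l * inverse (of_nat (x n)) ^ (Suc M - m)))
     = (\<Sum>l\<le>L. v l (Suc M) * of_real (ln (real (x n))) ^ l)"
  proof eventually_elim
    case (elim n)
    have e: "of_nat (x n) ^ m * inverse (of_nat (x n)) ^ Suc M = inverse (complex_of_nat (x n)) ^ (Suc M - m)" if "m \<le> Suc M" for m
    proof -
      have "inverse (of_nat (x n)) ^ Suc M = inverse (complex_of_nat (x n)) ^ m * inverse (of_nat (x n)) ^ (Suc M - m)"
        using that by (simp only: power_add[symmetric]) simp
      moreover have "complex_of_nat (x n) ^ m * inverse (of_nat (x n)) ^ m = 1"
        using elim by (simp add: power_mult_distrib[symmetric])
      ultimately show ?thesis by (simp add: mult.assoc[symmetric])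
    qed
    have "(\<Sum>m\<le>Suc M. \<Sum>l\<le>L. v l m * log_scale l m (x n)) * inverse (of_nat (x n)) ^ Suc M
      = (\<Sum>m\<le>Suc M. \<Sum>l\<le>L. v l m * (of_real (ln (real (x n))) ^ l * (of_nat (x n) ^ m * inverse (of_nat (x n)) ^ Suc M)))"
      unfolding sum_distrib_right log_scale_def by (simp only: mult.assoc)
    also have "\<dots> = (\<Sum>m\<le>Suc M. \<Sum>l\<le>L. v l m * (of_real (ln (real (x n))) ^ l * inverse (of_nat (x n)) ^ (Suc M - m)))"
      by (intro sum.cong refl) (simp only: e atMost_iff)
    finally show ?case by simp
  qed
  from Lim_transform_eventually[OF tendsto_diff[OF 1 2] this]
  have "(\<lambda>n. \<Sum>l\<le>L. v l (Suc M) * of_real (ln (real (x n))) ^ l) \<longlonglongrightarrow> 0" by simp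
  from poly_tendsto_0_imp_coeff_0[OF y this] have z: "\<forall>l\<le>L. v l (Suc M) = 0" .
  then have "(\<lambda>n. \<Sum>m\<le>M. \<Sum>l\<le>L. v l m * log_scale l m (x n)) \<longlonglongrightarrow> 0" using Suc.prems by simp
  from Suc.IH[OF this] z show ?case by (auto simp: le_Suc_eq)
qed

text \<open>Along N = j modulo P every \<open>\<xi> ^ N\<close> is constant, so the combined
  coefficient of the trivial scale vanishes for each j. Summing over a full period annihilates all
  \<open>\<xi>\<close> other than 1 and isolates c.\<close>

lemma has_reg_unique_0:
  assumes X: "finite X" "1 \<in> X" and P: "P > 0" "\<And>\<xi>. \<xi> \<in> X \<Longrightarrow> \<xi> ^ P = 1"
    and f: "has_reg X (\<lambda>_. 0) c"
  shows "c = 0"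
proof -
  obtain K u where u: "c = u 0 0 1"
    "\<And>K'. K' \<ge> K \<Longrightarrow> (\<lambda>N. 0 - (\<Sum>l\<le>K'. \<Sum>m\<le>K'. \<Sum>\<xi>\<in>X. u l m \<xi> * \<xi> ^ N * log_scale l m N)) \<longlonglongrightarrow> 0"
    by (rule has_regE[OF f]) (rule that)
  from tendsto_minus[OF u(2)[OF order_refl]]
  have lim: "(\<lambda>N. \<Sum>l\<le>K. \<Sum>m\<le>K. \<Sum>\<xi>\<in>X. u l m \<xi> * \<xi> ^ N * log_scale l m N) \<longlonglongrightarrow> 0" by simp
  have z: "(\<Sum>\<xi>\<in>X. u 0 0 \<xi> * \<xi> ^ j) = 0" for j
  proof -
    define x where "x = (\<lambda>n. P * n + j)"
    have x: "filterlim x at_top sequentially"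
    proof (rule filterlim_at_top_mono[OF filterlim_ident])
      have "n \<le> x n" for n using P(1) by (cases P) (auto simp: x_def)
      then show "\<forall>\<^sub>F n in sequentially. n \<le> x n" by simp
    qed
    have pw: "\<xi> ^ x n = \<xi> ^ j" if "\<xi> \<in> X" for \<xi> n
      using P(2)[OF that] by (simp add: x_def power_add power_mult)
    from filterlim_compose[OF lim x]
    have "(\<lambda>n. \<Sum>l\<le>K. \<Sum>m\<le>K. \<Sum>\<xi>\<in>X. u l m \<xi> * \<xi> ^ x n * log_scale l m (x n)) \<longlonglongrightarrow> 0" .
    also have "(\<lambda>n. \<Sum>l\<le>K. \<Sum>m\<le>K. \<Sum>\<xi>\<in>X. u l m \<xi> * \<xi> ^ x n * log_scale l m (x n))
      = (\<lambda>n. \<Sum>m\<le>K. \<Sum>l\<le>K. (\<Sum>\<xi>\<in>X. u l m \<xi> * \<xi> ^ j) * log_scale l m (x n))"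
      by (subst sum.swap) (simp add: pw sum_distrib_right cong: sum.cong)
    finally show ?thesis using log_scale_tendsto_0_imp_coeff_0[OF x, where v = "\<lambda>l m. \<Sum>\<xi>\<in>X. u l m \<xi> * \<xi> ^ j" and L = K and M = K] by simp
  qed
  have g: "(\<Sum>j<P. \<xi> ^ j) = (if \<xi> = 1 then of_nat P else 0)" if "\<xi> \<in> X" for \<xi>
    using P(2)[OF that] geometric_sum[of \<xi> P] by auto
  have "0 = (\<Sum>j<P. \<Sum>\<xi>\<in>X. u 0 0 \<xi> * \<xi> ^ j)" by (simp add: z)
  also have "\<dots> = (\<Sum>\<xi>\<in>X. u 0 0 \<xi> * (\<Sum>j<P. \<xi> ^ j))" unfolding sum_distrib_left by (rule sum.swap)
  also have "\<dots> = (\<Sum>\<xi>\<in>X. if \<xi> = 1 then u 0 0 \<xi> * of_nat P else 0)" by (intro sum.cong refl) (simp add: g)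
  also have "\<dots> = u 0 0 1 * of_nat P" using X by simp
  finally show ?thesis using P(1) u(1) by simp
qed

lemma has_reg_unique:
  assumes X: "finite X" "1 \<in> X" and P: "P > 0" "\<And>\<xi>. \<xi> \<in> X \<Longrightarrow> \<xi> ^ P = 1"
    and f: "has_reg X f c" "has_reg X f d"
  shows "c = d"
  using has_reg_unique_0[OF X P, where c = "c - d"] has_reg_lincomb[OF f, of 1 "-1"] by simp

lemma common_order:
  fixes r :: nat
  assumes "\<forall>i<r. \<exists>m>0. z i ^ m = (1::complex)"
  obtains P :: nat where "P > 0" "\<And>i. i < r \<Longrightarrow> z i ^ P = 1"
proof -
  from assms have "\<forall>i. \<exists>m. i < r \<longrightarrow> m > 0 \<and> z i ^ m = 1" by blast
  from choice[OF this] obtain m where m: "\<And>i. i < r \<Longrightarrow> m i > (0::nat) \<and> z i ^ m i = 1" by blast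
  define P where "P = (\<Prod>i<r. m i)"
  have "P > 0" using m by (auto simp: P_def intro!: prod_pos)
  moreover have "z i ^ P = 1" if "i < r" for i
  proof -
    have "m i dvd P" unfolding P_def using that by (intro dvd_prodI) auto
    then obtain q where "P = m i * q" by (auto simp: dvd_def)
    then show ?thesis using m[OF that] by (simp add: power_mult)
  qed
  ultimately show ?thesis by (rule that)
qed

lemma monomial_vals_power:
  assumes "\<And>i. i < r \<Longrightarrow> z i ^ P = (1::complex)" "\<xi> \<in> monomial_vals r z"
  shows "\<xi> ^ P = 1"
proof -
  obtain m where \<xi>: "\<xi> = (\<Prod>i<r. z i ^ m i)" using assms(2) by (auto simp: monomial_vals_def)
  have "\<xi> ^ P = (\<Prod>i<r. (z i ^ P) ^ m i)" by (simp add: \<xi> prod_power_distrib power_mult[symmetric] mult.commute)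
  then show ?thesis using assms(1) by simp
qed

lemma finite_monomial_vals:
  assumes "P > 0" "\<And>i. i < r \<Longrightarrow> z i ^ P = (1::complex)"
  shows "finite (monomial_vals r z)"
proof (rule finite_subset)
  show "monomial_vals r z \<subseteq> {x. x ^ P = 1}" using monomial_vals_power[of r z P] assms(2) by blast
  show "finite {x :: complex. x ^ P = 1}" using finite_nth_roots[OF assms(1), of 1] by simp
qed

lemma one_in_monomial_vals: "1 \<in> monomial_vals r z"
  unfolding monomial_vals_def by (intro CollectI exI[of _ "\<lambda>_. 0"]) simp

lemma head_prod_in_monomial_vals: "i \<le> r \<Longrightarrow> head_prod i z \<in> monomial_vals r z"
proof -
  assume i: "i \<le> r"
  have "(\<Prod>t<r. z t ^ (if t < i then 1 else 0)) = (\<Prod>t<i. z t)"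
    by (rule prod.mono_neutral_cong_right) (use i in auto)
  then show ?thesis unfolding monomial_vals_def head_prod_def
    by (intro CollectI exI[of _ "\<lambda>t. if t < i then 1 else 0"]) simp
qed

section \<open>Restriction to lines through the integer point\<close>

lemma sum_homog_idx_Suc:
  fixes f :: "(nat \<Rightarrow> nat) \<Rightarrow> complex"
  shows "(\<Sum>k\<in>homog_idx (Suc r) m. f k) = (\<Sum>j\<le>m. \<Sum>k\<in>homog_idx r (m - j). f (k(r := j)))"
proof -
  have "(\<Sum>k\<in>homog_idx (Suc r) m. f k) = (\<Sum>(j, k)\<in>(SIGMA j:{..m}. homog_idx r (m - j)). f (k(r := j)))"
  proof (rule sum.reindex_bij_witness[where j = "\<lambda>k. (k r, k(r := 0))" and i = "\<lambda>(j, k). k(r := j)"])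
    show "(k r, k(r := 0)) \<in> (SIGMA j:{..m}. homog_idx r (m - j))" if "k \<in> homog_idx (Suc r) m" for k
      using that unfolding homog_idx_def multi_idx_def by (auto dest: le_neq_implies_less)
  qed (auto simp: homog_idx_def multi_idx_def fun_eq_iff)
  then show ?thesis by (simp add: sum.Sigma)
qed

text \<open>The multinomial theorem, obtained by comparing coefficients in the addition formula of
  the exponential series.\<close>

lemma multinomial_homog_idx:
  fixes x :: "nat \<Rightarrow> complex"
  shows "(\<Sum>k\<in>homog_idx r m. \<Prod>i<r. x i ^ k i / fact (k i)) = (\<Sum>i<r. x i) ^ m / fact m"
proof (induction r arbitrary: m)
  case 0
  have "homog_idx 0 m = (if m = 0 then {\<lambda>_. 0} else {})" by (auto simp: homog_idx_def multi_idx_def)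
  then show ?case by simp
next
  case (Suc r)
  have "(\<Sum>k\<in>homog_idx (Suc r) m. \<Prod>i<Suc r. x i ^ k i / fact (k i))
     = (\<Sum>j\<le>m. x r ^ j / fact j * (\<Sum>k\<in>homog_idx r (m - j). \<Prod>i<r. x i ^ k i / fact (k i)))"
    unfolding sum_homog_idx_Suc by (simp add: sum_distrib_left mult.commute)
  also have "\<dots> = (\<Sum>j\<le>m. fps_nth (fps_exp (x r)) j * fps_nth (fps_exp (\<Sum>i<r. x i)) (m - j))"
    by (simp add: Suc.IH)
  also have "\<dots> = fps_nth (fps_exp (x r) * fps_exp (\<Sum>i<r. x i)) m"
    by (simp add: fps_mult_nth atLeast0AtMost)
  also have "\<dots> = (\<Sum>i<Suc r. x i) ^ m / fact m"
    by (simp add: fps_exp_add_mult[symmetric] add.commute)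
  finally show ?case .
qed

section \<open>Lines transversal to the polar hyperplanes\<close>

definition int_point :: "nat \<Rightarrow> (nat \<Rightarrow> int) \<Rightarrow> nat \<Rightarrow> complex" where
  "int_point r a = (\<lambda>i. if i < r then of_int (a i) else 0)"

lemma int_point_cspace [simp]: "int_point r a \<in> cspace r"
  by (simp add: int_point_def cspace_def)

lemma seg_sum_int_point: "i \<le> r \<Longrightarrow> seg_sum j i (int_point r a) = of_int (\<Sum>t=j..<i. a t)"
  by (simp add: seg_sum_def int_point_def)

text \<open>For |t| < 2 a segment sum moves by less than 1/2, so the line through an integer point
  meets the polar hyperplanes at t = 0 only. Radius 2 leaves room for Cauchy estimates on |t| = 1
  and for evaluation at t = 1.\<close>

definition small_dir :: "nat \<Rightarrow> (nat \<Rightarrow> complex) \<Rightarrow> bool" where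
  "small_dir r w \<longleftrightarrow> w \<in> cspace r \<and> (\<forall>j i. j < i \<longrightarrow> i \<le> r \<longrightarrow> seg_sum j i w \<noteq> 0 \<and> cmod (seg_sum j i w) \<le> 1/4)"

lemma small_dirD: "small_dir r w \<Longrightarrow> j < i \<Longrightarrow> i \<le> r \<Longrightarrow> seg_sum j i w \<noteq> 0 \<and> cmod (seg_sum j i w) \<le> 1/4"
  by (simp add: small_dir_def)

lemma int_plus_small_notin_Ints:
  fixes x :: complex
  assumes "x \<noteq> 0" "cmod x < 1"
  shows "of_int n + x \<notin> \<int>"
proof
  assume "of_int n + x \<in> \<int>"
  then have "x \<in> \<int>" by (metis Ints_diff Ints_of_int add_diff_cancel_left')
  then obtain m where m: "x = of_int m" by (auto elim: Ints_cases)
  then have "\<bar>real_of_int m\<bar> < 1" using assms(2) by simp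
  then show False using assms(1) m by simp
qed

lemma small_dir_generic:
  assumes w: "small_dir r w" and t: "t \<noteq> 0" "cmod t < 2"
  shows "cline (int_point r a) w t \<in> generic r"
  unfolding generic_def
proof (intro CollectI conjI allI impI)
  show "cline (int_point r a) w t \<in> cspace r" using w by (auto simp: small_dir_def)
  fix j i assume ji: "j < i" "i \<le> r"
  have "cmod (t * seg_sum j i w) \<le> 2 * (1/4)"
    unfolding norm_mult using small_dirD[OF w ji] t by (intro mult_mono) auto
  then have "of_int (\<Sum>t=j..<i. a t) + t * seg_sum j i w \<notin> \<int>"
    using small_dirD[OF w ji] t by (intro int_plus_small_notin_Ints) auto
  then show "seg_sum j i (cline (int_point r a) w t) \<notin> \<int>"
    using ji by (simp add: seg_sum_cline seg_sum_int_point)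
qed

text \<open>The zero at t = 0 is simple because l is nonzero, and no other integer is within reach;
  g is the difference quotient with its removable singularity filled in.\<close>

lemma sin_line_factor:
  fixes l :: complex
  assumes l: "l \<noteq> 0" "cmod l \<le> 1/4"
  shows "\<exists>g. g holomorphic_on ball 0 2 \<and> (\<forall>t\<in>ball 0 2. g t \<noteq> 0 \<and> sin (of_real pi * (of_int n + t * l)) = t * g t)"
proof -
  define f where "f = (\<lambda>t. sin (of_real pi * (of_int n + t * l)))"
  define g where "g = (\<lambda>t. if t = 0 then deriv f 0 else (f t - f 0) / (t - 0))"
  have "sin (of_real pi * of_int n :: complex) = 0" using sin_pi_eq_0_iff[of "of_int n"] by simp
  then have f0: "f 0 = 0" by (simp add: f_def)
  have "g holomorphic_on ball 0 2" unfolding g_def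
    by (rule pole_lemma_open) (auto simp: f_def intro!: holomorphic_intros)
  moreover have "g t \<noteq> 0 \<and> f t = t * g t" if t: "t \<in> ball 0 2" for t
  proof (cases "t = 0")
    case True
    have "(f has_field_derivative (cos (of_real pi * (of_int n + 0 * l)) * (of_real pi * l))) (at 0)"
      unfolding f_def by (auto intro!: derivative_eq_intros)
    then have "deriv f 0 = cos (of_real pi * of_int n) * (of_real pi * l)" by (simp add: DERIV_imp_deriv)
    moreover have "cos (of_real pi * of_int n :: complex) \<noteq> 0"
      using sin_cos_squared_add[of "of_real pi * of_int n :: complex"] \<open>sin (of_real pi * of_int n) = 0\<close> by auto
    ultimately show ?thesis using True l f0 by (simp add: g_def)
  next
    case False
    have "cmod (t * l) \<le> 2 * (1/4)" unfolding norm_mult using t l by (intro mult_mono) auto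
    then have "of_int n + t * l \<notin> \<int>" using False l by (intro int_plus_small_notin_Ints) auto
    then have "f t \<noteq> 0" unfolding f_def using sin_pi_eq_0_iff by blast
    then show ?thesis using False f0 by (simp add: g_def)
  qed
  ultimately show ?thesis by (auto simp: f_def)
qed

text \<open>Each segment contributes one simple zero at t = 0, so D is the number of
  segments.\<close>

lemma polar_line_factor:
  assumes w: "small_dir r w"
  obtains D h where "h holomorphic_on ball 0 2" "\<And>t. t \<in> ball 0 2 \<Longrightarrow> h t \<noteq> 0"
    "\<And>t. t \<in> ball 0 2 \<Longrightarrow> polar r (cline (int_point r a) w t) = t ^ D * h t"
proof -
  have "\<forall>x. \<exists>g. x \<in> seg_pairs r \<longrightarrow> g holomorphic_on ball 0 2 \<and> (\<forall>t\<in>ball 0 2. g t \<noteq> 0 \<and>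
     sin (of_real pi * (of_int (\<Sum>t=fst x..<snd x. a t) + t * seg_sum (fst x) (snd x) w)) = t * g t)"
  proof
    fix x
    show "\<exists>g. x \<in> seg_pairs r \<longrightarrow> g holomorphic_on ball 0 2 \<and> (\<forall>t\<in>ball 0 2. g t \<noteq> 0 \<and>
     sin (of_real pi * (of_int (\<Sum>t=fst x..<snd x. a t) + t * seg_sum (fst x) (snd x) w)) = t * g t)"
    proof (cases "x \<in> seg_pairs r")
      case True
      then have "fst x < snd x" "snd x \<le> r" by (auto simp: seg_pairs_def)
      from small_dirD[OF w this] sin_line_factor[of "seg_sum (fst x) (snd x) w" "\<Sum>t=fst x..<snd x. a t"]
      show ?thesis by blast
    qed simp
  qed
  from choice[OF this] obtain g where g: "\<And>x. x \<in> seg_pairs r \<Longrightarrow> g x holomorphic_on ball 0 2"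
    "\<And>x t. x \<in> seg_pairs r \<Longrightarrow> t \<in> ball 0 2 \<Longrightarrow> g x t \<noteq> 0"
    "\<And>x t. x \<in> seg_pairs r \<Longrightarrow> t \<in> ball 0 2 \<Longrightarrow>
       sin (of_real pi * (of_int (\<Sum>t=fst x..<snd x. a t) + t * seg_sum (fst x) (snd x) w)) = t * g x t"
    by blast
  show ?thesis
  proof (rule that[of "\<lambda>t. \<Prod>x\<in>seg_pairs r. g x t" "card (seg_pairs r)"])
    show "(\<lambda>t. \<Prod>x\<in>seg_pairs r. g x t) holomorphic_on ball 0 2" by (intro holomorphic_on_prod g)
    fix t :: complex assume t: "t \<in> ball 0 2"
    show "(\<Prod>x\<in>seg_pairs r. g x t) \<noteq> 0" using g(2)[OF _ t] by simp
    have "polar r (cline (int_point r a) w t) = (\<Prod>x\<in>seg_pairs r. t * g x t)"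
      unfolding polar_def case_prod_beta
    proof (rule prod.cong[OF refl])
      fix x assume x: "x \<in> seg_pairs r"
      then have "snd x \<le> r" by (auto simp: seg_pairs_def)
      then show "sin (of_real pi * seg_sum (fst x) (snd x) (cline (int_point r a) w t)) = t * g x t"
        using g(3)[OF x t] by (simp add: seg_sum_cline seg_sum_int_point)
    qed
    then show "polar r (cline (int_point r a) w t) = t ^ card (seg_pairs r) * (\<Prod>x\<in>seg_pairs r. g x t)"
      by (simp add: prod.distrib)
  qed
qed

lemma extends_holo_line:
  assumes f: "extends_holo r f" and w: "small_dir r w"
  shows "\<exists>\<phi>. \<phi> holomorphic_on ball 0 2 \<and> (\<forall>t. t \<noteq> 0 \<longrightarrow> cmod t < 2 \<longrightarrow> \<phi> t = f (cline (int_point r a) w t))"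
proof -
  let ?p = "int_point r a"
  define B where "B = 1 + (\<Sum>i<r. cmod (?p i) + 2 * cmod (w i))"
  have wc: "w \<in> cspace r" using w by (simp add: small_dir_def)
  have inB: "cline ?p w t \<in> polydisc r (\<lambda>_. 0) B" if t: "cmod t < 2" for t
    unfolding polydisc_iff
  proof (intro conjI allI impI)
    show "cline ?p w t \<in> cspace r" using wc by (intro cline_in_cspace) auto
    fix i assume i: "i < r"
    have "cmod (cline ?p w t i) \<le> cmod (?p i) + cmod t * cmod (w i)"
      unfolding cline_def by (metis norm_triangle_ineq norm_mult)
    also have "\<dots> \<le> cmod (?p i) + 2 * cmod (w i)" using t by (intro add_left_mono mult_right_mono) auto
    also have "\<dots> \<le> (\<Sum>i<r. cmod (?p i) + 2 * cmod (w i))" using i by (intro member_le_sum) auto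
    finally show "cmod (cline ?p w t i - 0) < B" by (simp add: B_def)
  qed
  obtain g where g: "bdd_gateaux r (polydisc r (\<lambda>_. 0) B) g" "\<forall>s\<in>generic r \<inter> polydisc r (\<lambda>_. 0) B. g s = f s"
    using f unfolding extends_holo_def by blast
  have "(\<lambda>t. g (cline ?p w t)) holomorphic_on ball 0 2"
    by (rule holomorphic_on_subset[OF bdd_gateaux_line_holomorphic[OF g(1) int_point_cspace wc]]) (use inB in auto)
  moreover have "g (cline ?p w t) = f (cline ?p w t)" if "t \<noteq> 0" "cmod t < 2" for t
    using g(2) small_dir_generic[OF w that] inB[OF that(2)] by blast
  ultimately show ?thesis by blast
qed

text \<open>The origin of the logarithms: on the line the non-integral part of a power is an
  exponential in t, whose Taylor coefficients are powers of log n.\<close>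

lemma powr_line_eq:
  fixes t \<delta> :: complex
  assumes "n \<ge> 1"
  shows "of_nat n powr (- (of_int m + t * \<delta>)) = of_nat n powi (- m) * exp (- (\<delta> * of_real (ln (real n))) * t)"
proof -
  have "of_nat n powr (- (of_int m + t * \<delta>)) = of_nat n powr of_int (- m) * of_nat n powr (- (t * \<delta>))"
  proof -
    have "- (of_int m + t * \<delta>) = of_int (- m) + - (t * \<delta>)" by simp
    then show ?thesis by (simp only: powr_add)
  qed
  also have "of_nat n powr of_int (- m) = (of_nat n powi (- m) :: complex)"
    using assms by (subst complex_powr_of_int) auto
  also have "of_nat n powr (- (t * \<delta>)) = exp (- (\<delta> * of_real (ln (real n))) * t)"
    using assms by (simp add: powr_def Ln_of_nat mult_ac)
  finally show ?thesis .
qed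

section \<open>Taylor coefficients along a line\<close>

definition log_coeff :: "nat \<Rightarrow> (nat \<Rightarrow> complex) \<Rightarrow> (nat \<Rightarrow> int) \<Rightarrow> (nat \<Rightarrow> complex) \<Rightarrow> nat \<Rightarrow> nat \<Rightarrow> complex" where
  "log_coeff r z a w N m = (\<Sum>k\<in>homog_idx r m. (-1) ^ m / (\<Prod>i<r. fact (k i)) * (\<Prod>i<r. w i ^ k i) * partial_sum r z a k N)"

lemma nested_psum_line:
  "nested_psum r z N (cline (int_point r a) w t) =
     (\<Sum>n\<in>trunc_tuples r N. (\<Prod>i<r. z i ^ n i * of_nat (n i) powi (- a i)) *
        exp (- (\<Sum>i<r. w i * of_real (ln (real (n i)))) * t))"
  unfolding nested_psum_eq_trunc
proof (rule sum.cong[OF refl])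
  fix n assume n: "n \<in> trunc_tuples r N"
  have "(\<Prod>i<r. z i ^ n i * of_nat (n i) powr (- cline (int_point r a) w t i)) =
     (\<Prod>i<r. z i ^ n i * of_nat (n i) powi (- a i) * exp (- (w i * of_real (ln (real (n i)))) * t))"
  proof (rule prod.cong[OF refl])
    fix i assume i: "i \<in> {..<r}"
    then have "n i \<ge> 1" using n by (auto simp: trunc_tuples_def decr_tuples_def Suc_le_eq)
    from powr_line_eq[OF this, of "a i" t "w i"] i
    show "z i ^ n i * of_nat (n i) powr (- cline (int_point r a) w t i) = z i ^ n i * of_nat (n i) powi (- a i) * exp (- (w i * of_real (ln (real (n i)))) * t)"
      by (simp add: cline_def int_point_def)
  qed
  also have "\<dots> = (\<Prod>i<r. z i ^ n i * of_nat (n i) powi (- a i)) * exp (- (\<Sum>i<r. w i * of_real (ln (real (n i)))) * t)"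
    by (simp only: prod.distrib exp_sum[symmetric, OF finite_lessThan] sum_distrib_right[symmetric] sum_negf)
  finally show "(\<Prod>i<r. z i ^ n i * of_nat (n i) powr (- cline (int_point r a) w t i)) = \<dots>" .
qed

lemma nested_psum_line_fps:
  "(\<lambda>t. nested_psum r z N (cline (int_point r a) w t)) has_fps_expansion Abs_fps (log_coeff r z a w N)"
proof -
  define A where "A = (\<lambda>n :: nat \<Rightarrow> nat. \<Prod>i<r. z i ^ n i * of_nat (n i) powi (- a i))"
  define c where "c = (\<lambda>n :: nat \<Rightarrow> nat. - (\<Sum>i<r. w i * complex_of_real (ln (real (n i)))))"
  have "(\<lambda>t. \<Sum>n\<in>trunc_tuples r N. A n * exp (c n * t)) has_fps_expansion (\<Sum>n\<in>trunc_tuples r N. fps_const (A n) * fps_exp (c n))"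
    by (intro fps_expansion_intros)
  moreover have "(\<Sum>n\<in>trunc_tuples r N. fps_const (A n) * fps_exp (c n)) = Abs_fps (log_coeff r z a w N)"
  proof (rule fps_ext)
    fix m
    have mn: "c n ^ m / fact m = (\<Sum>k\<in>homog_idx r m. (-1) ^ m / (\<Prod>i<r. fact (k i)) * (\<Prod>i<r. w i ^ k i) * (\<Prod>i<r. of_real (ln (real (n i))) ^ k i))" for n
    proof -
      have "c n = (\<Sum>i<r. - w i * complex_of_real (ln (real (n i))))" by (simp add: c_def sum_negf)
      then have "c n ^ m / fact m = (\<Sum>k\<in>homog_idx r m. \<Prod>i<r. (- w i * complex_of_real (ln (real (n i)))) ^ k i / fact (k i))"
        by (simp only: multinomial_homog_idx)
      also have "\<dots> = (\<Sum>k\<in>homog_idx r m. (-1) ^ m / (\<Prod>i<r. fact (k i)) * (\<Prod>i<r. w i ^ k i) * (\<Prod>i<r. of_real (ln (real (n i))) ^ k i))"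
      proof (rule sum.cong[OF refl])
        fix k assume k: "k \<in> homog_idx r m"
        have "(\<Prod>i<r. (- w i * complex_of_real (ln (real (n i)))) ^ k i / fact (k i))
          = (\<Prod>i<r. ((-1) * (w i * complex_of_real (ln (real (n i))))) ^ k i) / (\<Prod>i<r. fact (k i))"
          by (simp add: prod_dividef)
        also have "(\<Prod>i<r. ((-1) * (w i * complex_of_real (ln (real (n i))))) ^ k i) = (-1) ^ m * (\<Prod>i<r. (w i * complex_of_real (ln (real (n i)))) ^ k i)"
          by (rule prod_power_homog_idx[OF k])
        finally show "(\<Prod>i<r. (- w i * complex_of_real (ln (real (n i)))) ^ k i / fact (k i)) =
           (-1) ^ m / (\<Prod>i<r. fact (k i)) * (\<Prod>i<r. w i ^ k i) * (\<Prod>i<r. of_real (ln (real (n i))) ^ k i)"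
          by (simp add: power_mult_distrib prod.distrib)
      qed
      finally show ?thesis .
    qed
    have "fps_nth (\<Sum>n\<in>trunc_tuples r N. fps_const (A n) * fps_exp (c n)) m = (\<Sum>n\<in>trunc_tuples r N. A n * (c n ^ m / fact m))"
      by (simp add: fps_sum_nth)
    also have "\<dots> = (\<Sum>k\<in>homog_idx r m. \<Sum>n\<in>trunc_tuples r N. A n * ((-1) ^ m / (\<Prod>i<r. fact (k i)) * (\<Prod>i<r. w i ^ k i) * (\<Prod>i<r. of_real (ln (real (n i))) ^ k i)))"
      unfolding mn sum_distrib_left by (rule sum.swap)
    also have "\<dots> = log_coeff r z a w N m"
      unfolding log_coeff_def partial_sum_def sum_distrib_left A_def
      by (intro sum.cong refl) (simp add: prod.distrib mult_ac)
    finally show "fps_nth (\<Sum>n\<in>trunc_tuples r N. fps_const (A n) * fps_exp (c n)) m = fps_nth (Abs_fps (log_coeff r z a w N)) m" by simp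
  qed
  moreover have "(\<lambda>t. nested_psum r z N (cline (int_point r a) w t)) = (\<lambda>t. \<Sum>n\<in>trunc_tuples r N. A n * exp (c n * t))"
    by (simp add: nested_psum_line A_def c_def)
  ultimately show ?thesis by simp
qed

lemma nested_psum_line_holomorphic:
  "(\<lambda>t. nested_psum r z N (cline (int_point r a) w t)) holomorphic_on S"
  unfolding nested_psum_line by (intro holomorphic_intros)

text \<open>The Taylor coefficient is a polynomial in log N with constant term
  \<open>fps_nth \<Gamma> n\<close>. After multiplication by \<open>\<xi> ^ N\<close> and N^(-e) it
  can meet the constant sequence only if e = 0 and \<open>\<xi>\<close> = 1; for e > 0 everything
  tends to 0.\<close>

lemma has_reg_fps_term:
  assumes \<xi>: "\<xi> \<in> X" "cmod \<xi> = 1" and X: "finite X"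
  shows "has_reg X (\<lambda>N. \<xi> ^ N * of_nat N powi (- e) * fps_nth (\<Gamma> * fps_exp (- (\<delta> * of_real (ln (real N))))) n)
     (if e = 0 \<and> \<xi> = 1 then fps_nth \<Gamma> n else 0)"
proof -
  define A where "A = (\<lambda>j. fps_nth \<Gamma> j * (- \<delta>) ^ (n - j) / fact (n - j))"
  have cf: "fps_nth (\<Gamma> * fps_exp (- (\<delta> * of_real (ln (real N))))) n = (\<Sum>j\<le>n. A j * of_real (ln (real N)) ^ (n - j))" for N
  proof -
    have "(- (\<delta> * complex_of_real (ln (real N)))) ^ q = (- \<delta>) ^ q * of_real (ln (real N)) ^ q" for q
      by (metis minus_mult_left power_mult_distrib)
    then show ?thesis by (simp add: fps_mult_nth A_def atLeast0AtMost mult.assoc)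
  qed
  have eq: "(\<lambda>N. \<xi> ^ N * of_nat N powi (- e) * fps_nth (\<Gamma> * fps_exp (- (\<delta> * of_real (ln (real N))))) n)
     = (\<lambda>N. \<Sum>j\<le>n. A j * (\<xi> ^ N * (of_real (ln (real N)) ^ (n - j) * of_nat N powi (- e))))"
    unfolding cf sum_distrib_left by (simp add: mult_ac)
  show ?thesis
  proof (cases "e \<le> 0")
    case True
    then have pw: "of_nat N powi (- e) = (of_nat N ^ nat (- e) :: complex)" for N by (simp add: power_int_def)
    have "has_reg X (\<lambda>N. \<Sum>j\<le>n. A j * (\<xi> ^ N * log_scale (n - j) (nat (- e)) N))
      (\<Sum>j\<le>n. A j * (if n - j = 0 \<and> nat (- e) = 0 \<and> \<xi> = 1 then 1 else 0))"
      by (intro has_reg_sum has_reg_cmult has_reg_basis \<xi> X)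
    also have "(\<Sum>j\<le>n. A j * (if n - j = 0 \<and> nat (- e) = 0 \<and> \<xi> = 1 then 1 else 0)) = (\<Sum>j\<le>n. if j = n then (if e = 0 \<and> \<xi> = 1 then A n else 0) else 0)"
      using True by (intro sum.cong) auto
    also have "\<dots> = (if e = 0 \<and> \<xi> = 1 then fps_nth \<Gamma> n else 0)" by (simp add: A_def)
    finally show ?thesis unfolding eq unfolding pw log_scale_def .
  next
    case False
    then have pw: "of_nat N powi (- e) = (inverse (of_nat N) ^ nat e :: complex)" for N by (simp add: power_int_def)
    have "(\<lambda>N. \<Sum>j\<le>n. A j * (\<xi> ^ N * (of_real (ln (real N)) ^ (n - j) * inverse (of_nat N) ^ nat e))) \<longlonglongrightarrow> (\<Sum>j\<le>n. A j * 0)"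
    proof (intro tendsto_sum tendsto_mult tendsto_const)
      fix j
      have "(\<lambda>N. complex_of_real (ln (real N)) ^ (n - j) * inverse (of_nat N) ^ nat e) \<longlonglongrightarrow> 0"
        using log_power_over_power[of "\<lambda>n. n" "nat e" "n - j"] False by (simp add: filterlim_ident)
      from tendsto_norm_zero[OF this]
      have "(\<lambda>N. norm (\<xi> ^ N * (complex_of_real (ln (real N)) ^ (n - j) * inverse (of_nat N) ^ nat e))) \<longlonglongrightarrow> 0"
        unfolding norm_mult[of "\<xi> ^ _"] norm_power[of \<xi>] \<xi>(2) by simp
      then show "(\<lambda>N. \<xi> ^ N * (complex_of_real (ln (real N)) ^ (n - j) * inverse (of_nat N) ^ nat e)) \<longlonglongrightarrow> 0"
        by (rule tendsto_norm_zero_cancel)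
    qed
    then have "has_reg X (\<lambda>N. \<Sum>j\<le>n. A j * (\<xi> ^ N * (of_real (ln (real N)) ^ (n - j) * inverse (of_nat N) ^ nat e))) 0"
      by (intro has_reg_null) simp
    then show ?thesis unfolding eq unfolding pw using False by simp
  qed
qed

text \<open>The terms whose power of N has exponent 0 at s = a. The equation becomes the summation
  condition in the coefficients C_i.\<close>

definition sel_idx :: "nat \<Rightarrow> (nat \<Rightarrow> complex) \<Rightarrow> (nat \<Rightarrow> int) \<Rightarrow> (nat \<Rightarrow> nat) set" where
  "sel_idx i z a = {k. (\<forall>j\<ge>i. k j = 0) \<and> (\<Sum>t<i. a t) + tail_exp i z k = 0}"

definition Li_reg :: "nat \<Rightarrow> (nat \<Rightarrow> complex) \<Rightarrow> (nat \<Rightarrow> int) \<Rightarrow> (nat \<Rightarrow> complex) \<Rightarrow> complex" where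
  "Li_reg r z a s = (\<Sum>i\<le>r. if head_prod i z = 1 then
     Li_cont (r - i) (shiftn i z) (shiftn i s) * (\<Sum>k\<in>sel_idx i z a. tail_coeff i z s k) else 0)"

lemma sel_idx_subset_box:
  assumes "i \<le> r" "int K \<ge> int r + (\<Sum>t<r. \<bar>a t\<bar>)"
  shows "sel_idx i z a \<subseteq> idx_box i K"
proof
  fix k assume k: "k \<in> sel_idx i z a"
  have "k j \<le> K" if j: "j < i" for j
  proof -
    have "tail_exp i z k \<ge> int (k j) - int i" by (rule tail_exp_ge[OF j])
    moreover have "\<bar>\<Sum>t<i. a t\<bar> \<le> (\<Sum>t<r. \<bar>a t\<bar>)"
    proof -
      have "\<bar>\<Sum>t<i. a t\<bar> \<le> (\<Sum>t<i. \<bar>a t\<bar>)" by (rule sum_abs)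
      also have "\<dots> \<le> (\<Sum>t<r. \<bar>a t\<bar>)" using assms(1) by (intro sum_mono2) auto
      finally show ?thesis .
    qed
    moreover have "(\<Sum>t<i. a t) + tail_exp i z k = 0" using k by (simp add: sel_idx_def)
    ultimately show ?thesis using assms by linarith
  qed
  then show "k \<in> idx_box i K" using k by (auto simp: idx_box_def sel_idx_def)
qed

lemma sel_idx_eq_box:
  assumes "i \<le> r" "int K \<ge> int r + (\<Sum>t<r. \<bar>a t\<bar>)"
  shows "sel_idx i z a = {k \<in> idx_box i K. (\<Sum>t<i. a t) + tail_exp i z k = 0}"
  using sel_idx_subset_box[OF assms, of z] by (auto simp: sel_idx_def idx_box_def)

lemma finite_sel_idx [simp, intro]: "finite (sel_idx i z a)"
proof (rule finite_subset)
  show "sel_idx i z a \<subseteq> idx_box i (nat (int i + (\<Sum>t<i. \<bar>a t\<bar>)))"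
    by (rule sel_idx_subset_box[OF order_refl]) (simp add: sum_nonneg)
qed simp

text \<open>Restricted to a line through the integer point, all poles sit at \<open>t = 0\<close> and
  \<open>t ^ D\<close> clears them. The coefficients of negative degree vanish because the partial sums are
  entire and asymptotic expansions are unique.\<close>

lemma line_regularization:
  assumes P: "P > 0" "\<forall>i<r. z i ^ P = 1" and w: "small_dir r w"
  shows "\<exists>c. (\<forall>n. has_reg (monomial_vals r z) (\<lambda>N. log_coeff r z a w N n) (c n)) \<and>
     (\<forall>t. t \<noteq> 0 \<longrightarrow> cmod t < 2 \<longrightarrow> (\<lambda>n. c n * t ^ n) sums Li_reg r z a (cline (int_point r a) w t))"
proof -
  define X where "X = monomial_vals r z"
  have X: "finite X" "1 \<in> X" "\<And>\<xi>. \<xi> \<in> X \<Longrightarrow> \<xi> ^ P = 1"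
  proof -
    show "finite X" unfolding X_def by (rule finite_monomial_vals) (use P in auto)
    show "1 \<in> X" unfolding X_def by (rule one_in_monomial_vals)
    show "\<xi> ^ P = 1" if "\<xi> \<in> X" for \<xi>
      using that unfolding X_def by (intro monomial_vals_power[of r z P \<xi>]) (use P in auto)
  qed
  have X1: "cmod \<xi> = 1" if "\<xi> \<in> X" for \<xi>
    using power_eq_1_iff[OF X(3)[OF that]] P(1) by simp
  have zn: "\<forall>i<r. cmod (z i) = 1" using P power_eq_1_iff[of "z _" P] by blast
  define cs where "cs = cline (int_point r a) w"
  have gen: "cs t \<in> generic r" if "t \<noteq> 0" "cmod t < 2" for t
    unfolding cs_def by (rule small_dir_generic[OF w that])
  obtain D h where h: "h holomorphic_on ball 0 2" "\<And>t. t \<in> ball 0 2 \<Longrightarrow> h t \<noteq> 0"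
    "\<And>t. t \<in> ball 0 2 \<Longrightarrow> polar r (cs t) = t ^ D * h t"
    by (rule polar_line_factor[OF w, where a = a, folded cs_def]) (rule that)
  define B where "B = 1 + (\<Sum>i<r. cmod (int_point r a i) + cmod (w i))"
  have inB: "cs t \<in> polydisc r (\<lambda>_. 0) B" if t: "cmod t = 1" for t
    unfolding polydisc_iff
  proof (intro conjI allI impI)
    show "cs t \<in> cspace r" using gen[of t] t generic_subset_cspace[of r] by force
    fix i assume i: "i < r"
    have "cmod (cs t i) \<le> cmod (int_point r a i) + cmod t * cmod (w i)"
      unfolding cs_def cline_def by (metis norm_triangle_ineq norm_mult)
    also have "\<dots> = cmod (int_point r a i) + cmod (w i)" using t by simp
    also have "\<dots> \<le> (\<Sum>i<r. cmod (int_point r a i) + cmod (w i))" using i by (intro member_le_sum) auto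
    finally show "cmod (cs t i - 0) < B" by (simp add: B_def)
  qed
  obtain K0 where K0: "\<And>K. K \<ge> K0 \<Longrightarrow> decays (generic r \<inter> polydisc r (\<lambda>_. 0) B) 1 (\<lambda>N s. polar r s * Li_remainder r K z N s)"
    using Li_expansion_holds[of r] zn unfolding Li_expansion_def by blast
  \<comment> \<open>Large enough for the remainder estimate and for every selected index to lie
    inside the truncation boxes.\<close>
  define K where "K = max K0 (nat (int r + (\<Sum>t<r. \<bar>a t\<bar>)))"
  have KK: "int K \<ge> int r + (\<Sum>t<r. \<bar>a t\<bar>)" unfolding K_def by linarith
  have "K \<ge> K0" by (simp add: K_def)
  from K0[OF this] obtain C where C: "\<And>s N. s \<in> generic r \<inter> polydisc r (\<lambda>_. 0) B \<Longrightarrow> N \<ge> 1 \<Longrightarrow>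
     cmod (polar r s * Li_remainder r K z N s) \<le> C / real N ^ 1"
    unfolding decays_def by blast
  define T where "T = (SIGMA i:{..r}. idx_box i K)"
  have fT: "finite T" unfolding T_def by blast
  define e where "e = (\<lambda>(i, k). (\<Sum>t<i. a t) + tail_exp i z k)"
  define \<xi> where "\<xi> = (\<lambda>p :: nat \<times> (nat \<Rightarrow> nat). head_prod (fst p) z)"
  define \<delta> where "\<delta> = (\<lambda>p :: nat \<times> (nat \<Rightarrow> nat). seg_sum 0 (fst p) w)"
  define LT where "LT = (\<lambda>(i, k) s. Li_cont (r - i) (shiftn i z) (shiftn i s) * tail_coeff i z s k)"
  have "\<forall>p. \<exists>\<phi>. p \<in> T \<longrightarrow> \<phi> holomorphic_on ball 0 2 \<and> (\<forall>t. t \<noteq> 0 \<longrightarrow> cmod t < 2 \<longrightarrow> \<phi> t = polar r (cs t) * LT p (cs t))"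
  proof
    fix p
    show "\<exists>\<phi>. p \<in> T \<longrightarrow> \<phi> holomorphic_on ball 0 2 \<and> (\<forall>t. t \<noteq> 0 \<longrightarrow> cmod t < 2 \<longrightarrow> \<phi> t = polar r (cs t) * LT p (cs t))"
    proof (cases "p \<in> T")
      case True
      obtain i k where p: "p = (i, k)" by fastforce
      have i: "i \<le> r" using True p by (simp add: T_def)
      have "\<forall>j<r - i. cmod (shiftn i z j) = 1" using zn i by (simp add: shiftn_def)
      then have "extends_holo (r - i) (\<lambda>s. polar (r - i) s * Li_cont (r - i) (shiftn i z) s)"
        using Li_expansion_holds[of "r - i"] unfolding Li_expansion_def by blast
      from extends_holo_polar_Li_tail[OF this i, of z k]
      have "extends_holo r (\<lambda>s. polar r s * LT p s)" unfolding LT_def p by simp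
      from extends_holo_line[OF this w, of a] show ?thesis unfolding cs_def by blast
    qed simp
  qed
  from choice[OF this] obtain G where G: "\<And>p. p \<in> T \<Longrightarrow> G p holomorphic_on ball 0 2"
    "\<And>p t. p \<in> T \<Longrightarrow> t \<noteq> 0 \<Longrightarrow> cmod t < 2 \<Longrightarrow> G p t = polar r (cs t) * LT p (cs t)" by blast
  \<comment> \<open>Dividing by the zero-free factor \<open>h\<close> replaces \<open>polar\<close>
    by its power \<open>t ^ D\<close>, so all terms share a monomial denominator.\<close>
  define Q where "Q = (\<lambda>p t. G p t / h t)"
  have Qh: "Q p holomorphic_on ball 0 2" if "p \<in> T" for p
    unfolding Q_def using G(1)[OF that] h by (intro holomorphic_intros) auto
  define \<Gamma> where "\<Gamma> = (\<lambda>p. fps_expansion (Q p) 0)"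
  have Qf: "Q p has_fps_expansion \<Gamma> p" if "p \<in> T" for p
    unfolding \<Gamma>_def by (rule has_fps_expansion_fps_expansion[OF _ _ Qh[OF that]]) auto
  have Qt: "Q p t = t ^ D * LT p (cs t)" if "p \<in> T" "t \<noteq> 0" "cmod t < 2" for p t
    using G(2)[OF that] h(2,3)[of t] that(3) by (simp add: Q_def field_simps)
  define cst where "cst = (\<lambda>p N. \<xi> p ^ N * of_nat N powi (- e p) :: complex)"
  \<comment> \<open>Off t = 0 this is \<open>t ^ D\<close> times the remainder; written through
    \<open>Q\<close> it is holomorphic at t = 0 as well.\<close>
  define \<rho> where "\<rho> = (\<lambda>N t. t ^ D * nested_psum r z N (cs t) - (\<Sum>p\<in>T. cst p N * (Q p t * exp (- (\<delta> p * of_real (ln (real N))) * t))))"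
  have \<rho>_eq: "\<rho> N t = t ^ D * Li_remainder r K z N (cs t)" if N: "N \<ge> 1" and t: "t \<noteq> 0" "cmod t < 2" for N t
  proof -
    have ts: "tail_sum i K z N (cs t) = (\<Sum>k\<in>idx_box i K. cst (i, k) N * (tail_coeff i z (cs t) k * exp (- (\<delta> (i, k) * of_real (ln (real N))) * t)))"
      if i: "i \<le> r" for i
    proof -
      have pw: "of_nat N powr (- (seg_sum 0 i (cs t) + of_int (tail_exp i z k))) = of_nat N powi (- e (i, k)) * exp (- (\<delta> (i, k) * of_real (ln (real N))) * t)" for k
      proof -
        have "seg_sum 0 i (cs t) + of_int (tail_exp i z k) = of_int (e (i, k)) + t * \<delta> (i, k)"
          using i by (simp add: cs_def seg_sum_cline seg_sum_int_point e_def \<delta>_def lessThan_atLeast0)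
        then show ?thesis using powr_line_eq[OF N, of "e (i, k)" t "\<delta> (i, k)"] by simp
      qed
      show ?thesis unfolding tail_sum_def pw sum_distrib_left cst_def \<xi>_def by (simp add: mult_ac)
    qed
    have "(\<Sum>p\<in>T. cst p N * (Q p t * exp (- (\<delta> p * of_real (ln (real N))) * t)))
      = (\<Sum>p\<in>T. t ^ D * (LT p (cs t) * (cst p N * exp (- (\<delta> p * of_real (ln (real N))) * t))))"
      by (intro sum.cong refl) (simp add: Qt t)
    also have "\<dots> = (\<Sum>i\<le>r. \<Sum>k\<in>idx_box i K. t ^ D * (LT (i, k) (cs t) * (cst (i, k) N * exp (- (\<delta> (i, k) * of_real (ln (real N))) * t))))"
      unfolding T_def by (subst sum.Sigma) auto
    also have "\<dots> = (\<Sum>i\<le>r. t ^ D * (Li_cont (r - i) (shiftn i z) (shiftn i (cs t)) * tail_sum i K z N (cs t)))"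
      by (intro sum.cong refl) (simp add: ts LT_def sum_distrib_left mult_ac)
    finally show ?thesis unfolding \<rho>_def Li_remainder_def right_diff_distrib sum_distrib_left by simp
  qed
  have \<rho>_hol: "\<rho> N holomorphic_on ball 0 2" for N
    unfolding \<rho>_def cs_def by (intro holomorphic_intros nested_psum_line_holomorphic holomorphic_on_sum Qh)
  \<comment> \<open>The remainder estimate contains \<open>polar\<close>, that is
    \<open>t ^ D * h t\<close>; a lower bound for \<open>h\<close> on the unit circle converts it
    into one for \<open>\<rho>\<close>.\<close>
  obtain \<mu> where \<mu>: "\<mu> > 0" "\<And>t. cmod t = 1 \<Longrightarrow> cmod (h t) \<ge> \<mu>"
  proof -
    have "continuous_on (sphere 0 1) (\<lambda>t. cmod (h t))"
      by (intro continuous_intros holomorphic_on_imp_continuous_on holomorphic_on_subset[OF h(1)]) auto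
    moreover have "sphere (0::complex) 1 \<noteq> {}" by (auto intro!: exI[of _ 1])
    ultimately obtain t0 where t0: "t0 \<in> sphere 0 1" "\<And>t. t \<in> sphere 0 1 \<Longrightarrow> cmod (h t0) \<le> cmod (h t)"
      using continuous_attains_inf[OF compact_sphere] by blast
    show ?thesis
      by (rule that[of "cmod (h t0)"]) (use t0 h(2)[of t0] in auto)
  qed
  have \<rho>_bound: "cmod (\<rho> N t) \<le> C / \<mu> / real N" if N: "N \<ge> 1" and t: "cmod t = 1" for N t
  proof -
    have "t \<noteq> 0" "cmod t < 2" using t by auto
    have "cmod (polar r (cs t) * Li_remainder r K z N (cs t)) \<le> C / real N"
      using C[of "cs t" N] gen[OF \<open>t \<noteq> 0\<close> \<open>cmod t < 2\<close>] inB[OF t] N by simp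
    moreover have "polar r (cs t) * Li_remainder r K z N (cs t) = h t * \<rho> N t"
      using \<rho>_eq[OF N \<open>t \<noteq> 0\<close> \<open>cmod t < 2\<close>] h(3)[of t] t by simp
    ultimately have "cmod (h t) * cmod (\<rho> N t) \<le> C / real N" by (simp add: norm_mult)
    moreover have "\<mu> * cmod (\<rho> N t) \<le> cmod (h t) * cmod (\<rho> N t)" by (intro mult_right_mono \<mu>(2) t) auto
    ultimately have "\<mu> * cmod (\<rho> N t) \<le> C / real N" by linarith
    then have "cmod (\<rho> N t) \<le> C / real N / \<mu>" using \<mu>(1) by (simp only: pos_le_divide_eq mult.commute)
    then show ?thesis by (simp add: mult.commute)
  qed
  define S where "S = (\<lambda>N. fps_X ^ D * Abs_fps (log_coeff r z a w N))"
  define R where "R = (\<lambda>N. fps_expansion (\<rho> N) 0)"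
  have Rf: "\<rho> N has_fps_expansion R N" for N
    unfolding R_def by (rule has_fps_expansion_fps_expansion[OF _ _ \<rho>_hol]) auto
  have Sf: "S N = R N + (\<Sum>p\<in>T. fps_const (cst p N) * (\<Gamma> p * fps_exp (- (\<delta> p * of_real (ln (real N))))))" for N
  proof (rule fps_expansion_unique_complex)
    show "(\<lambda>t. t ^ D * nested_psum r z N (cs t)) has_fps_expansion S N"
      unfolding S_def cs_def by (intro fps_expansion_intros nested_psum_line_fps)
    have "(\<lambda>t. \<rho> N t + (\<Sum>p\<in>T. cst p N * (Q p t * exp (- (\<delta> p * of_real (ln (real N))) * t)))) has_fps_expansion
       (R N + (\<Sum>p\<in>T. fps_const (cst p N) * (\<Gamma> p * fps_exp (- (\<delta> p * of_real (ln (real N)))))))"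
      by (intro has_fps_expansion_add has_fps_expansion_sum has_fps_expansion_cmult_left has_fps_expansion_mult has_fps_expansion_exp Rf Qf)
    then show "(\<lambda>t. t ^ D * nested_psum r z N (cs t)) has_fps_expansion
       (R N + (\<Sum>p\<in>T. fps_const (cst p N) * (\<Gamma> p * fps_exp (- (\<delta> p * of_real (ln (real N)))))))"
      by (simp add: \<rho>_def)
  qed
  \<comment> \<open>Cauchy's inequality on |t| = 1 turns the uniform bound into decay of every
    single Taylor coefficient.\<close>
  have R0: "(\<lambda>N. fps_nth (R N) n) \<longlonglongrightarrow> 0" for n
  proof (rule Lim_null_comparison)
    show "\<forall>\<^sub>F N in sequentially. norm (fps_nth (R N) n) \<le> C / \<mu> / real N"
      using eventually_ge_at_top[of 1]
    proof eventually_elim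
      case (elim N)
      have "cmod ((deriv ^^ n) (\<rho> N) 0) \<le> fact n * (C / \<mu> / real N) / 1 ^ n"
      proof (rule Cauchy_inequality)
        show "\<rho> N holomorphic_on ball 0 1" by (rule holomorphic_on_subset[OF \<rho>_hol]) auto
        show "continuous_on (cball 0 1) (\<rho> N)"
          by (rule holomorphic_on_imp_continuous_on, rule holomorphic_on_subset[OF \<rho>_hol]) auto
        show "cmod (\<rho> N x) \<le> C / \<mu> / real N" if "cmod (0 - x) = 1" for x
          by (rule \<rho>_bound[OF elim]) (use that in simp)
      qed simp
      then show ?case unfolding fps_nth_fps_expansion[OF Rf] by (simp add: norm_divide field_simps)
    qed
    show "(\<lambda>N. C / \<mu> / real N) \<longlonglongrightarrow> 0" by (rule lim_const_over_n)
  qed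
  define \<Lambda> where "\<Lambda> = (\<lambda>n. \<Sum>p\<in>T. if e p = 0 \<and> \<xi> p = 1 then fps_nth (\<Gamma> p) n else 0)"
  have reg: "has_reg X (\<lambda>N. fps_nth (S N) n) (\<Lambda> n)" for n
  proof -
    have "has_reg X (\<lambda>N. fps_nth (R N) n + (\<Sum>p\<in>T. cst p N * fps_nth (\<Gamma> p * fps_exp (- (\<delta> p * of_real (ln (real N))))) n)) (0 + \<Lambda> n)"
      unfolding \<Lambda>_def cst_def
    proof (intro has_reg_add has_reg_null R0 has_reg_sum has_reg_fps_term X(1))
      fix p assume p: "p \<in> T"
      then show "\<xi> p \<in> X" by (auto simp: T_def \<xi>_def X_def intro: head_prod_in_monomial_vals)
      then show "cmod (\<xi> p) = 1" by (rule X1)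
    qed
    then show ?thesis by (simp add: Sf fps_sum_nth)
  qed
  have Snth: "fps_nth (S N) n = (if n < D then 0 else log_coeff r z a w N (n - D))" for N n
    by (simp add: S_def fps_X_power_mult_nth)
  \<comment> \<open>Below degree D the sequence of coefficients is identically 0, so uniqueness
    makes the polar parts of the selected terms cancel.\<close>
  have low: "\<Lambda> n = 0" if "n < D" for n
    by (rule has_reg_unique_0[OF X(1,2) P(1) X(3)]) (use reg[of n] that in \<open>simp_all add: Snth\<close>)
  define c where "c = (\<lambda>n. \<Lambda> (n + D))"
  have "has_reg X (\<lambda>N. log_coeff r z a w N n) (c n)" for n
    using reg[of "n + D"] by (simp add: Snth c_def)
  moreover have "(\<lambda>n. c n * t ^ n) sums Li_reg r z a (cs t)" if t: "t \<noteq> 0" "cmod t < 2" for t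
  proof -
    define L1 where "L1 = (\<lambda>t. \<Sum>p\<in>T. (if e p = 0 \<and> \<xi> p = 1 then 1 else 0) * Q p t)"
    have "L1 holomorphic_on ball 0 2" unfolding L1_def
      by (intro holomorphic_on_sum holomorphic_on_mult holomorphic_on_const Qh)
    then have hol: "L1 holomorphic_on eball 0 2" by simp
    have "L1 has_fps_expansion (\<Sum>p\<in>T. fps_const (if e p = 0 \<and> \<xi> p = 1 then 1 else 0) * \<Gamma> p)"
      unfolding L1_def by (intro has_fps_expansion_sum has_fps_expansion_cmult_left Qf)
    from has_fps_expansion_imp_sums_complex[OF this hol, of t] t
    have "(\<lambda>n. \<Lambda> n * t ^ n) sums L1 t"
      by (simp add: fps_sum_nth \<Lambda>_def if_distrib[of "\<lambda>x. x * _"] cong: if_cong)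
    from sums_split_initial_segment[OF this, of D]
    have "(\<lambda>n. \<Lambda> (n + D) * t ^ (n + D)) sums L1 t" by (simp add: low)
    from sums_divide[OF this, of "t ^ D"]
    have s: "(\<lambda>n. c n * t ^ n) sums (L1 t / t ^ D)" using t by (simp add: c_def power_add)
    have "L1 t = (\<Sum>p\<in>T. t ^ D * (if e p = 0 \<and> \<xi> p = 1 then LT p (cs t) else 0))"
      unfolding L1_def by (intro sum.cong refl) (simp add: Qt t)
    also have "\<dots> = t ^ D * (\<Sum>i\<le>r. \<Sum>k\<in>idx_box i K. if e (i, k) = 0 \<and> \<xi> (i, k) = 1 then LT (i, k) (cs t) else 0)"
      unfolding T_def sum_distrib_left[symmetric] by (subst sum.Sigma) auto
    also have "(\<Sum>i\<le>r. \<Sum>k\<in>idx_box i K. if e (i, k) = 0 \<and> \<xi> (i, k) = 1 then LT (i, k) (cs t) else 0) = Li_reg r z a (cs t)"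
      unfolding Li_reg_def
    proof (intro sum.cong refl)
      fix i assume i: "i \<in> {..r}"
      have "(\<Sum>k\<in>idx_box i K. if e (i, k) = 0 \<and> \<xi> (i, k) = 1 then LT (i, k) (cs t) else 0)
         = (\<Sum>k\<in>sel_idx i z a. if head_prod i z = 1 then LT (i, k) (cs t) else 0)"
        by (rule sum.mono_neutral_cong_right) (use sel_idx_eq_box[of i r a K z] i KK in \<open>auto simp: e_def \<xi>_def\<close>)
      then show "(\<Sum>k\<in>idx_box i K. if e (i, k) = 0 \<and> \<xi> (i, k) = 1 then LT (i, k) (cs t) else 0) =
        (if head_prod i z = 1 then Li_cont (r - i) (shiftn i z) (shiftn i (cs t)) * (\<Sum>k\<in>sel_idx i z a. tail_coeff i z (cs t) k) else 0)"
        by (simp add: LT_def sum_distrib_left)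
    qed
    finally show ?thesis using s t by simp
  qed
  ultimately show ?thesis unfolding X_def cs_def by blast
qed

section \<open>Extraction of the coefficients on a torus\<close>

text \<open>Discrete Fourier inversion. In total degree n each exponent is at most n, so the roots
  of unity of order n + 1 separate all monomials.\<close>

lemma torus_coefficient:
  fixes A :: "(nat \<Rightarrow> nat) \<Rightarrow> complex" and \<rho> :: "nat \<Rightarrow> complex"
  assumes k0: "k0 \<in> homog_idx r n"
  defines "u \<equiv> cis (2 * pi / real (Suc n))"
  shows "(\<Sum>j\<in>PiE {..<r} (\<lambda>_. {..<Suc n}). (\<Prod>i<r. cnj (u ^ j i) ^ k0 i) *
       (\<Sum>k\<in>homog_idx r n. A k * (\<Prod>i<r. (\<rho> i * u ^ j i) ^ k i)))
     = of_nat (Suc n) ^ r * (\<Prod>i<r. \<rho> i ^ k0 i) * A k0"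
proof -
  let ?J = "PiE {..<r} (\<lambda>_. {..<Suc n})"
  have le: "k i < Suc n" if "k \<in> homog_idx r n" "i < r" for k i
    using that member_le_sum[of i "{..<r}" k] by (auto simp: homog_idx_def less_Suc_eq_le)
  have inner: "(\<Sum>j\<in>?J. \<Prod>i<r. (u ^ j i) ^ k i * cnj (u ^ j i) ^ k0 i) = (if k = k0 then of_nat (Suc n) ^ r else 0)"
    if k: "k \<in> homog_idx r n" for k
  proof -
    have "(\<Sum>j\<in>?J. \<Prod>i<r. (u ^ j i) ^ k i * cnj (u ^ j i) ^ k0 i) = (\<Prod>i<r. \<Sum>x<Suc n. (u ^ x) ^ k i * cnj (u ^ x) ^ k0 i)"
      by (rule prod_sum_PiE[symmetric]) auto
    also have "\<dots> = (\<Prod>i<r. if k i = k0 i then of_nat (Suc n) else 0)"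
      unfolding u_def by (intro prod.cong refl sum_roots_unity_orthogonal) (use le k k0 in auto)
    also have "\<dots> = (if k = k0 then of_nat (Suc n) ^ r else 0)"
    proof (cases "k = k0")
      case False
      then obtain i where i: "k i \<noteq> k0 i" by auto
      then have "i < r" using k k0 by (cases "i < r") (auto simp: homog_idx_def multi_idx_def)
      have "(\<Prod>i<r. if k i = k0 i then of_nat (Suc n) else 0) = (0 :: complex)"
        by (rule prod_zero) (use i \<open>i < r\<close> in auto)
      then show ?thesis using False by simp
    qed simp
    finally show ?thesis .
  qed
  have "(\<Sum>j\<in>?J. (\<Prod>i<r. cnj (u ^ j i) ^ k0 i) * (\<Sum>k\<in>homog_idx r n. A k * (\<Prod>i<r. (\<rho> i * u ^ j i) ^ k i)))
    = (\<Sum>j\<in>?J. \<Sum>k\<in>homog_idx r n. A k * (\<Prod>i<r. \<rho> i ^ k i) * (\<Prod>i<r. (u ^ j i) ^ k i * cnj (u ^ j i) ^ k0 i))"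
    unfolding sum_distrib_left power_mult_distrib prod.distrib by (intro sum.cong refl) (simp only: mult_ac)
  also have "\<dots> = (\<Sum>k\<in>homog_idx r n. A k * (\<Prod>i<r. \<rho> i ^ k i) * (\<Sum>j\<in>?J. \<Prod>i<r. (u ^ j i) ^ k i * cnj (u ^ j i) ^ k0 i))"
    unfolding sum_distrib_left by (rule sum.swap)
  also have "\<dots> = (\<Sum>k\<in>homog_idx r n. if k = k0 then A k * (\<Prod>i<r. \<rho> i ^ k i) * of_nat (Suc n) ^ r else 0)"
  proof (rule sum.cong[OF refl])
    fix k assume k: "k \<in> homog_idx r n"
    show "A k * (\<Prod>i<r. \<rho> i ^ k i) * (\<Sum>j\<in>?J. \<Prod>i<r. (u ^ j i) ^ k i * cnj (u ^ j i) ^ k0 i)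
      = (if k = k0 then A k * (\<Prod>i<r. \<rho> i ^ k i) * of_nat (Suc n) ^ r else 0)"
      unfolding inner[OF k] by simp
  qed
  also have "\<dots> = of_nat (Suc n) ^ r * (\<Prod>i<r. \<rho> i ^ k0 i) * A k0"
    using k0 by (simp add: mult_ac)
  finally show ?thesis .
qed

text \<open>Radii decreasing so fast that no sum of consecutive coordinates vanishes on the torus.\<close>

definition torus_radius :: "nat \<Rightarrow> real" where
  "torus_radius i = (1/4) ^ (i + 2)"

lemma torus_radius_pos [simp]: "torus_radius i > 0"
  by (simp add: torus_radius_def)

lemma torus_radius_antimono: "i \<le> j \<Longrightarrow> torus_radius j \<le> torus_radius i"
  unfolding torus_radius_def by (rule power_decreasing) auto

lemma sum_torus_radius_le: "(\<Sum>t=m..<i. torus_radius t) \<le> 4/3 * torus_radius m"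
proof -
  have "(\<Sum>t=m..<m + n. torus_radius t) = 4/3 * (torus_radius m - torus_radius (m + n))" for n
  proof (induction n)
    case (Suc n)
    have "torus_radius (m + Suc n) = torus_radius (m + n) / 4" by (simp add: torus_radius_def)
    then show ?case using Suc by simp
  qed simp
  from this[of "i - m"] show ?thesis
    using less_imp_le[OF torus_radius_pos[of m]] less_imp_le[OF torus_radius_pos[of i]] by (cases "m \<le> i") auto
qed

lemma seg_sum_torus_upper:
  assumes "\<And>t. t < i \<Longrightarrow> cmod (w t) \<le> torus_radius t"
  shows "cmod (seg_sum j i w) \<le> 1/4"
proof -
  have "cmod (seg_sum j i w) \<le> (\<Sum>t=j..<i. torus_radius t)"
    unfolding seg_sum_def by (rule sum_norm_le) (use assms in auto)
  also have "\<dots> \<le> 4/3 * torus_radius j" by (rule sum_torus_radius_le)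
  also have "torus_radius j \<le> torus_radius 0" by (rule torus_radius_antimono) simp
  also have "4/3 * torus_radius 0 \<le> 1/4" by (simp add: torus_radius_def power2_eq_square)
  finally show ?thesis by simp
qed

text \<open>The first coordinate of the segment dominates: by the geometric sum the others
  contribute at most a third of its modulus.\<close>

lemma seg_sum_torus_lower:
  assumes w: "\<And>t. t < i \<Longrightarrow> cmod (w t) = torus_radius t" and ji: "j < i"
  shows "cmod (seg_sum j i w) \<ge> torus_radius i / 2"
proof -
  have split: "seg_sum j i w = w j + seg_sum (Suc j) i w"
    unfolding seg_sum_def using ji by (simp add: sum.atLeast_Suc_lessThan)
  have "cmod (seg_sum (Suc j) i w) \<le> (\<Sum>t=Suc j..<i. torus_radius t)"
    unfolding seg_sum_def by (rule sum_norm_le) (use w in auto)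
  also have "\<dots> \<le> 4/3 * torus_radius (Suc j)" by (rule sum_torus_radius_le)
  also have "\<dots> = torus_radius j / 3" by (simp add: torus_radius_def)
  finally have 1: "cmod (seg_sum (Suc j) i w) \<le> torus_radius j / 3" .
  have "cmod (w j) \<le> cmod (seg_sum j i w) + cmod (seg_sum (Suc j) i w)"
    unfolding split using norm_triangle_ineq4[of "w j + seg_sum (Suc j) i w" "seg_sum (Suc j) i w"] by simp
  then have "cmod (seg_sum j i w) \<ge> torus_radius j * (2/3)" using 1 w[OF ji] by simp
  moreover have "torus_radius i \<le> torus_radius j" using ji by (intro torus_radius_antimono) simp
  ultimately show ?thesis using torus_radius_pos[of j] by linarith
qed

definition torus :: "nat \<Rightarrow> (nat \<Rightarrow> complex) set" where
  "torus r = {w \<in> cspace r. \<forall>i<r. cmod (w i) = torus_radius i}"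

lemma torus_small_dir: "w \<in> torus r \<Longrightarrow> small_dir r w"
  unfolding small_dir_def
proof (intro conjI allI impI)
  assume w: "w \<in> torus r"
  show "w \<in> cspace r" using w by (simp add: torus_def)
  fix j i assume ji: "j < i" "i \<le> r"
  have t: "cmod (w t) = torus_radius t" if "t < i" for t using w ji that by (simp add: torus_def)
  show "seg_sum j i w \<noteq> 0" using seg_sum_torus_lower[of i w j] t ji torus_radius_pos[of i] by force
  show "cmod (seg_sum j i w) \<le> 1/4" by (rule seg_sum_torus_upper) (use t in simp)
qed

text \<open>On the torus each segment sum stays in a compact annulus around 0 of outer radius 1/4,
  where the shifted sine has no zero and hence a positive minimum modulus.\<close>

lemma polar_torus_lower_bound:
  obtains \<mu> where "\<mu> > 0" "\<And>w. w \<in> torus r \<Longrightarrow> cmod (polar r (cline (int_point r a) w 1)) \<ge> \<mu>"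
proof -
  define f where "f = (\<lambda>x y. cmod (sin (of_real pi * (of_int (\<Sum>t=fst x..<snd x. a t) + y))))"
  have "\<forall>x. \<exists>m. x \<in> seg_pairs r \<longrightarrow> m > 0 \<and> (\<forall>w\<in>torus r. m \<le> f x (seg_sum (fst x) (snd x) w))"
  proof
    fix x
    show "\<exists>m. x \<in> seg_pairs r \<longrightarrow> m > 0 \<and> (\<forall>w\<in>torus r. m \<le> f x (seg_sum (fst x) (snd x) w))"
    proof (cases "x \<in> seg_pairs r")
      case True
      then have x: "fst x < snd x" "snd x \<le> r" by (auto simp: seg_pairs_def)
      define S where "S = cball (0::complex) (1/4) - ball 0 (torus_radius (snd x) / 2)"
      have inS: "seg_sum (fst x) (snd x) w \<in> S" if w: "w \<in> torus r" for w
        using seg_sum_torus_lower[of "snd x" w "fst x"] small_dirD[OF torus_small_dir[OF w] x] w x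
        by (auto simp: S_def torus_def)
      show ?thesis
      proof (cases "S = {}")
        case True
        then show ?thesis using inS by (intro exI[of _ 1]) auto
      next
        case False
        have "compact S" unfolding S_def by (intro compact_diff compact_cball open_ball)
        moreover have "continuous_on S (f x)" unfolding f_def by (intro continuous_intros)
        ultimately obtain y0 where y0: "y0 \<in> S" "\<And>y. y \<in> S \<Longrightarrow> f x y0 \<le> f x y"
          using continuous_attains_inf[OF _ False] by blast
        have "y0 \<noteq> 0" "cmod y0 < 1" using y0(1) torus_radius_pos[of "snd x"] by (auto simp: S_def)
        then have "of_int (\<Sum>t=fst x..<snd x. a t) + y0 \<notin> \<int>" by (rule int_plus_small_notin_Ints)
        then have "f x y0 > 0" unfolding f_def using sin_pi_eq_0_iff[of "of_int (\<Sum>t=fst x..<snd x. a t) + y0"] by simp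
        then show ?thesis using y0(2) inS by blast
      qed
    qed simp
  qed
  from choice[OF this] obtain m where m: "\<And>x. x \<in> seg_pairs r \<Longrightarrow> m x > 0"
    "\<And>x w. x \<in> seg_pairs r \<Longrightarrow> w \<in> torus r \<Longrightarrow> m x \<le> f x (seg_sum (fst x) (snd x) w)" by blast
  show ?thesis
  proof (rule that[of "\<Prod>x\<in>seg_pairs r. m x"])
    show "(\<Prod>x\<in>seg_pairs r. m x) > 0" using m(1) by (intro prod_pos) auto
    fix w assume w: "w \<in> torus r"
    have "(\<Prod>x\<in>seg_pairs r. m x) \<le> (\<Prod>x\<in>seg_pairs r. f x (seg_sum (fst x) (snd x) w))"
      using m w by (intro prod_mono) (auto intro: less_imp_le)
    also have "\<dots> = cmod (polar r (cline (int_point r a) w 1))"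
      unfolding polar_def prod_norm[symmetric] case_prod_beta
    proof (rule prod.cong[OF refl])
      fix x assume "x \<in> seg_pairs r"
      then have "snd x \<le> r" by (auto simp: seg_pairs_def)
      then show "f x (seg_sum (fst x) (snd x) w) = cmod (sin (of_real pi * seg_sum (fst x) (snd x) (cline (int_point r a) w 1)))"
        by (simp add: f_def seg_sum_cline seg_sum_int_point)
    qed
    finally show "cmod (polar r (cline (int_point r a) w 1)) \<ge> (\<Prod>x\<in>seg_pairs r. m x)" .
  qed
qed

lemma extends_holo_polar_Li_reg:
  assumes z: "\<forall>i<r. cmod (z i) = 1"
  shows "extends_holo r (\<lambda>s. polar r s * Li_reg r z a s)"
proof -
  have t: "extends_holo r (\<lambda>s. polar r s * (Li_cont (r - i) (shiftn i z) (shiftn i s) * tail_coeff i z s k))" if i: "i \<le> r" for i k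
  proof (rule extends_holo_polar_Li_tail[OF _ i])
    have "\<forall>j<r - i. cmod (shiftn i z j) = 1" using z by (simp add: shiftn_def)
    then show "extends_holo (r - i) (\<lambda>s. polar (r - i) s * Li_cont (r - i) (shiftn i z) s)"
      using Li_expansion_holds[of "r - i"] unfolding Li_expansion_def by blast
  qed
  have "extends_holo r (\<lambda>s. \<Sum>i\<le>r. \<Sum>k\<in>sel_idx i z a. (if head_prod i z = 1 then 1 else 0) *
      (polar r s * (Li_cont (r - i) (shiftn i z) (shiftn i s) * tail_coeff i z s k)))"
    by (intro extends_holo_sum extends_holo_mult[OF extends_holo_const t]) auto
  then show ?thesis
  proof (rule extends_holo_cong)
    fix s
    show "(\<Sum>i\<le>r. \<Sum>k\<in>sel_idx i z a. (if head_prod i z = 1 then 1 else 0) *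
      (polar r s * (Li_cont (r - i) (shiftn i z) (shiftn i s) * tail_coeff i z s k))) = polar r s * Li_reg r z a s"
      unfolding Li_reg_def sum_distrib_left by (intro sum.cong refl) (simp add: sum_distrib_left)
  qed
qed

lemma Li_reg_torus_bound:
  assumes z: "\<forall>i<r. cmod (z i) = 1"
  obtains M where "\<And>w. w \<in> torus r \<Longrightarrow> cmod (Li_reg r z a (cline (int_point r a) w 1)) \<le> M"
proof -
  define B where "B = 1 + (\<Sum>i<r. cmod (int_point r a i) + torus_radius i)"
  obtain C where C: "\<And>s. s \<in> generic r \<inter> polydisc r (\<lambda>_. 0) B \<Longrightarrow> cmod (polar r s * Li_reg r z a s) \<le> C"
    using extends_holo_bound[OF extends_holo_polar_Li_reg[OF z, of a]] by blast
  obtain \<mu> where \<mu>: "\<mu> > 0" "\<And>w. w \<in> torus r \<Longrightarrow> cmod (polar r (cline (int_point r a) w 1)) \<ge> \<mu>"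
    using polar_torus_lower_bound[of r a] by blast
  show ?thesis
  proof (rule that[of "C / \<mu>"])
    fix w assume w: "w \<in> torus r"
    define s where "s = cline (int_point r a) w 1"
    have sg: "s \<in> generic r" unfolding s_def by (rule small_dir_generic[OF torus_small_dir[OF w]]) auto
    have "s \<in> polydisc r (\<lambda>_. 0) B"
      unfolding polydisc_iff
    proof (intro conjI allI impI)
      show "s \<in> cspace r" using sg generic_subset_cspace by blast
      fix i assume i: "i < r"
      have "cmod (s i) \<le> cmod (int_point r a i) + torus_radius i"
        unfolding s_def cline_def using norm_triangle_ineq[of "int_point r a i" "w i"] w i by (simp add: torus_def)
      also have "\<dots> \<le> (\<Sum>i<r. cmod (int_point r a i) + torus_radius i)"
        using i by (intro member_le_sum add_nonneg_nonneg) (auto intro: less_imp_le)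
      finally show "cmod (s i - 0) < B" by (simp add: B_def)
    qed
    with sg have "cmod (polar r s * Li_reg r z a s) \<le> C" by (intro C) simp
    moreover have "\<mu> * cmod (Li_reg r z a s) \<le> cmod (polar r s) * cmod (Li_reg r z a s)"
      unfolding s_def by (intro mult_right_mono \<mu>(2) w) auto
    ultimately have "\<mu> * cmod (Li_reg r z a s) \<le> C" by (simp add: norm_mult)
    then show "cmod (Li_reg r z a (cline (int_point r a) w 1)) \<le> C / \<mu>"
      using \<mu>(1) by (simp add: s_def pos_le_divide_eq mult.commute)
  qed
qed

lemma cline_scale: "cline p w t = cline p (\<lambda>i. t * w i) 1"
  by (simp add: cline_def)

text \<open>Cauchy's inequality on the unit circle. At t = 0, where g is not controlled, the value
  of the series is inserted.\<close>

lemma series_coeff_bound: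
  assumes s: "\<And>t. t \<noteq> 0 \<Longrightarrow> cmod t < 2 \<Longrightarrow> (\<lambda>n. c n * t ^ n) sums g t"
    and M: "\<And>t. cmod t = 1 \<Longrightarrow> cmod (g t) \<le> M"
  shows "cmod (c n) \<le> M"
proof -
  define f where "f = (\<lambda>t. if t = 0 then c 0 else g t)"
  have sf: "(\<lambda>n. c n * t ^ n) sums f t" if "cmod t < 2" for t
    using s[of t] that powser_sums_zero[of c] by (auto simp: f_def)
  have hol: "f holomorphic_on ball 0 2"
    by (rule power_series_holomorphic) (use sf in auto)
  have "f has_fps_expansion Abs_fps c"
  proof (rule has_fps_expansionI)
    have "eventually (\<lambda>t. t \<in> ball 0 (2::real)) (nhds (0::complex))" by (rule eventually_nhds_in_open) auto
    then show "eventually (\<lambda>t. (\<lambda>n. fps_nth (Abs_fps c) n * t ^ n) sums f t) (nhds 0)"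
      by eventually_elim (use sf in auto)
  qed
  from fps_nth_fps_expansion[OF this, of n] have cn: "c n = (deriv ^^ n) f 0 / fact n" by simp
  have "cmod ((deriv ^^ n) f 0) \<le> fact n * M / 1 ^ n"
  proof (rule Cauchy_inequality)
    show "f holomorphic_on ball 0 1" by (rule holomorphic_on_subset[OF hol]) auto
    show "continuous_on (cball 0 1) f"
      by (rule holomorphic_on_imp_continuous_on, rule holomorphic_on_subset[OF hol]) auto
    show "cmod (f x) \<le> M" if "cmod (0 - x) = 1" for x
      using M[of x] that by (auto simp: f_def)
  qed simp
  then show ?thesis unfolding cn by (simp add: norm_divide field_simps)
qed

definition reg_coeff :: "nat \<Rightarrow> (nat \<Rightarrow> complex) \<Rightarrow> (nat \<Rightarrow> int) \<Rightarrow> (nat \<Rightarrow> nat) \<Rightarrow> complex" where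
  "reg_coeff r z a k = (-1) ^ (\<Sum>i<r. k i) / (\<Prod>i<r. fact (k i)) * reg_value r z a k"

lemma log_coeff_eq_sum:
  "log_coeff r z a w N n = (\<Sum>k\<in>homog_idx r n. (-1) ^ n / (\<Prod>i<r. fact (k i)) * partial_sum r z a k N * (\<Prod>i<r. w i ^ k i))"
  unfolding log_coeff_def by (simp add: mult_ac)

lemma torus_point:
  "(\<lambda>i. if i < r then of_real (torus_radius i) * cis x ^ j i else 0) \<in> torus r"
  by (auto simp: torus_def cspace_def norm_mult norm_power less_imp_le)

text \<open>As \<open>reg_value\<close> is a choice, an expansion is required for each individual k.
  \<open>line_regularization\<close> supplies expansions of combinations over all k of one degree,
  in every torus direction; Fourier inversion over finitely many directions isolates a single
  k.\<close>

lemma reg_value_exists: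
  assumes P: "P > 0" "\<forall>i<r. z i ^ P = 1" and k: "k \<in> multi_idx r"
  shows "has_reg (monomial_vals r z) (partial_sum r z a k) (reg_value r z a k)"
proof -
  define X where "X = monomial_vals r z"
  define n where "n = (\<Sum>i<r. k i)"
  have kh: "k \<in> homog_idx r n" using k by (simp add: homog_idx_def n_def)
  define u where "u = cis (2 * pi / real (Suc n))"
  define wj where "wj = (\<lambda>j i. if i < r then of_real (torus_radius i) * u ^ j i else 0)"
  have "\<exists>c. has_reg X (\<lambda>N. log_coeff r z a (wj j) N n) c" for j
    proof -
    have "wj j \<in> torus r" unfolding wj_def u_def by (rule torus_point)
    from line_regularization[where P = P and r = r and z = z and w = "wj j" and a = a, OF P torus_small_dir[OF this]]
    show ?thesis unfolding X_def by (elim exE conjE) (rule exI, erule spec)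
  qed
  then have "\<forall>j. \<exists>c. has_reg X (\<lambda>N. log_coeff r z a (wj j) N n) c" by blast
  from choice[OF this] obtain c where c: "\<And>j. has_reg X (\<lambda>N. log_coeff r z a (wj j) N n) (c j)" by blast
  define \<beta> where "\<beta> = of_nat (Suc n) ^ r * (\<Prod>i<r. of_real (torus_radius i) ^ k i) * ((-1) ^ n / (\<Prod>i<r. fact (k i)) :: complex)"
  have \<beta>: "\<beta> \<noteq> 0" using torus_radius_pos by (simp add: \<beta>_def less_imp_neq[symmetric] del: of_nat_Suc)
  have "(\<Sum>j\<in>PiE {..<r} (\<lambda>_. {..<Suc n}). (\<Prod>i<r. cnj (u ^ j i) ^ k i) * log_coeff r z a (wj j) N n) = \<beta> * partial_sum r z a k N" for N
  proof -
    have "log_coeff r z a (wj j) N n = (\<Sum>k\<in>homog_idx r n. (-1) ^ n / (\<Prod>i<r. fact (k i)) * partial_sum r z a k N * (\<Prod>i<r. (of_real (torus_radius i) * u ^ j i) ^ k i))" for j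
      unfolding log_coeff_eq_sum by (intro sum.cong refl arg_cong2[where f = "(*)"] prod.cong) (auto simp: wj_def)
    then show ?thesis
      unfolding u_def using torus_coefficient[OF kh, of "\<lambda>k. (-1) ^ n / (\<Prod>i<r. fact (k i)) * partial_sum r z a k N" "\<lambda>i. of_real (torus_radius i)"]
      by (simp add: \<beta>_def mult_ac)
  qed
  moreover have "has_reg X (\<lambda>N. \<Sum>j\<in>PiE {..<r} (\<lambda>_. {..<Suc n}). (\<Prod>i<r. cnj (u ^ j i) ^ k i) * log_coeff r z a (wj j) N n)
     (\<Sum>j\<in>PiE {..<r} (\<lambda>_. {..<Suc n}). (\<Prod>i<r. cnj (u ^ j i) ^ k i) * c j)"
    by (intro has_reg_sum has_reg_cmult c)
  ultimately have "has_reg X (\<lambda>N. \<beta> * partial_sum r z a k N) (\<Sum>j\<in>PiE {..<r} (\<lambda>_. {..<Suc n}). (\<Prod>i<r. cnj (u ^ j i) ^ k i) * c j)" by simp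
  from has_reg_cmult[OF this, of "inverse \<beta>"] \<beta>
  have "has_reg X (partial_sum r z a k) (inverse \<beta> * (\<Sum>j\<in>PiE {..<r} (\<lambda>_. {..<Suc n}). (\<Prod>i<r. cnj (u ^ j i) ^ k i) * c j))"
    by (simp add: mult.assoc[symmetric])
  then have "reg_expansion r z a k (reg_value r z a k)"
    unfolding reg_value_def reg_expansion_iff_has_reg X_def by (rule someI)
  then show ?thesis by (simp add: reg_expansion_iff_has_reg)
qed

text \<open>Uniqueness of regularised values identifies the coefficients from
  \<open>line_regularization\<close> with the corresponding combinations of
  \<open>reg_value\<close>.\<close>

lemma Li_reg_line_series:
  assumes P: "P > 0" "\<forall>i<r. z i ^ P = 1" and w: "small_dir r w" and t: "t \<noteq> 0" "cmod t < 2"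
  shows "(\<lambda>n. (\<Sum>k\<in>homog_idx r n. reg_coeff r z a k * (\<Prod>i<r. w i ^ k i)) * t ^ n) sums Li_reg r z a (cline (int_point r a) w t)"
proof -
  define X where "X = monomial_vals r z"
  from line_regularization[where P = P and r = r and z = z and w = w and a = a, OF P w] obtain c where cc: "\<forall>n. has_reg (monomial_vals r z) (\<lambda>N. log_coeff r z a w N n) (c n)"
    "\<forall>t. t \<noteq> 0 \<longrightarrow> cmod t < 2 \<longrightarrow> (\<lambda>n. c n * t ^ n) sums Li_reg r z a (cline (int_point r a) w t)"
    by (elim exE conjE)
  then have c: "\<And>n. has_reg X (\<lambda>N. log_coeff r z a w N n) (c n)"
    "\<And>t. t \<noteq> 0 \<Longrightarrow> cmod t < 2 \<Longrightarrow> (\<lambda>n. c n * t ^ n) sums Li_reg r z a (cline (int_point r a) w t)"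
    unfolding X_def by simp_all
  have "c n = (\<Sum>k\<in>homog_idx r n. reg_coeff r z a k * (\<Prod>i<r. w i ^ k i))" for n
  proof (rule has_reg_unique[OF _ _ P(1) _ c(1)[of n]])
    show "finite X" unfolding X_def by (rule finite_monomial_vals) (use P in auto)
    show "1 \<in> X" unfolding X_def by (rule one_in_monomial_vals)
    show "\<xi> ^ P = 1" if "\<xi> \<in> X" for \<xi>
      using that unfolding X_def by (intro monomial_vals_power[of r z P \<xi>]) (use P in auto)
    have "has_reg X (\<lambda>N. \<Sum>k\<in>homog_idx r n. ((-1) ^ n / (\<Prod>i<r. fact (k i)) * (\<Prod>i<r. w i ^ k i)) * partial_sum r z a k N)
      (\<Sum>k\<in>homog_idx r n. ((-1) ^ n / (\<Prod>i<r. fact (k i)) * (\<Prod>i<r. w i ^ k i)) * reg_value r z a k)"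
      unfolding X_def by (intro has_reg_sum has_reg_cmult reg_value_exists[where P = P and r = r and z = z, OF P]) (auto simp: homog_idx_def)
    also have "(\<Sum>k\<in>homog_idx r n. ((-1) ^ n / (\<Prod>i<r. fact (k i)) * (\<Prod>i<r. w i ^ k i)) * reg_value r z a k)
      = (\<Sum>k\<in>homog_idx r n. reg_coeff r z a k * (\<Prod>i<r. w i ^ k i))"
      by (intro sum.cong refl) (auto simp: reg_coeff_def homog_idx_def)
    finally show "has_reg X (\<lambda>N. log_coeff r z a w N n) (\<Sum>k\<in>homog_idx r n. reg_coeff r z a k * (\<Prod>i<r. w i ^ k i))"
      unfolding log_coeff_def .
  qed
  then show ?thesis using c(2)[OF t] by simp
qed

text \<open>Cauchy estimates on the torus: each homogeneous part is bounded by M in every torus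
  direction, and Fourier inversion averages these values.\<close>

lemma reg_coeff_bound:
  assumes P: "P > 0" "\<forall>i<r. z i ^ P = 1"
  obtains M where "\<And>k. k \<in> multi_idx r \<Longrightarrow> cmod (reg_coeff r z a k) \<le> M / (\<Prod>i<r. torus_radius i ^ k i)"
proof -
  have zn: "\<forall>i<r. cmod (z i) = 1" using P power_eq_1_iff[of "z _" P] by blast
  obtain M where M: "\<And>w. w \<in> torus r \<Longrightarrow> cmod (Li_reg r z a (cline (int_point r a) w 1)) \<le> M"
    using Li_reg_torus_bound[OF zn, of a] by blast
  show ?thesis
  proof (rule that)
    fix k0 assume k0: "k0 \<in> multi_idx r"
    define n where "n = (\<Sum>i<r. k0 i)"
    have kh: "k0 \<in> homog_idx r n" using k0 by (simp add: homog_idx_def n_def)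
    define u where "u = cis (2 * pi / real (Suc n))"
    define H where "H = (\<lambda>j. \<Sum>k\<in>homog_idx r n. reg_coeff r z a k * (\<Prod>i<r. (of_real (torus_radius i) * u ^ j i) ^ k i))"
    have H: "cmod (H j) \<le> M" for j
    proof -
      define w where "w = (\<lambda>i. if i < r then of_real (torus_radius i) * u ^ j i else 0)"
      have w: "w \<in> torus r" unfolding w_def u_def by (rule torus_point)
      have "cmod (\<Sum>k\<in>homog_idx r n. reg_coeff r z a k * (\<Prod>i<r. w i ^ k i)) \<le> M"
      proof (rule series_coeff_bound[where c = "\<lambda>n. \<Sum>k\<in>homog_idx r n. reg_coeff r z a k * (\<Prod>i<r. w i ^ k i)"])
        show "(\<lambda>n. (\<Sum>k\<in>homog_idx r n. reg_coeff r z a k * (\<Prod>i<r. w i ^ k i)) * t ^ n) sums Li_reg r z a (cline (int_point r a) w t)"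
          if "t \<noteq> 0" "cmod t < 2" for t
          by (rule Li_reg_line_series[where P = P and r = r and z = z, OF P torus_small_dir[OF w] that])
        \<comment> \<open>Rotating a torus direction by t with |t| = 1 stays on the torus, so the
          bound at parameter 1 covers the unit circle.\<close>
        show "cmod (Li_reg r z a (cline (int_point r a) w t)) \<le> M" if "cmod t = 1" for t
          unfolding cline_scale[of _ w t] by (rule M) (use w that in \<open>auto simp: torus_def cspace_def norm_mult\<close>)
      qed
      also have "(\<Sum>k\<in>homog_idx r n. reg_coeff r z a k * (\<Prod>i<r. w i ^ k i)) = H j"
        unfolding H_def by (intro sum.cong refl arg_cong2[where f = "(*)"] prod.cong) (auto simp: w_def)
      finally show ?thesis .
    qed
    have un: "cmod u = 1" by (simp add: u_def)
    have "of_nat (Suc n) ^ r * (\<Prod>i<r. of_real (torus_radius i) ^ k0 i) * reg_coeff r z a k0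
      = (\<Sum>j\<in>PiE {..<r} (\<lambda>_. {..<Suc n}). (\<Prod>i<r. cnj (u ^ j i) ^ k0 i) * H j)"
      unfolding H_def u_def by (rule torus_coefficient[OF kh, symmetric])
    also have "cmod \<dots> \<le> (\<Sum>j\<in>PiE {..<r} (\<lambda>_. {..<Suc n}). M)"
      by (rule sum_norm_le) (simp add: norm_mult prod_norm[symmetric] norm_power un H)
    also have "\<dots> = real (Suc n) ^ r * M" by (simp add: card_PiE)
    finally have "real (Suc n) ^ r * ((\<Prod>i<r. torus_radius i ^ k0 i) * cmod (reg_coeff r z a k0)) \<le> real (Suc n) ^ r * M"
      using torus_radius_pos by (simp add: norm_mult prod_norm[symmetric] norm_power less_imp_le mult.assoc del: of_nat_Suc)
    then have "(\<Prod>i<r. torus_radius i ^ k0 i) * cmod (reg_coeff r z a k0) \<le> M"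
      by (rule mult_left_le_imp_le) simp
    moreover have "(\<Prod>i<r. torus_radius i ^ k0 i) > 0" by (intro prod_pos) simp
    ultimately show "cmod (reg_coeff r z a k0) \<le> M / (\<Prod>i<r. torus_radius i ^ k0 i)"
      by (simp add: pos_le_divide_eq mult.commute)
  qed
qed

lemma reg_coeff_summable:
  assumes P: "P > 0" "\<forall>i<r. z i ^ P = 1"
    and w: "\<And>i. i < r \<Longrightarrow> cmod (w i) < torus_radius i"
  shows "(\<lambda>k. reg_coeff r z a k * (\<Prod>i<r. w i ^ k i)) summable_on multi_idx r"
proof -
  obtain M where M: "\<And>k. k \<in> multi_idx r \<Longrightarrow> cmod (reg_coeff r z a k) \<le> M / (\<Prod>i<r. torus_radius i ^ k i)"
    using reg_coeff_bound[OF P, of a] by blast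
  have "(\<lambda>k. M * (\<Prod>i<r. (cmod (w i) / torus_radius i) ^ k i)) summable_on multi_idx r"
    by (intro summable_on_cmult_right has_sum_imp_summable[OF has_sum_geometric_multi])
       (use w in \<open>auto intro: divide_nonneg_pos\<close>)
  then have "(\<lambda>k. norm (reg_coeff r z a k * (\<Prod>i<r. w i ^ k i))) summable_on multi_idx r"
  proof (rule Infinite_Sum.abs_summable_on_comparison_test')
    fix k assume k: "k \<in> multi_idx r"
    have "norm (reg_coeff r z a k * (\<Prod>i<r. w i ^ k i)) \<le> M / (\<Prod>i<r. torus_radius i ^ k i) * (\<Prod>i<r. cmod (w i) ^ k i)"
      unfolding norm_mult prod_norm[symmetric] norm_power by (intro mult_right_mono M k prod_nonneg) auto
    also have "\<dots> = M * (\<Prod>i<r. (cmod (w i) / torus_radius i) ^ k i)"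
      by (simp add: power_divide prod_dividef)
    finally show "norm (reg_coeff r z a k * (\<Prod>i<r. w i ^ k i)) \<le> M * (\<Prod>i<r. (cmod (w i) / torus_radius i) ^ k i)" .
  qed
  then show ?thesis by (rule Infinite_Sum.abs_summable_summable)
qed

section \<open>The coefficients in closed form\<close>

lemma tail_exp_closed:
  "tail_exp i z k = (\<Sum>j<i. int (k j) - int (dq (head_prod (i - j) (shiftn j z))))"
proof (induction i arbitrary: z k)
  case (Suc i)
  have "tail_exp (Suc i) z k = (\<Sum>j<i. int (k (Suc j)) - int (dq (head_prod (i - j) (shiftn (Suc j) z)))) + (int (k 0) - int (dq (head_prod (Suc i) z)))"
    by (simp add: Suc.IH) (simp add: shiftn_def)
  also have "\<dots> = (\<Sum>j<Suc i. int (k j) - int (dq (head_prod (Suc i - j) (shiftn j z))))"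
    by (subst sum.lessThan_Suc_shift) simp
  finally show ?case .
qed simp

lemma tail_coeff_closed:
  "tail_coeff i z s k = (-1) ^ i * (\<Prod>j<i. em_coeff (head_prod (i - j) (shiftn j z)) (k j) *
     gpoch (seg_sum j i s + of_int (tail_exp (i - Suc j) (shiftn (Suc j) z) (shiftn (Suc j) k)))
       (int (k j) - int (dq (head_prod (i - j) (shiftn j z)))))"
proof (induction i arbitrary: z s k)
  case (Suc i)
  define f where "f = (\<lambda>j. em_coeff (head_prod (Suc i - j) (shiftn j z)) (k j) *
     gpoch (seg_sum j (Suc i) s + of_int (tail_exp (Suc i - Suc j) (shiftn (Suc j) z) (shiftn (Suc j) k)))
       (int (k j) - int (dq (head_prod (Suc i - j) (shiftn j z)))))"
  have "tail_coeff i (shiftn 1 z) (shiftn 1 s) (shiftn 1 k) = (-1) ^ i * (\<Prod>j<i. f (Suc j))"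
    unfolding Suc.IH f_def by (simp add: seg_sum_shiftn) (simp add: shiftn_def)
  moreover have "tail_coeff (Suc i) z s k = - f 0 * tail_coeff i (shiftn 1 z) (shiftn 1 s) (shiftn 1 k)"
    by (simp add: f_def)
  ultimately have "tail_coeff (Suc i) z s k = (-1) ^ Suc i * (f 0 * (\<Prod>j<i. f (Suc j)))" by simp
  also have "f 0 * (\<Prod>j<i. f (Suc j)) = (\<Prod>j<Suc i. f j)" by (subst prod.lessThan_Suc_shift) simp
  finally show ?case by (simp only: f_def)
qed simp

lemma head_prod_shiftn: "j \<le> i \<Longrightarrow> head_prod (i - j) (shiftn j z) = zprod z (Suc j) i"
  unfolding head_prod_def zprod_def shiftn_def
  by (rule prod.reindex_bij_witness[of _ "\<lambda>t. t - Suc j" "\<lambda>t. Suc (j + t)"]) auto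

lemma dq_head_prod: "j \<le> i \<Longrightarrow> dq (head_prod (i - j) (shiftn j z)) = qq z (Suc j) i"
  by (simp add: head_prod_shiftn dq_def qq_def)

lemma sum_shift_index: "(\<Sum>t\<in>{Suc m..i}. f t) = (\<Sum>j<i - m. f (Suc (m + j)))" for f :: "nat \<Rightarrow> 'a :: comm_monoid_add"
  by (rule sum.reindex_bij_witness[of _ "\<lambda>j. Suc (m + j)" "\<lambda>t. t - Suc m"]) auto

text \<open>This is the shift k_i + ... + k_(j+1) - Q_[j+1,i] inside the Pochhammer symbols of
  C_i.\<close>

lemma tail_exp_suffix:
  assumes "m \<le> i"
  shows "tail_exp (i - m) (shiftn m z) (shiftn m k) = (\<Sum>t\<in>{Suc m..i}. int (k (t - 1))) - int (QQ z (Suc m) i)"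
proof -
  have "tail_exp (i - m) (shiftn m z) (shiftn m k) = (\<Sum>j<i - m. int (k (m + j)) - int (qq z (Suc (m + j)) i))"
    unfolding tail_exp_closed
  proof (rule sum.cong[OF refl])
    fix j assume "j \<in> {..<i - m}"
    then have "m + j \<le> i" by auto
    moreover have "shiftn m k j = k (m + j)" by (simp add: shiftn_def)
    ultimately show "int (shiftn m k j) - int (dq (head_prod (i - m - j) (shiftn j (shiftn m z)))) = int (k (m + j)) - int (qq z (Suc (m + j)) i)"
      using dq_head_prod[of "m + j" i z] by (simp add: add.commute)
  qed
  then show ?thesis unfolding QQ_def sum_shift_index by (simp add: sum_subtractf)
qed

lemma prod_shift_index: "(\<Prod>t\<in>{1..i}. f t) = (\<Prod>j<i. f (Suc j))" for f :: "nat \<Rightarrow> 'a :: comm_monoid_mult"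
  by (rule prod.reindex_bij_witness[of _ Suc "\<lambda>t. t - 1"]) auto

text \<open>\<open>case_nat 0\<close> passes from 0-based to 1-based indices, with a 0 in the
  position that the 1-based tuples keep at 0.\<close>

lemma C_index_bij:
  assumes "i \<ge> 1"
  shows "bij_betw (\<lambda>k. case_nat 0 k) (sel_idx i z a) (C_index z a i)"
proof (rule bij_betw_byWitness[where f' = "shiftn 1"])
  have te: "tail_exp i z k = (\<Sum>t<i. int (k t)) - int (QQ z 1 i)" for k
    using tail_exp_suffix[of 0 i z k] sum_shift_index[of "\<lambda>t. int (k (t - 1))" 0 i] by simp
  have cond: "(\<Sum>t<i. a t) + tail_exp i z k = 0 \<longleftrightarrow> (\<Sum>t\<in>{1..i}. int (case_nat 0 k t) + a (t - 1)) = int (QQ z 1 i)" for k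
    using sum_shift_index[of "\<lambda>t. int (case_nat 0 k t) + a (t - 1)" 0 i] by (simp add: te sum.distrib) linarith
  have eq: "case_nat 0 (shiftn 1 k) = k" if "k 0 = 0" for k :: "nat \<Rightarrow> nat"
    using that by (auto simp: fun_eq_iff shiftn_def split: nat.splits)
  show "\<forall>k\<in>sel_idx i z a. shiftn 1 (case_nat 0 k) = k" by (simp add: shiftn_def)
  show "\<forall>k\<in>C_index z a i. case_nat 0 (shiftn 1 k) = k"
    using eq by (auto simp: C_index_def)
  show "case_nat 0 ` sel_idx i z a \<subseteq> C_index z a i"
  proof (rule image_subsetI)
    fix k assume k: "k \<in> sel_idx i z a"
    then have "(\<Sum>t\<in>{1..i}. int (case_nat 0 k t) + a (t - 1)) = int (QQ z 1 i)"
      using cond[of k] by (simp add: sel_idx_def)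
    moreover have "case_nat 0 k j = 0" if "j < 1 \<or> i < j" for j
      using k that by (auto simp: sel_idx_def split: nat.splits)
    ultimately show "case_nat 0 k \<in> C_index z a i" unfolding C_index_def by blast
  qed
  show "shiftn 1 ` C_index z a i \<subseteq> sel_idx i z a"
  proof (rule image_subsetI)
    fix k assume k: "k \<in> C_index z a i"
    then have k0: "k 0 = 0" by (auto simp: C_index_def)
    have "case_nat 0 (shiftn 1 k) = k" using k0 by (rule eq)
    then have "(\<Sum>t<i. a t) + tail_exp i z (shiftn 1 k) = 0"
      using cond[of "shiftn 1 k"] k by (simp only: C_index_def mem_Collect_eq)
    moreover have "shiftn 1 k j = 0" if "j \<ge> i" for j using k that by (auto simp: C_index_def shiftn_def)
    ultimately show "shiftn 1 k \<in> sel_idx i z a" unfolding sel_idx_def by blast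
  qed
qed

text \<open>Every Euler-Maclaurin step carries a minus sign, which accounts for (-1)^i. The factor
  q_[1,i] selects a trivial oscillation, and the products over \<open>JJ'\<close> and
  \<open>JJ\<close> are the two branches of \<open>em_coeff\<close>.\<close>

lemma C_coef_eq_tail_coeff:
  "(-1) ^ i * C_coef z a i s = (if head_prod i z = 1 then \<Sum>k\<in>sel_idx i z a. tail_coeff i z s k else 0)"
proof (cases "i = 0")
  case True
  have "sel_idx 0 z a = {\<lambda>_. 0}" by (auto simp: sel_idx_def)
  then show ?thesis using True by (simp add: C_coef_def head_prod_def)
next
  case False
  then have i: "i \<ge> 1" by simp
  define trm where "trm = (\<lambda>k :: nat \<Rightarrow> nat. (1 / (\<Prod>t\<in>{1..i}. fact (k t))) *
        (\<Prod>j\<in>JJ' z i. cnj (zprod z j i) * eulerian_star (k j) (cnj (zprod z j i)) / (cnj (zprod z j i) - 1) ^ (k j + 1)) *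
        (\<Prod>j\<in>JJ z i. bernoulli_star (k j)) *
        (\<Prod>j\<in>{1..i}. gpoch ((\<Sum>t\<in>{j..i}. s (t - 1)) + of_nat (\<Sum>t\<in>{j+1..i}. k t) - of_nat (QQ z (j+1) i)) (int (k j) - int (qq z j i))))"
  have trm: "tail_coeff i z s k = (-1) ^ i * trm (case_nat 0 k)" for k
  proof -
    define k' where "k' = case_nat 0 k"
    have k': "k' (Suc j) = k j" for j by (simp add: k'_def)
    define A where "A = (\<lambda>j. if zprod z j i = 1 then bernoulli_star (k' j) else cnj (zprod z j i) * eulerian_star (k' j) (cnj (zprod z j i)) / (cnj (zprod z j i) - 1) ^ (k' j + 1))"
    have em: "em_coeff (zprod z j i) (k' j) = A j / fact (k' j)" for j by (simp add: em_coeff_def A_def)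
    have "{1..i} = JJ' z i \<union> JJ z i" "JJ' z i \<inter> JJ z i = {}" "finite (JJ' z i)" "finite (JJ z i)"
      by (auto simp: JJ_def JJ'_def)
    then have "(\<Prod>j\<in>{1..i}. A j) = (\<Prod>j\<in>JJ' z i. A j) * (\<Prod>j\<in>JJ z i. A j)" by (simp add: prod.union_disjoint)
    also have "(\<Prod>j\<in>JJ z i. A j) = (\<Prod>j\<in>JJ z i. bernoulli_star (k' j))"
      by (rule prod.cong) (auto simp: A_def JJ_def)
    also have "(\<Prod>j\<in>JJ' z i. A j) = (\<Prod>j\<in>JJ' z i. cnj (zprod z j i) * eulerian_star (k' j) (cnj (zprod z j i)) / (cnj (zprod z j i) - 1) ^ (k' j + 1))"
      by (rule prod.cong) (auto simp: A_def JJ'_def)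
    finally have "trm k' = (\<Prod>j\<in>{1..i}. A j / fact (k' j)) * (\<Prod>j\<in>{1..i}. gpoch ((\<Sum>t\<in>{j..i}. s (t - 1)) + of_nat (\<Sum>t\<in>{j+1..i}. k' t) - of_nat (QQ z (j+1) i)) (int (k' j) - int (qq z j i)))"
      unfolding trm_def by (simp add: prod_dividef)
    also have "\<dots> = (\<Prod>j\<in>{1..i}. em_coeff (zprod z j i) (k' j) * gpoch ((\<Sum>t\<in>{j..i}. s (t - 1)) + of_nat (\<Sum>t\<in>{j+1..i}. k' t) - of_nat (QQ z (j+1) i)) (int (k' j) - int (qq z j i)))"
      by (simp only: em prod.distrib)
    also have "\<dots> = (\<Prod>j<i. em_coeff (zprod z (Suc j) i) (k' (Suc j)) * gpoch ((\<Sum>t\<in>{Suc j..i}. s (t - 1)) + of_nat (\<Sum>t\<in>{Suc j+1..i}. k' t) - of_nat (QQ z (Suc j+1) i)) (int (k' (Suc j)) - int (qq z (Suc j) i)))"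
      by (rule prod_shift_index)
    also have "\<dots> = (\<Prod>j<i. em_coeff (head_prod (i - j) (shiftn j z)) (k j) *
     gpoch (seg_sum j i s + of_int (tail_exp (i - Suc j) (shiftn (Suc j) z) (shiftn (Suc j) k)))
       (int (k j) - int (dq (head_prod (i - j) (shiftn j z)))))"
    proof (rule prod.cong[OF refl])
      fix j assume "j \<in> {..<i}"
      then have j: "j < i" by simp
      have 1: "(\<Sum>t\<in>{Suc j..i}. s (t - 1)) = seg_sum j i s"
        unfolding sum_shift_index seg_sum_def
        by (rule sum.reindex_bij_witness[of _ "\<lambda>t. t - j" "\<lambda>t. j + t"]) (use j in auto)
      have "(\<Sum>t\<in>{Suc (Suc j)..i}. int (k (t - 1))) = (\<Sum>t\<in>{Suc (Suc j)..i}. int (k' t))"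
        by (rule sum.cong) (auto simp: k'_def split: nat.splits)
      then have 2: "tail_exp (i - Suc j) (shiftn (Suc j) z) (shiftn (Suc j) k) = int (\<Sum>t\<in>{Suc j+1..i}. k' t) - int (QQ z (Suc j+1) i)"
        using tail_exp_suffix[of "Suc j" i z k] j by simp
      show "em_coeff (zprod z (Suc j) i) (k' (Suc j)) * gpoch ((\<Sum>t\<in>{Suc j..i}. s (t - 1)) + of_nat (\<Sum>t\<in>{Suc j+1..i}. k' t) - of_nat (QQ z (Suc j+1) i)) (int (k' (Suc j)) - int (qq z (Suc j) i))
         = em_coeff (head_prod (i - j) (shiftn j z)) (k j) *
           gpoch (seg_sum j i s + of_int (tail_exp (i - Suc j) (shiftn (Suc j) z) (shiftn (Suc j) k)))
             (int (k j) - int (dq (head_prod (i - j) (shiftn j z))))"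
        unfolding 1 2 k' using j dq_head_prod[of j i z] by (simp add: head_prod_shiftn add_diff_eq)
    qed
    finally show ?thesis unfolding tail_coeff_closed k'_def by simp
  qed
  have q: "of_nat (qq z 1 i) = (if head_prod i z = 1 then 1 else 0 :: complex)"
    using head_prod_shiftn[of 0 i z] by (simp add: qq_def)
  have "C_coef z a i s = (if head_prod i z = 1 then 1 else 0) * (\<Sum>k\<in>C_index z a i. trm k)"
    unfolding C_coef_def q trm_def using False by (simp only: if_False)
  then have "(-1) ^ i * C_coef z a i s = (if head_prod i z = 1 then 1 else 0) * (\<Sum>k\<in>C_index z a i. (-1) ^ i * trm k)"
    by (simp add: sum_distrib_left)
  also have "(\<Sum>k\<in>C_index z a i. (-1) ^ i * trm k) = (\<Sum>k\<in>sel_idx i z a. tail_coeff i z s k)"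
    unfolding trm by (rule sum.reindex_bij_betw[OF C_index_bij[OF i], symmetric])
  finally show ?thesis by simp
qed

lemma shift_vec_eq_shiftn: "s \<in> cspace r \<Longrightarrow> i \<le> r \<Longrightarrow> shift_vec r i s = shiftn i s"
  by (auto simp: shift_vec_def shiftn_def cspace_def fun_eq_iff)

text \<open>Each suffix polylogarithm brings its own open dense set; these are pulled back to all r
  variables and intersected one at a time.\<close>

lemma Li_reg_rhs_eq:
  assumes z: "\<forall>i<r. cmod (z i) = 1"
  obtains U where "open_dense r U" "U \<subseteq> generic r" "\<And>s. s \<in> U \<Longrightarrow> Li_reg_rhs r z a s = Li_reg r z a s"
proof -
  have "\<exists>U. open_dense (r - i) U \<and> (\<forall>s\<in>U. Li_mero (r - i) (shiftn i z) s = Li_cont (r - i) (shiftn i z) s)" for i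
  proof -
    have "\<forall>j<r - i. cmod (shiftn i z j) = 1" using z by (simp add: shiftn_def)
    then show ?thesis by (rule Li_mero_eq_Li_cont) blast
  qed
  then have "\<forall>i. \<exists>U. open_dense (r - i) U \<and> (\<forall>s\<in>U. Li_mero (r - i) (shiftn i z) s = Li_cont (r - i) (shiftn i z) s)" by (rule allI)
  from choice[OF this] obtain U where U: "\<And>i. open_dense (r - i) (U i)"
    "\<And>i s. s \<in> U i \<Longrightarrow> Li_mero (r - i) (shiftn i z) s = Li_cont (r - i) (shiftn i z) s" by blast
  define V where "V = (\<lambda>m. generic r \<inter> {s. \<forall>i<m. shiftn i s \<in> U i})"
  have V: "open_dense r (V m)" if "m \<le> Suc r" for m
    using that
  proof (induction m)
    case 0
    then show ?case by (simp add: V_def open_dense_generic)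
  next
    case (Suc m)
    then have m: "m + (r - m) = r" by simp
    have "open_dense r {s \<in> cspace r. shiftn m s \<in> U m}"
      using open_dense_shiftn[OF U(1)[of m], of m] unfolding m .
    moreover have "V (Suc m) = V m \<inter> {s \<in> cspace r. shiftn m s \<in> U m}"
      using generic_subset_cspace[of r] by (auto simp: V_def less_Suc_eq)
    ultimately show ?case using Suc by (simp add: open_dense_Int)
  qed
  show ?thesis
  proof (rule that[of "V (Suc r)"])
    show "open_dense r (V (Suc r))" by (rule V) simp
    show "V (Suc r) \<subseteq> generic r" by (auto simp: V_def)
    fix s assume s: "s \<in> V (Suc r)"
    have sc: "s \<in> cspace r" using s generic_subset_cspace[of r] by (auto simp: V_def)
    show "Li_reg_rhs r z a s = Li_reg r z a s"
      unfolding Li_reg_rhs_def Li_reg_def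
    proof (rule sum.cong[OF refl])
      fix i assume "i \<in> {..r}"
      then have i: "i \<le> r" by simp
      have "shiftn i s \<in> U i" using s i by (simp add: V_def)
      then have "Li_mero (r - i) (\<lambda>j. z (i + j)) (shift_vec r i s) = Li_cont (r - i) (shiftn i z) (shiftn i s)"
        unfolding shift_vec_eq_shiftn[OF sc i] using U(2) by (simp add: shiftn_def)
      then have "(-1) ^ i * Li_mero (r - i) (\<lambda>j. z (i + j)) (shift_vec r i s) * C_coef z a i s
        = Li_cont (r - i) (shiftn i z) (shiftn i s) * ((-1) ^ i * C_coef z a i s)" by simp
      then show "(-1) ^ i * Li_mero (r - i) (\<lambda>j. z (i + j)) (shift_vec r i s) * C_coef z a i s
        = (if head_prod i z = 1 then Li_cont (r - i) (shiftn i z) (shiftn i s) * (\<Sum>k\<in>sel_idx i z a. tail_coeff i z s k) else 0)"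
        unfolding C_coef_eq_tail_coeff by simp
    qed
  qed
qed

theorem theorem6:
  fixes r :: nat and z :: "nat \<Rightarrow> complex" and a :: "nat \<Rightarrow> int"
  assumes "r \<ge> 1"
    and "\<forall>i<r. \<exists>m>0. z i ^ m = 1"
  shows "\<exists>e>0. \<exists>F. c_meromorphic r F \<and>
           (\<forall>s\<in>polydisc r (\<lambda>i. if i < r then of_int (a i) else 0) e.
               (reg_series_term r z a s has_sum F s) (multi_idx r)) \<and>
           mero_eq r F (Li_reg_rhs r z a)"
proof -
  obtain P where P0: "P > 0" "\<And>i. i < r \<Longrightarrow> z i ^ P = 1" using common_order[OF assms(2)] by blast
  then have P: "P > 0" "\<forall>i<r. z i ^ P = 1" by auto
  have zn: "\<forall>i<r. cmod (z i) = 1" using P power_eq_1_iff[of "z _" P] by blast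
  define p where "p = int_point r a"
  \<comment> \<open>Below every \<open>torus_radius i\<close> with i < r, so the Cauchy bounds give
    absolute convergence on the polydisc.\<close>
  define e where "e = torus_radius r"
  have e: "e > 0" by (simp add: e_def)
  define D where "D = polydisc r p e"
  \<comment> \<open>Inside \<open>D\<close> the series must give the value at every point, including
    a itself where \<open>Li_reg\<close> is not controlled; outside, \<open>Li_reg\<close> provides
    the continuation.\<close>
  define F where "F = (\<lambda>s. if s \<in> D then \<Sum>\<^sub>\<infinity>k\<in>multi_idx r. reg_series_term r z a s k else Li_reg r z a s)"
  have term_eq: "reg_series_term r z a s = (\<lambda>k. reg_coeff r z a k * (\<Prod>i<r. (s i - p i) ^ k i))" for s
    by (simp add: reg_series_term_def reg_coeff_def p_def int_point_def fun_eq_iff)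
  have close: "cmod (s i - p i) < torus_radius i" if "s \<in> D" "i < r" for s i
    using that torus_radius_antimono[of i r] by (force simp: D_def polydisc_def e_def)
  have sums: "(reg_series_term r z a s has_sum F s) (multi_idx r)" if s: "s \<in> D" for s
  proof -
    have "reg_series_term r z a s summable_on multi_idx r"
      unfolding term_eq by (rule reg_coeff_summable[OF P]) (rule close[OF s])
    then show ?thesis using s by (simp add: F_def has_sum_infsum)
  qed
  have F_generic: "F s = Li_reg r z a s" if s: "s \<in> generic r" for s
  proof (cases "s \<in> D")
    case True
    define w where "w = (\<lambda>i. s i - p i)"
    have sw: "cline p w 1 = s" by (simp add: cline_def w_def)
    \<comment> \<open>Genericity of s makes the direction from a to s transversal, and the size of
      \<open>D\<close> makes it small; the series on this line at t = 1 then compares F with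
      \<open>Li_reg\<close> at s.\<close>
    have wd: "small_dir r w"
      unfolding small_dir_def
    proof (intro conjI allI impI)
      show "w \<in> cspace r" using s by (auto simp: w_def p_def int_point_def generic_def cspace_def)
      fix j i assume ji: "j < i" "i \<le> r"
      have "seg_sum j i s = of_int (\<Sum>t=j..<i. a t) + seg_sum j i w"
        using seg_sum_cline[of j i p w 1] ji unfolding sw by (simp add: p_def seg_sum_int_point)
      then show "seg_sum j i w \<noteq> 0" using genericD[OF s ji] by (metis Ints_of_int add.right_neutral)
      show "cmod (seg_sum j i w) \<le> 1/4"
        by (rule seg_sum_torus_upper) (use close[OF True] ji in \<open>auto simp: w_def intro: less_imp_le\<close>)
    qed
    have "(\<lambda>n. \<Sum>k\<in>homog_idx r n. reg_coeff r z a k * (\<Prod>i<r. w i ^ k i)) sums F s"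
      using has_sum_multi_idx_by_degree[OF sums[OF True]] unfolding term_eq w_def .
    moreover have "(\<lambda>n. \<Sum>k\<in>homog_idx r n. reg_coeff r z a k * (\<Prod>i<r. w i ^ k i)) sums Li_reg r z a s"
      using Li_reg_line_series[OF P wd, of 1 a] sw unfolding p_def by simp
    ultimately show ?thesis by (rule sums_unique2)
  qed (simp add: F_def)
  have "c_meromorphic r F"
    by (rule c_meromorphic_of_extends_holo[OF extends_holo_polar_Li_reg[OF zn, of a]]) (rule F_generic)
  moreover have "mero_eq r F (Li_reg_rhs r z a)"
  proof -
    obtain U where U: "open_dense r U" "U \<subseteq> generic r" "\<And>s. s \<in> U \<Longrightarrow> Li_reg_rhs r z a s = Li_reg r z a s"
      using Li_reg_rhs_eq[OF zn, of a] by blast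
    have "\<forall>s\<in>U. F s = Li_reg_rhs r z a s" using U F_generic by (metis subsetD)
    then show ?thesis using U(1) unfolding mero_eq_def open_dense_def by blast
  qed
  moreover have "\<forall>s\<in>polydisc r (\<lambda>i. if i < r then of_int (a i) else 0) e. (reg_series_term r z a s has_sum F s) (multi_idx r)"
    using sums unfolding D_def p_def int_point_def by blast
  ultimately show ?thesis using e by blast
qed

end
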